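(* Let $\mathbb K$ be a field and let $\mathfrak g$ be a simple classical Lie algebra over $\mathbb K$, that is, a simple Lie algebra which is one of $\mathfrak{sl}(V)$, $\mathfrak{so}(V)$, $\mathfrak{sp}(V)$ for a finite-dimensional $\mathbb K$-vector space $V$ (equipped with a non-degenerate symmetric, respectively skew-symmetric, bilinear form in the last two cases). Let $e\in\mathfrak g$ be a nilpotent element and let $k$ be the number of Jordan blocks of $e$ acting on $V$. Assume that $\mathbb K$ contains at least $k$ elements and, if $\mathfrak g$ is $\mathfrak{so}(V)$ or $\mathfrak{sp}(V)$, that $\operatorname{char}\mathbb K\neq 2$. Let $\mathfrak g_e$ be the centraliser of $e$ in $\mathfrak g$. Then $\operatorname{ind}\mathfrak g_e=\operatorname{rk}\mathfrak g$.
   Context: For a finite-dimensional Lie algebra $\mathfrak q$ over $\mathbb K$ and $\alpha\in\mathfrak q^*$, the stabiliser is $\mathfrak q_\alpha=\{\xi\in\mathfrak q:\alpha([\xi,\mathfrak q])=0\}$, and the index is $\operatorname{ind}\mathfrak q=\min_{\alpha\in\mathfrak q^*}\dim\mathfrak q_\alpha$. The ranks are $\operatorname{rk}\mathfrak{sl}(V)=\dim V-1$, $\operatorname{rk}\mathfrak{so}(V)=[\dim V/2]$ and $\operatorname{rk}\mathfrak{sp}(V)=\dim V/2$. *)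

theory Defs
  imports Complex_Main "HOL-Library.Function_Algebras"
begin

text \<open>
  A Lie algebra over \<open>'k\<close> is a subspace \<open>L\<close> of an ambient vector space, with a bracket that only
  matters on \<open>L\<close>.
\<close>

locale lie_algebra = vector_space scale
  for scale :: "'k::field \<Rightarrow> 'x::ab_group_add \<Rightarrow> 'x" (infixr "*s" 75) +
  fixes br :: "'x \<Rightarrow> 'x \<Rightarrow> 'x" and L :: "'x set"
  assumes subspace_L: "subspace L"
    and br_closed: "\<lbrakk>x \<in> L; y \<in> L\<rbrakk> \<Longrightarrow> br x y \<in> L"
    and br_add_left: "\<lbrakk>x \<in> L; y \<in> L; z \<in> L\<rbrakk> \<Longrightarrow> br (x + y) z = br x z + br y z"
    and br_add_right: "\<lbrakk>x \<in> L; y \<in> L; z \<in> L\<rbrakk> \<Longrightarrow> br x (y + z) = br x y + br x z"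
    and br_scale_left: "\<lbrakk>x \<in> L; y \<in> L\<rbrakk> \<Longrightarrow> br (c *s x) y = c *s br x y"
    and br_scale_right: "\<lbrakk>x \<in> L; y \<in> L\<rbrakk> \<Longrightarrow> br x (c *s y) = c *s br x y"
    and br_alternating: "x \<in> L \<Longrightarrow> br x x = 0"
    and jacobi: "\<lbrakk>x \<in> L; y \<in> L; z \<in> L\<rbrakk> \<Longrightarrow>
      br x (br y z) + br y (br z x) + br z (br x y) = 0"

locale simple_lie_algebra = lie_algebra scale br L
  for scale :: "'k::field \<Rightarrow> 'x::ab_group_add \<Rightarrow> 'x" (infixr "*s" 75)
    and br :: "'x \<Rightarrow> 'x \<Rightarrow> 'x" and L :: "'x set" +
  assumes not_abelian: "\<exists>x\<in>L. \<exists>y\<in>L. br x y \<noteq> 0"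
    and ideals_trivial: "\<lbrakk>subspace I; I \<subseteq> L; \<And>x y. \<lbrakk>x \<in> L; y \<in> I\<rbrakk> \<Longrightarrow> br x y \<in> I\<rbrakk> \<Longrightarrow>
      I = {0} \<or> I = L"

text \<open>
  The dual of \<open>L\<close> is represented by functions on the ambient space that are linear on \<open>L\<close>; their
  values outside \<open>L\<close> are irrelevant below.
\<close>

definition lie_dual :: "('k::field \<Rightarrow> 'x::ab_group_add \<Rightarrow> 'x) \<Rightarrow> 'x set \<Rightarrow> ('x \<Rightarrow> 'k) set" where
  "lie_dual scale L = {\<alpha>. (\<forall>x\<in>L. \<forall>y\<in>L. \<alpha> (x + y) = \<alpha> x + \<alpha> y) \<and>
                          (\<forall>c. \<forall>x\<in>L. \<alpha> (scale c x) = c * \<alpha> x)}"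

definition lie_stabiliser :: "('x \<Rightarrow> 'x \<Rightarrow> 'x) \<Rightarrow> 'x set \<Rightarrow> ('x \<Rightarrow> 'k::zero) \<Rightarrow> 'x set" where
  "lie_stabiliser br L \<alpha> = {\<xi>\<in>L. \<forall>\<eta>\<in>L. \<alpha> (br \<xi> \<eta>) = 0}"

definition lie_index ::
  "('k::field \<Rightarrow> 'x::ab_group_add \<Rightarrow> 'x) \<Rightarrow> ('x \<Rightarrow> 'x \<Rightarrow> 'x) \<Rightarrow> 'x set \<Rightarrow> nat" where
  "lie_index scale br L =
     (LEAST d. \<exists>\<alpha>\<in>lie_dual scale L. d = vector_space.dim scale (lie_stabiliser br L \<alpha>))"

definition lie_centraliser ::
  "('x \<Rightarrow> 'x \<Rightarrow> 'x::zero) \<Rightarrow> 'x set \<Rightarrow> 'x \<Rightarrow> 'x set" where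
  "lie_centraliser br L e = {x\<in>L. br x e = 0}"

text \<open>
  Endomorphisms of \<open>'v\<close> live in the function space \<open>'v \<Rightarrow> 'v\<close>, with addition and subtraction
  pointwise (\<open>Function_Algebras\<close>) and scalar multiplication given by \<open>endo_scale\<close>.
\<close>

definition endo_scale :: "('k \<Rightarrow> 'v \<Rightarrow> 'v) \<Rightarrow> 'k \<Rightarrow> ('v \<Rightarrow> 'v) \<Rightarrow> 'v \<Rightarrow> 'v" where
  "endo_scale scale c f = (\<lambda>v. scale c (f v))"

definition commutator :: "('v \<Rightarrow> 'v) \<Rightarrow> ('v \<Rightarrow> 'v) \<Rightarrow> 'v \<Rightarrow> 'v::ab_group_add" where
  "commutator f g = (\<lambda>v. f (g v) - g (f v))"

text \<open>
  The trace is read off in the basis \<open>Basis\<close> that comes with the finite-dimensional space; it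
  does not depend on that choice.
\<close>

definition endo_trace ::
  "('k::field \<Rightarrow> 'v::ab_group_add \<Rightarrow> 'v) \<Rightarrow> 'v set \<Rightarrow> ('v \<Rightarrow> 'v) \<Rightarrow> 'k" where
  "endo_trace scale Basis f = (\<Sum>b\<in>Basis. module.representation scale Basis (f b) b)"

definition nilpotent_endo :: "('v \<Rightarrow> 'v::zero) \<Rightarrow> bool" where
  "nilpotent_endo f \<longleftrightarrow> (\<exists>m. \<forall>v. (f ^^ m) v = 0)"

text \<open>
  A Jordan basis of a nilpotent \<open>e\<close> with \<open>k\<close> blocks of sizes \<open>d 0, \<dots>, d (k - 1)\<close>: the vectors
  \<open>e\<^sup>s (w i)\<close> with \<open>i < k\<close> and \<open>s < d i\<close> are pairwise distinct and form a basis, and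
  \<open>e\<close> kills the last vector of each chain. The number of blocks does not depend on the basis.
\<close>

definition jordan_basis ::
  "('k::field \<Rightarrow> 'v::ab_group_add \<Rightarrow> 'v) \<Rightarrow> ('v \<Rightarrow> 'v) \<Rightarrow> nat \<Rightarrow> (nat \<Rightarrow> nat) \<Rightarrow> (nat \<Rightarrow> 'v) \<Rightarrow> bool"
  where
  "jordan_basis scale e k d w \<longleftrightarrow>
     (let I = Sigma {..<k} (\<lambda>i. {..<d i}); b = (\<lambda>(i, s). (e ^^ s) (w i)) in
       (\<forall>i<k. d i > 0 \<and> (e ^^ d i) (w i) = 0) \<and>
       inj_on b I \<and> \<not> module.dependent scale (b ` I) \<and> module.span scale (b ` I) = UNIV)"

definition num_jordan_blocks ::
  "('k::field \<Rightarrow> 'v::ab_group_add \<Rightarrow> 'v) \<Rightarrow> ('v \<Rightarrow> 'v) \<Rightarrow> nat" where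
  "num_jordan_blocks scale e = (THE k. \<exists>d w. jordan_basis scale e k d w)"

definition bilinear_form ::
  "('k::field \<Rightarrow> 'v::ab_group_add \<Rightarrow> 'v) \<Rightarrow> ('v \<Rightarrow> 'v \<Rightarrow> 'k) \<Rightarrow> bool" where
  "bilinear_form scale B \<longleftrightarrow>
     (\<forall>v. Vector_Spaces.linear scale (*) (B v)) \<and>
     (\<forall>w. Vector_Spaces.linear scale (*) (\<lambda>v. B v w))"

definition nondegenerate :: "('v::zero \<Rightarrow> 'v \<Rightarrow> 'k::zero) \<Rightarrow> bool" where
  "nondegenerate B \<longleftrightarrow> (\<forall>v. (\<forall>w. B v w = 0) \<longrightarrow> v = 0)"

definition special_linear ::
  "('k::field \<Rightarrow> 'v::ab_group_add \<Rightarrow> 'v) \<Rightarrow> 'v set \<Rightarrow> ('v \<Rightarrow> 'v) set" where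
  "special_linear scale Basis =
     {f. Vector_Spaces.linear scale scale f \<and> endo_trace scale Basis f = 0}"

definition form_algebra ::
  "('k::field \<Rightarrow> 'v::ab_group_add \<Rightarrow> 'v) \<Rightarrow> ('v \<Rightarrow> 'v \<Rightarrow> 'k) \<Rightarrow> ('v \<Rightarrow> 'v) set" where
  "form_algebra scale B =
     {f. Vector_Spaces.linear scale scale f \<and> (\<forall>v w. B (f v) w + B v (f w) = 0)}"

text \<open>
  The constructor arguments are the bilinear forms on the vector space.
\<close>

datatype ('k, 'v) classical_type =
    SL
  | SO "'v \<Rightarrow> 'v \<Rightarrow> 'k"
  | SP "'v \<Rightarrow> 'v \<Rightarrow> 'k"

fun admissible_type ::
  "('k::field \<Rightarrow> 'v::ab_group_add \<Rightarrow> 'v) \<Rightarrow> ('k, 'v) classical_type \<Rightarrow> bool" where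
  "admissible_type scale SL \<longleftrightarrow> True"
| "admissible_type scale (SO B) \<longleftrightarrow>
     bilinear_form scale B \<and> nondegenerate B \<and> (\<forall>v w. B v w = B w v)"
| "admissible_type scale (SP B) \<longleftrightarrow>
     bilinear_form scale B \<and> nondegenerate B \<and> (\<forall>v w. B v w = - B w v)"

fun classical_algebra ::
  "('k::field \<Rightarrow> 'v::ab_group_add \<Rightarrow> 'v) \<Rightarrow> 'v set \<Rightarrow> ('k, 'v) classical_type \<Rightarrow> ('v \<Rightarrow> 'v) set"
  where
  "classical_algebra scale Basis SL = special_linear scale Basis"
| "classical_algebra scale Basis (SO B) = form_algebra scale B"
| "classical_algebra scale Basis (SP B) = form_algebra scale B"

fun classical_rank ::
  "('k::field \<Rightarrow> 'v::ab_group_add \<Rightarrow> 'v) \<Rightarrow> ('k, 'v) classical_type \<Rightarrow> nat" where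
  "classical_rank scale SL = vector_space.dim scale UNIV - 1"
| "classical_rank scale (SO B) = vector_space.dim scale UNIV div 2"
| "classical_rank scale (SP B) = vector_space.dim scale UNIV div 2"

end

theory Submission
  imports Defs "HOL-Computational_Algebra.Polynomial"
begin

text \<open>
  Lower bound. Write a functional on \<open>\<gg>\<^sub>e\<close> as \<open>\<alpha> = tr (X \<cdot>)\<close> with \<open>X\<close> in the matrix algebra. For a
  suitable polynomial matrix \<open>D\<close> the odd powers of \<open>Y = E + t X + s D\<close> are linearly independent
  over \<open>\<bbbK>(s, t)\<close>, already because their leading terms in \<open>s\<close> are, and they commute with \<open>Y\<close>; odd
  powers stay in the Lie algebra of a form. Saturating the module which they span and letting first
  \<open>s \<rightarrow> 0\<close> and then \<open>t \<rightarrow> 0\<close> gives equally many independent elements \<open>y\<close> such that \<open>[y, E] = 0\<close>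
  and \<open>[y, X] + [y', E] = 0\<close> for some \<open>y'\<close>; these stabilise \<open>\<alpha>\<close>.

  Upper bound. In a Jordan basis with generators \<open>w\<^sub>i\<close>, an element of \<open>\<gg>\<^sub>e\<close> is given by the
  coefficients of \<open>e\<^sup>s w\<^sub>j\<close> in the image of \<open>w\<^sub>m\<close>. For \<open>\<gg>\<ll>\<close> and \<open>\<ss>\<pp>\<close> the functional reads off the
  top coefficients on the diagonal, weighted by distinct field elements (this is where the size of
  the field is used), and the stabiliser equations force the off-diagonal coefficients to vanish.
  For \<open>\<ss>\<oo>\<close> the Jordan blocks of odd size are matched with each other, the next lower level
  contributes as well, and extra terms link some pairs of blocks of even size to the odd blocks.

  Passing from \<open>\<gg>\<ll>\<close> to \<open>\<ss>\<ll>\<close> costs exactly one dimension, since simplicity gives \<open>tr 1 \<noteq> 0\<close>.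
\<close>

section \<open>Limits of centralisers\<close>

text \<open>The lower bound replaces them by formal parameters: over \<open>'k poly poly\<close> a
  perturbation \<open>D\<close> whose entries are monomials of suitable degrees serves as a regular
  element over every field, and saturation of a module replaces the limit of subspaces.

  The upper bound is shaped by the behaviour of the functional under the adjoint. The weight on the
  diagonal of a block is tied to the weight on its dual block: for \<open>SP\<close> the two are
  opposite, for \<open>SO\<close> they are equal, and on a self-dual block of \<open>SO\<close> the
  weight is 0. Hence for \<open>SO\<close> the blocks of odd size need off-diagonal weights, and two
  dual blocks of even size can be told apart only by coefficients one level below the top. Where
  signs could make two weights collide, the weights are chosen with distinct squares, up to fixed
  factors. This costs two field elements per pair of blocks, which stays within the bound
  \<open>k\<close>.\<close>

definition independent_family :: "'j set \<Rightarrow> 'i set \<Rightarrow> ('j \<Rightarrow> 'i \<Rightarrow> 'a::comm_ring_1) \<Rightarrow> bool" where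
  "independent_family J I v \<longleftrightarrow>
    (\<forall>c. (\<forall>i\<in>I. (\<Sum>j\<in>J. c j * v j i) = 0) \<longrightarrow> (\<forall>j\<in>J. c j = 0))"

lemma independent_familyD:
  "\<lbrakk>independent_family J I v; \<And>i. i \<in> I \<Longrightarrow> (\<Sum>j\<in>J. c j * v j i) = 0; j \<in> J\<rbrakk> \<Longrightarrow> c j = 0"
  unfolding independent_family_def by blast

text \<open>\<open>P\<close> describes a module of vectors of polynomials that is closed under
  division by the variable. If the values at 0 are dependent, the same combination of the vectors
  themselves is divisible by the variable; its quotient lies in \<open>P\<close> and replaces one of
  them. The sum of the degree bounds \<open>N\<close> drops each time, so the process stops.\<close>

lemma saturation:
  fixes v :: "'j \<Rightarrow> 'i \<Rightarrow> 'a::idom poly"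
  assumes fin: "finite J" "finite I"
    and sums: "\<And>c f. (\<And>j. j \<in> J \<Longrightarrow> P (f j)) \<Longrightarrow> P (\<lambda>i. \<Sum>j\<in>J. c j * f j i)"
    and divs: "\<And>f g. P f \<Longrightarrow> (\<And>i. i \<in> I \<Longrightarrow> f i = pCons 0 (g i)) \<Longrightarrow> P g"
    and v: "\<And>j. j \<in> J \<Longrightarrow> P (v j)" and ind: "independent_family J I v"
  shows "\<exists>u. (\<forall>j\<in>J. P (u j)) \<and> independent_family J I (\<lambda>j i. poly (u j i) 0)"
proof -
  have main: "\<lbrakk>\<And>j. j \<in> J \<Longrightarrow> P (v j); independent_family J I v;
      \<And>j i. \<lbrakk>j \<in> J; i \<in> I\<rbrakk> \<Longrightarrow> degree (v j i) \<le> N j; sum N J = M\<rbrakk> \<Longrightarrow> ?thesis" for v N M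
  proof (induction M arbitrary: v N rule: less_induct)
    case (less M)
    show ?case
    proof (cases "independent_family J I (\<lambda>j i. poly (v j i) 0)")
      case True
      with less.prems show ?thesis by blast
    next
      case False
      then obtain c j1 where c: "\<And>i. i \<in> I \<Longrightarrow> (\<Sum>j\<in>J. c j * poly (v j i) 0) = 0"
        and j1: "j1 \<in> J" "c j1 \<noteq> 0"
        unfolding independent_family_def by blast
      let ?A = "{j\<in>J. c j \<noteq> 0}"
      have A: "finite (N ` ?A)" "N ` ?A \<noteq> {}" using fin j1 by auto
      \<comment> \<open>Among the vectors that occur in the relation, one with the largest degree
        bound is replaced, so that the quotient has a smaller bound than the vector it
        replaces.\<close>
      obtain j0 where j0: "j0 \<in> J" "c j0 \<noteq> 0" "N j0 = Max (N ` ?A)"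
        using imageE[OF Max_in[OF A]] by (metis (mono_tags, lifting) mem_Collect_eq)
      have mx: "N j \<le> N j0" if "j \<in> J" "c j \<noteq> 0" for j
        using j0(3) A that by simp
      define s where "s = (\<lambda>i. \<Sum>j\<in>J. [:c j:] * v j i)"
      define u0 where "u0 = (\<lambda>i. poly_shift 1 (s i))"
      have s0: "s i = pCons 0 (u0 i)" if "i \<in> I" for i
      proof -
        have "coeff (s i) 0 = 0"
          using c[OF that] by (simp add: s_def coeff_sum poly_0_coeff_0)
        then show ?thesis
          by (intro poly_eqI) (simp add: u0_def coeff_pCons coeff_poly_shift split: nat.split)
      qed
      have degs: "degree (s i) \<le> N j0" if "i \<in> I" for i
        unfolding s_def
      proof (rule degree_sum_le[OF fin(1)])
        fix j assume j: "j \<in> J"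
        show "degree ([:c j:] * v j i) \<le> N j0"
        proof (cases "c j = 0")
          case False
          have "degree ([:c j:] * v j i) \<le> degree (v j i)" by simp
          also have "\<dots> \<le> N j" using less.prems(3) j that by blast
          finally show ?thesis using mx[OF j False] by simp
        qed simp
      qed
      have Ps: "P s" unfolding s_def by (rule sums) (rule less.prems(1))
      have Pu: "P u0" using divs[OF Ps s0] .
      \<comment> \<open>Bound 0 would make \<open>s\<close> constant; being divisible by the
        variable, it would vanish, against the independence over the polynomials.\<close>
      have pos: "N j0 > 0"
      proof (rule ccontr)
        assume "\<not> N j0 > 0"
        then have "s i = 0" if "i \<in> I" for i
          using degs[OF that] s0[OF that] by (auto split: if_splits)
        then have "[:c j0:] = 0"
          using independent_familyD[OF less.prems(2), of "\<lambda>j. [:c j:]" j0] j0(1) by (simp add: s_def)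
        then show False using j0 by simp
      qed
      define v' where "v' = v(j0 := u0)"
      define N' where "N' = N(j0 := N j0 - 1)"
      have "sum N' J < sum N J"
        using pos j0(1) fin by (intro sum_strict_mono_ex1) (auto simp: N'_def)
      moreover have "P (v' j)" if "j \<in> J" for j
        using Pu less.prems(1) that by (simp add: v'_def)
      moreover have "degree (v' j i) \<le> N' j" if "j \<in> J" "i \<in> I" for j i
      proof (cases "j = j0")
        case True
        have "degree (u0 i) \<le> N j0 - 1"
          using degs[OF that(2)] s0[OF that(2)] by (auto split: if_splits)
        then show ?thesis using True by (simp add: v'_def N'_def)
      qed (use less.prems(3) that in \<open>simp add: v'_def N'_def\<close>)
      moreover have "independent_family J I v'"
        unfolding independent_family_def
      proof (intro allI impI)
        fix d assume d: "\<forall>i\<in>I. (\<Sum>j\<in>J. d j * v' j i) = 0"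
        \<comment> \<open>A relation \<open>d\<close> for the new family, multiplied by the
          variable, becomes the relation \<open>d'\<close> for the old one, since the variable times
          \<open>u0\<close> is \<open>s\<close>.\<close>
        define d' where "d' = (\<lambda>j. (if j = j0 then 0 else [:0,1:] * d j) + d j0 * [:c j:])"
        have "(\<Sum>j\<in>J. d' j * v j i) = 0" if i: "i \<in> I" for i
        proof -
          have sp: "(\<Sum>j\<in>J. d j * v' j i) = (\<Sum>j\<in>J-{j0}. d j * v j i) + d j0 * u0 i"
            by (subst sum.remove[OF fin(1) j0(1)]) (auto simp: v'_def intro: sum.cong)
          have "(\<Sum>j\<in>J. d' j * v j i) = (\<Sum>j\<in>J-{j0}. [:0,1:] * d j * v j i) + d j0 * s i"
          proof -
            have "(\<Sum>j\<in>J. (if j = j0 then 0 else [:0,1:] * d j) * v j i) =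
              (\<Sum>j\<in>J-{j0}. [:0,1:] * d j * v j i)"
              by (subst sum.remove[OF fin(1) j0(1)]) (auto intro: sum.cong)
            then show ?thesis
              by (simp add: d'_def distrib_right sum.distrib s_def sum_distrib_left mult.assoc
                  del: mult_pCons_left mult_pCons_right)
          qed
          also have "d j0 * s i = [:0,1:] * d j0 * u0 i" using s0[OF i] by (simp add: mult_ac)
          also have "(\<Sum>j\<in>J-{j0}. [:0,1:] * d j * v j i) + [:0,1:] * d j0 * u0 i =
            [:0,1:] * (\<Sum>j\<in>J. d j * v' j i)"
            by (simp add: sp sum_distrib_left distrib_left mult.assoc
                del: mult_pCons_left mult_pCons_right)
          finally show ?thesis using d i by simp
        qed
        then have z: "d' j = 0" if "j \<in> J" for j
          using independent_familyD[OF less.prems(2)] that by blast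
        have "d j0 = 0" using z[OF j0(1)] j0(2) by (simp add: d'_def)
        moreover from this have "d j = 0" if "j \<in> J" "j \<noteq> j0" for j
          using z[OF that(1)] that(2) by (simp add: d'_def)
        ultimately show "\<forall>j\<in>J. d j = 0" by blast
      qed
      ultimately show ?thesis
        using less.IH[of "sum N' J" v' N'] less.prems(4) by blast
    qed
  qed
  have "degree (v j i) \<le> Max ((\<lambda>i. degree (v j i)) ` I)" if "i \<in> I" for i j
    using fin that by simp
  then show ?thesis
    by (intro main[OF v ind, where N = "\<lambda>j. Max ((\<lambda>i. degree (v j i)) ` I)"]) auto
qed

text \<open>The size is an argument rather than a type because it is the dimension of a given space,
  and the entries run through \<open>'k\<close>, \<open>'k poly\<close> and
  \<open>'k poly poly\<close>. Only the summation index is bounded, which makes associativity an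
  equality of functions.\<close>

definition mmul :: "nat \<Rightarrow> (nat \<Rightarrow> nat \<Rightarrow> 'a::comm_ring_1) \<Rightarrow> (nat \<Rightarrow> nat \<Rightarrow> 'a) \<Rightarrow> nat \<Rightarrow> nat \<Rightarrow> 'a" where
  "mmul n A B = (\<lambda>i j. \<Sum>l<n. A i l * B l j)"

lemma mmul_assoc: "mmul n (mmul n A B) C = mmul n A (mmul n B C)"
proof (intro ext)
  fix i j
  show "mmul n (mmul n A B) C i j = mmul n A (mmul n B C) i j"
    unfolding mmul_def sum_distrib_left sum_distrib_right
    by (subst sum.swap) (simp add: mult.assoc)
qed

text \<open>The index \<open>j\<close> stands for the exponent 2j + 1.\<close>

primrec odd_power :: "nat \<Rightarrow> (nat \<Rightarrow> nat \<Rightarrow> 'a::comm_ring_1) \<Rightarrow> nat \<Rightarrow> nat \<Rightarrow> nat \<Rightarrow> 'a" where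
  "odd_power n A 0 = A"
| "odd_power n A (Suc j) = mmul n A (mmul n A (odd_power n A j))"

lemma odd_power_commute: "mmul n A (odd_power n A j) = mmul n (odd_power n A j) A"
  by (induction j) (simp_all, metis mmul_assoc)

text \<open>With the transpose written out, this is A^T G + G A = 0 for a Gram matrix
  \<open>G\<close>. For \<open>G\<close> = 0 every matrix qualifies, so that the general linear
  algebra is covered by the same lemmas.\<close>

definition skew_for :: "nat \<Rightarrow> (nat \<Rightarrow> nat \<Rightarrow> 'a::comm_ring_1) \<Rightarrow> (nat \<Rightarrow> nat \<Rightarrow> 'a) \<Rightarrow> bool" where
  "skew_for n G A \<longleftrightarrow> (\<forall>i<n. \<forall>j<n. (\<Sum>l<n. A l i * G l j) + (\<Sum>l<n. G i l * A l j) = 0)"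

text \<open>Each of the three factors \<open>A\<close>, \<open>A\<close> and \<open>?B\<close>
  changes sign when it moves across \<open>G\<close>, and three signs leave one. The factors arrive
  in reverse order, which \<open>comm\<close> repairs.\<close>

lemma skew_for_odd_power:
  assumes "skew_for n G A"
  shows "skew_for n G (odd_power n A j)"
proof (induction j)
  case (Suc j)
  let ?B = "odd_power n A j"
  have comm: "mmul n A (mmul n A ?B) = mmul n ?B (mmul n A A)"
    by (metis mmul_assoc odd_power_commute)
  have A: "(\<Sum>l<n. A l i * G l m) = - (\<Sum>l<n. G i l * A l m)" if "i < n" "m < n" for i m
    using assms that unfolding skew_for_def by (simp add: eq_neg_iff_add_eq_0)
  have B: "(\<Sum>l<n. ?B l i * G l m) = - (\<Sum>l<n. G i l * ?B l m)" if "i < n" "m < n" for i m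
    using Suc that unfolding skew_for_def by (simp add: eq_neg_iff_add_eq_0)
  have step: "(\<Sum>l<n. mmul n P Q l i * G l m) = (\<Sum>l<n. Q l i * (\<Sum>r<n. P r l * G r m))"
    for P Q :: "nat \<Rightarrow> nat \<Rightarrow> 'a" and i m
    unfolding mmul_def sum_distrib_left sum_distrib_right
    by (subst sum.swap) (simp add: mult_ac)
  show ?case unfolding skew_for_def
  proof (intro allI impI)
    fix i m assume im: "i < n" "m < n"
    have "(\<Sum>l<n. odd_power n A (Suc j) l i * G l m) =
       (\<Sum>l<n. mmul n A ?B l i * (\<Sum>r<n. A r l * G r m))"
      by (simp add: step)
    also have "\<dots> = (\<Sum>l<n. mmul n A ?B l i * - mmul n G A l m)"
      using A im by (intro sum.cong) (auto simp: mmul_def)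
    also have "\<dots> = - (\<Sum>l<n. mmul n A ?B l i * mmul n G A l m)" by (simp add: sum_negf)
    also have "(\<Sum>l<n. mmul n A ?B l i * mmul n G A l m) =
       (\<Sum>s<n. (\<Sum>l<n. mmul n A ?B l i * G l s) * A s m)"
      unfolding mmul_def[of n G A] sum_distrib_left sum_distrib_right
      by (subst sum.swap) (simp add: mult_ac)
    also have "\<dots> = (\<Sum>s<n. (\<Sum>l<n. ?B l i * (\<Sum>r<n. A r l * G r s)) * A s m)"
      by (simp add: step)
    also have "\<dots> = (\<Sum>s<n. (\<Sum>l<n. ?B l i * - mmul n G A l s) * A s m)"
      using A im by (intro sum.cong arg_cong2[where f="(*)"] refl) (auto simp: mmul_def)
    also have "\<dots> = - (\<Sum>s<n. (\<Sum>l<n. ?B l i * mmul n G A l s) * A s m)"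
      by (simp add: sum_negf)
    also have "(\<Sum>s<n. (\<Sum>l<n. ?B l i * mmul n G A l s) * A s m) =
      (\<Sum>s<n. (\<Sum>r<n. (\<Sum>l<n. ?B l i * G l r) * A r s) * A s m)"
    proof -
      have "(\<Sum>l<n. ?B l i * mmul n G A l s) = (\<Sum>r<n. (\<Sum>l<n. ?B l i * G l r) * A r s)" for s
        unfolding mmul_def[of n G A] sum_distrib_left sum_distrib_right
        by (subst sum.swap) (simp add: mult_ac)
      then show ?thesis by simp
    qed
    also have "\<dots> = (\<Sum>s<n. (\<Sum>r<n. - mmul n G ?B i r * A r s) * A s m)"
      using B[OF im(1)] by (intro sum.cong arg_cong2[where f="(*)"] refl) (auto simp: mmul_def)
    also have "\<dots> = - (\<Sum>s<n. (\<Sum>r<n. mmul n G ?B i r * A r s) * A s m)"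
      by (simp add: sum_negf)
    also have "(\<Sum>s<n. (\<Sum>r<n. mmul n G ?B i r * A r s) * A s m) =
        mmul n (mmul n (mmul n G ?B) A) A i m"
      by (simp only: mmul_def)
    also have "\<dots> = mmul n G (mmul n A (mmul n A ?B)) i m"
      unfolding comm by (simp add: mmul_assoc)
    finally show "(\<Sum>l<n. odd_power n A (Suc j) l i * G l m) +
       (\<Sum>l<n. G i l * odd_power n A (Suc j) l m) = 0"
      by (simp add: mmul_def[of n G])
  qed
qed (use assms in simp)

lemma sum_pCons:
  "(\<Sum>l\<in>A. pCons (f l) (p l)) = pCons (\<Sum>l\<in>A. f l) (\<Sum>l\<in>A. p l)"
  by (induction A rule: infinite_finite_induct) auto

lemma pderiv_sum: "pderiv (\<Sum>l\<in>A. p l) = (\<Sum>l\<in>A. pderiv (p l))"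
  by (induction A rule: infinite_finite_induct) (auto simp: pderiv_add)

lemma coeff_mult_top:
  assumes "degree p \<le> a" "degree q \<le> b"
  shows "coeff (p * q) (a + b) = coeff p a * coeff q b"
proof (cases "degree p = a \<and> degree q = b")
  case True
  then show ?thesis using coeff_mult_degree_sum[of p q] by simp
next
  case False
  then have "degree p < a \<or> degree q < b" using assms by linarith
  moreover from this have "degree (p * q) < a + b"
    using assms degree_mult_le[of p q] by linarith
  ultimately show ?thesis by (auto simp: coeff_eq_0)
qed

text \<open>The entries of \<open>Y\<close> are those of C + s D. Every factor raises the degree in
  s by at most one, and at the top degree only \<open>D\<close> contributes.\<close>

lemma odd_power_pencil:
  fixes C D :: "nat \<Rightarrow> nat \<Rightarrow> 'a::comm_ring_1"
  defines "Y \<equiv> \<lambda>i l. [:C i l, D i l:]"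
  shows "degree (odd_power n Y j i l) \<le> 2 * j + 1 \<and>
    coeff (odd_power n Y j i l) (2 * j + 1) = odd_power n D j i l"
proof (induction j arbitrary: i l)
  case (Suc j)
  have mult: "degree (mmul n Y B i l) \<le> Suc d \<and> coeff (mmul n Y B i l) (Suc d) = mmul n D Z i l"
    if B: "\<And>i l. degree (B i l) \<le> d \<and> coeff (B i l) d = Z i l" for B d Z i l
  proof -
    have "degree (Y i r * B r l) \<le> Suc d" for r
      by (rule order.trans[OF degree_mult_le]) (use B[of r l] in \<open>auto simp: Y_def\<close>)
    moreover have "coeff (Y i r * B r l) (Suc d) = D i r * Z r l" for r
      using B[of r l] by (simp add: Y_def coeff_eq_0)
    ultimately show ?thesis
      unfolding mmul_def by (auto simp: coeff_sum intro!: degree_sum_le sum.cong)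
  qed
  show ?case
    using mult[OF mult[of "odd_power n Y j", OF Suc]] by simp
qed (simp add: Y_def)

text \<open>In a relation with coefficients \<open>c j\<close>, compare the coefficients at the
  largest degree \<open>M\<close> that a product can reach. Only leading terms in s survive there,
  and they form a relation between the odd powers of \<open>D\<close>.\<close>

lemma odd_power_pencil_independent:
  fixes C D :: "nat \<Rightarrow> nat \<Rightarrow> 'a::idom"
  assumes ind: "independent_family {..<N} I (\<lambda>j (i, l). odd_power n D j i l)"
  shows "independent_family {..<N} I (\<lambda>j (i, l). odd_power n (\<lambda>i l. [:C i l, D i l:]) j i l)"
  unfolding independent_family_def
proof (intro allI impI, rule ccontr)
  let ?P = "odd_power n (\<lambda>i l. [:C i l, D i l:])"
  fix c :: "nat \<Rightarrow> 'a poly"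
  assume c: "\<forall>p\<in>I. (\<Sum>j<N. c j * (case p of (i, l) \<Rightarrow> ?P j i l)) = 0"
    and "\<not> (\<forall>j\<in>{..<N}. c j = 0)"
  then obtain j1 where j1: "j1 < N" "c j1 \<noteq> 0" by auto
  let ?A = "{j. j < N \<and> c j \<noteq> 0}"
  let ?g = "\<lambda>j. degree (c j) + (2 * j + 1)"
  define M where "M = Max (?g ` ?A)"
  have A: "finite (?g ` ?A)" "?g ` ?A \<noteq> {}" using j1 by auto
  have "M \<in> ?g ` ?A" unfolding M_def by (rule Max_in[OF A])
  then obtain j0 where j0: "j0 < N" "c j0 \<noteq> 0" "?g j0 = M" by blast
  have mx: "degree (c j) + (2 * j + 1) \<le> M" if "j < N" "c j \<noteq> 0" for j
    unfolding M_def using that by (intro Max_ge[OF A(1)] image_eqI[where x=j]) auto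
  \<comment> \<open>The case distinction guards against truncated subtraction; if \<open>c j\<close>
    is nonzero, then \<open>2 * j + 1 \<le> M\<close> holds.\<close>
  define b where "b = (\<lambda>j. if 2 * j + 1 \<le> M then coeff (c j) (M - (2 * j + 1)) else 0)"
  have top: "coeff (c j * ?P j i l) M = b j * odd_power n D j i l" if "j < N" for j i l
  proof (cases "c j = 0")
    case False
    note pc = odd_power_pencil[of n C D j i l] and m = mx[OF that False]
    have M: "M - (2 * j + 1) + (2 * j + 1) = M" using m by linarith
    have "coeff (c j * ?P j i l) M = coeff (c j * ?P j i l) (M - (2 * j + 1) + (2 * j + 1))"
      unfolding M ..
    also have "\<dots> = coeff (c j) (M - (2 * j + 1)) * coeff (?P j i l) (2 * j + 1)"
    proof (rule coeff_mult_top)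
      show "degree (c j) \<le> M - (2 * j + 1)" using m by linarith
      show "degree (?P j i l) \<le> 2 * j + 1" using pc by (rule conjunct1)
    qed
    also have "\<dots> = b j * odd_power n D j i l"
    proof -
      have "2 * j + 1 \<le> M" using m by linarith
      then have "b j = coeff (c j) (M - (2 * j + 1))" unfolding b_def by (rule if_P)
      then show ?thesis using conjunct2[OF pc] by (simp only:)
    qed
    finally show ?thesis .
  qed (simp add: b_def)
  have "(\<Sum>j<N. b j * (case p of (i, l) \<Rightarrow> odd_power n D j i l)) = 0" if "p \<in> I" for p
  proof -
    have "coeff (\<Sum>j<N. c j * (case p of (i, l) \<Rightarrow> ?P j i l)) M = 0" using c that by simp
    then show ?thesis using top by (cases p) (simp add: coeff_sum)
  qed
  then have "b j0 = 0"
    using independent_familyD[OF ind, of b j0] j0(1) by simp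
  moreover have "b j0 = lead_coeff (c j0)" using j0(3) by (auto simp: b_def)
  ultimately show False using j0(2) by simp
qed

text \<open>The matrix \<open>f\<close> is a function on index pairs, the shape of the vectors in
  \<open>saturation\<close>; this is the module whose limits are taken.\<close>

definition skew_commuting ::
  "nat \<Rightarrow> (nat \<Rightarrow> nat \<Rightarrow> 'a::comm_ring_1) \<Rightarrow> (nat \<Rightarrow> nat \<Rightarrow> 'a) \<Rightarrow> (nat \<times> nat \<Rightarrow> 'a) \<Rightarrow> bool" where
  "skew_commuting n G Y f \<longleftrightarrow> (\<forall>i<n. \<forall>l<n.
    (\<Sum>r<n. Y i r * f (r, l)) = (\<Sum>r<n. f (i, r) * Y r l) \<and>
    (\<Sum>r<n. f (r, i) * G r l) + (\<Sum>r<n. G i r * f (r, l)) = 0)"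

lemma skew_commuting_sum:
  assumes that: "\<And>j. j \<in> J \<Longrightarrow> skew_commuting n H Z (f j)"
  shows "skew_commuting n H Z (\<lambda>p. \<Sum>j\<in>J. c j * f j p)"
  unfolding skew_commuting_def
  proof (intro allI impI conjI)
    fix i l assume il: "i < n" "l < n"
    have "(\<Sum>r<n. Z i r * (\<Sum>j\<in>J. c j * f j (r, l))) = (\<Sum>j\<in>J. c j * (\<Sum>r<n. Z i r * f j (r, l)))"
      unfolding sum_distrib_left by (subst sum.swap) (simp add: mult_ac)
    also have "\<dots> = (\<Sum>j\<in>J. c j * (\<Sum>r<n. f j (i, r) * Z r l))"
      using that il unfolding skew_commuting_def by (intro sum.cong) auto
    also have "\<dots> = (\<Sum>r<n. (\<Sum>j\<in>J. c j * f j (i, r)) * Z r l)"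
      unfolding sum_distrib_left sum_distrib_right by (subst sum.swap) (simp add: mult_ac)
    finally show "(\<Sum>r<n. Z i r * (\<Sum>j\<in>J. c j * f j (r, l))) =
      (\<Sum>r<n. (\<Sum>j\<in>J. c j * f j (i, r)) * Z r l)" .
    have "(\<Sum>r<n. (\<Sum>j\<in>J. c j * f j (r, i)) * H r l) + (\<Sum>r<n. H i r * (\<Sum>j\<in>J. c j * f j (r, l))) =
      (\<Sum>j\<in>J. c j * ((\<Sum>r<n. f j (r, i) * H r l) + (\<Sum>r<n. H i r * f j (r, l))))"
      unfolding sum_distrib_left sum_distrib_right distrib_left sum.distrib
      by (subst (1 2) sum.swap) (simp add: mult_ac)
    also have "\<dots> = 0" using that il unfolding skew_commuting_def by (intro sum.neutral) auto
    finally show "(\<Sum>r<n. (\<Sum>j\<in>J. c j * f j (r, i)) * H r l) +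
      (\<Sum>r<n. H i r * (\<Sum>j\<in>J. c j * f j (r, l))) = 0" .
  qed

text \<open>Both conditions are homogeneous and linear in the matrix, and the variable can be
  cancelled over a domain.\<close>

lemma skew_commuting_divide:
  fixes H Z :: "nat \<Rightarrow> nat \<Rightarrow> 'a::idom poly"
  assumes f: "skew_commuting n H Z f"
    and fg: "\<And>p. p \<in> {..<n} \<times> {..<n} \<Longrightarrow> f p = pCons 0 (g p)"
  shows "skew_commuting n H Z g"
  unfolding skew_commuting_def
  proof (intro allI impI conjI)
    fix i l assume il: "i < n" "l < n"
    have fg': "f (r, s) = [:0, 1:] * g (r, s)" if "r < n" "s < n" for r s
      using fg[of "(r, s)"] that by simp
    have "[:0, 1:] * ((\<Sum>r<n. Z i r * g (r, l)) - (\<Sum>r<n. g (i, r) * Z r l)) =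
      (\<Sum>r<n. Z i r * f (r, l)) - (\<Sum>r<n. f (i, r) * Z r l)"
      unfolding right_diff_distrib sum_distrib_left
      using il fg' by (intro arg_cong2[where f="(-)"] sum.cong) (auto simp: mult_ac)
    also have "\<dots> = 0" using f il unfolding skew_commuting_def by simp
    finally show "(\<Sum>r<n. Z i r * g (r, l)) = (\<Sum>r<n. g (i, r) * Z r l)" by simp
    have "[:0, 1:] * ((\<Sum>r<n. g (r, i) * H r l) + (\<Sum>r<n. H i r * g (r, l))) =
      (\<Sum>r<n. f (r, i) * H r l) + (\<Sum>r<n. H i r * f (r, l))"
      unfolding distrib_left sum_distrib_left
      using il fg' by (intro arg_cong2[where f="(+)"] sum.cong) (auto simp: mult_ac)
    also have "\<dots> = 0" using f il unfolding skew_commuting_def by simp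
    finally show "(\<Sum>r<n. g (r, i) * H r l) + (\<Sum>r<n. H i r * g (r, l)) = 0" by simp
  qed

text \<open>
  The first-order part of the limit \<open>t \<rightarrow> 0\<close> of the centraliser of \<open>E + t X\<close>; the term
  \<open>s D\<close> makes the odd powers of \<open>E + t X + s D\<close> independent, and \<open>s\<close> is sent to \<open>0\<close> first.
\<close>

lemma limit_of_centralisers:
  fixes E X G :: "nat \<Rightarrow> nat \<Rightarrow> 'k::field" and D :: "nat \<Rightarrow> nat \<Rightarrow> 'k poly"
  assumes E: "skew_for n G E" and X: "skew_for n G X"
    and D: "skew_for n (\<lambda>i l. [:G i l:]) D"
    and ind: "independent_family {..<N} ({..<n} \<times> {..<n}) (\<lambda>j (i, l). odd_power n D j i l)"
  shows "\<exists>y y'. independent_family {..<N} ({..<n} \<times> {..<n}) (\<lambda>j (i, l). y j i l) \<and>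
    (\<forall>j<N. skew_for n G (y j) \<and>
      (\<forall>i<n. \<forall>l<n. mmul n E (y j) i l = mmul n (y j) E i l \<and>
        mmul n X (y j) i l + mmul n E (y' j) i l = mmul n (y j) X i l + mmul n (y' j) E i l))"
proof -
  let ?I = "{..<n} \<times> {..<n}"
  \<comment> \<open>\<open>C\<close> is E + t X over \<open>'k poly\<close> and \<open>Y\<close> is
    C + s D over \<open>'k poly poly\<close>: the outer variable is s, the inner one t.\<close>
  define C where "C = (\<lambda>i l. [:E i l, X i l:])"
  define Y where "Y = (\<lambda>i l. [:C i l, D i l:])"
  have "skew_for n (\<lambda>i l. [:[:G i l:]:]) Y"
  proof -
    have e: "(\<Sum>l<n. Y l i * [:[:G l j:]:]) + (\<Sum>l<n. [:[:G i l:]:] * Y l j) =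
      [:[:(\<Sum>l<n. E l i * G l j) + (\<Sum>l<n. G i l * E l j),
         (\<Sum>l<n. X l i * G l j) + (\<Sum>l<n. G i l * X l j):],
       (\<Sum>l<n. D l i * [:G l j:]) + (\<Sum>l<n. [:G i l:] * D l j):]" for i j
      by (simp add: Y_def C_def sum_pCons mult.commute)
    show ?thesis unfolding skew_for_def e
      using E X D by (simp add: skew_for_def)
  qed
  note skY = skew_for_odd_power[OF this]
  have "skew_commuting n (\<lambda>i l. [:[:G i l:]:]) Y (\<lambda>(i, l). odd_power n Y j i l)" for j
    using skY[of j] fun_cong[OF fun_cong[OF odd_power_commute[of n Y j]]]
    unfolding skew_commuting_def skew_for_def mmul_def by auto
  then have "\<exists>u. (\<forall>j\<in>{..<N}. skew_commuting n (\<lambda>i l. [:[:G i l:]:]) Y (u j)) \<and>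
      independent_family {..<N} ?I (\<lambda>j i. poly (u j i) 0)"
    by (intro saturation[where v = "\<lambda>j (i, l). odd_power n Y j i l"] skew_commuting_sum
        odd_power_pencil_independent[OF ind, of C, folded Y_def])
      (auto intro: skew_commuting_divide)
  then obtain u where u: "\<And>j. j < N \<Longrightarrow> skew_commuting n (\<lambda>i l. [:[:G i l:]:]) Y (u j)"
      "independent_family {..<N} ?I (\<lambda>j i. poly (u j i) 0)"
    by auto
  have "skew_commuting n (\<lambda>i l. [:G i l:]) C (\<lambda>p. poly (u j p) 0)" if "j < N" for j
    unfolding skew_commuting_def
  proof (intro allI impI conjI)
    fix i l assume il: "i < n" "l < n"
    have "poly (\<Sum>r<n. Y i r * u j (r, l)) 0 = poly (\<Sum>r<n. u j (i, r) * Y r l) 0"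
      using u(1)[OF that] il unfolding skew_commuting_def by simp
    then show "(\<Sum>r<n. C i r * poly (u j (r, l)) 0) = (\<Sum>r<n. poly (u j (i, r)) 0 * C r l)"
      by (simp add: poly_sum Y_def mult.commute)
    have "poly ((\<Sum>r<n. u j (r, i) * [:[:G r l:]:]) + (\<Sum>r<n. [:[:G i r:]:] * u j (r, l))) 0 = 0"
      using u(1)[OF that] il unfolding skew_commuting_def by simp
    then show "(\<Sum>r<n. poly (u j (r, i)) 0 * [:G r l:]) + (\<Sum>r<n. [:G i r:] * poly (u j (r, l)) 0) = 0"
      by (simp only: poly_sum poly_add poly_mult poly_pCons poly_0) simp
  qed
  \<comment> \<open>The second saturation takes place in t and starts from the independent family
    that the first one left at s = 0.\<close>
  then have "\<exists>z. (\<forall>j\<in>{..<N}. skew_commuting n (\<lambda>i l. [:G i l:]) C (z j)) \<and>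
      independent_family {..<N} ?I (\<lambda>j i. poly (z j i) 0)"
    by (intro saturation[where v = "\<lambda>j p. poly (u j p) 0"] skew_commuting_sum u(2)) (auto intro: skew_commuting_divide)
  then obtain z where z: "\<And>j. j < N \<Longrightarrow> skew_commuting n (\<lambda>i l. [:G i l:]) C (z j)"
      "independent_family {..<N} ?I (\<lambda>j i. poly (z j i) 0)"
    by auto
  define y where "y = (\<lambda>j i l. poly (z j (i, l)) 0)"
  \<comment> \<open>\<open>y'\<close> is the derivative at t = 0: differentiating the commutation of
    \<open>C\<close> with \<open>z j\<close> gives the first-order condition on
    \<open>y\<close>.\<close>
  define y' where "y' = (\<lambda>j i l. poly (pderiv (z j (i, l))) 0)"
  have "independent_family {..<N} ?I (\<lambda>j (i, l). y j i l)"
    using z(2) unfolding independent_family_def y_def by auto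
  moreover have "skew_for n G (y j)" if "j < N" for j
    unfolding skew_for_def
  proof (intro allI impI)
    fix i l assume il: "i < n" "l < n"
    have "poly ((\<Sum>r<n. z j (r, i) * [:G r l:]) + (\<Sum>r<n. [:G i r:] * z j (r, l))) 0 = 0"
      using z(1)[OF that] il unfolding skew_commuting_def by simp
    then show "(\<Sum>r<n. y j r i * G r l) + (\<Sum>r<n. G i r * y j r l) = 0"
      by (simp add: poly_sum y_def mult_ac)
  qed
  moreover have "mmul n E (y j) i l = mmul n (y j) E i l \<and>
      mmul n X (y j) i l + mmul n E (y' j) i l = mmul n (y j) X i l + mmul n (y' j) E i l"
    if "j < N" "i < n" "l < n" for j i l
  proof -
    have eq: "(\<Sum>r<n. C i r * z j (r, l)) = (\<Sum>r<n. z j (i, r) * C r l)"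
      using z(1)[OF that(1)] that unfolding skew_commuting_def by simp
    have p: "pderiv (C a b) = [:X a b:]" "poly (C a b) 0 = E a b" for a b
      by (simp_all add: C_def pderiv_pCons)
    show ?thesis
      using arg_cong[OF eq, of "\<lambda>q. poly q 0"] arg_cong[OF eq, of "\<lambda>q. poly (pderiv q) 0"]
      by (simp add: poly_sum p y_def y'_def mmul_def pderiv_sum pderiv_mult sum.distrib ac_simps)
  qed
  ultimately show ?thesis by blast
qed

text \<open>Since \<open>t\<close> is an involution, the square of this monomial matrix is diagonal,
  with entry \<open>h a * h (t a)\<close> at a.\<close>

lemma odd_power_monomial:
  assumes t: "\<And>a. a < n \<Longrightarrow> t a < n \<and> t (t a) = a" and a: "a < n"
  shows "odd_power n (\<lambda>a b. if b = t a then h a else 0) j a b =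
    (if b = t a then h a * (h a * h (t a)) ^ j else (0::'a::comm_ring_1))"
proof (induction j)
  case (Suc j)
  have "mmul n (\<lambda>a b. if b = t a then h a else 0) P a b = h a * P (t a) b" if "a < n"
    for P :: "nat \<Rightarrow> nat \<Rightarrow> 'a" and a
    unfolding mmul_def using t[OF that]
    by (subst sum.remove[of _ "t a"]) (auto intro!: sum.neutral)
  then show ?case using t[OF a] a Suc by (simp add: mult_ac)
qed simp

text \<open>Up to the factor \<open>h a\<close>, the entries at (a, t a) of the odd powers are the
  powers of \<open>h a * h (t a)\<close>. A relation is therefore a polynomial of degree below
  \<open>N\<close> with \<open>N\<close> distinct roots.\<close>

lemma odd_power_monomial_independent:
  fixes h :: "nat \<Rightarrow> 'a::idom"
  assumes t: "\<And>a. a < n \<Longrightarrow> t a < n \<and> t (t a) = a"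
    and A: "A \<subseteq> {..<n}" "card A = N" "\<And>a. a \<in> A \<Longrightarrow> h a \<noteq> 0"
    and inj: "inj_on (\<lambda>a. h a * h (t a)) A"
  shows "independent_family {..<N} ({..<n} \<times> {..<n})
    (\<lambda>j (i, l). odd_power n (\<lambda>a b. if b = t a then h a else 0) j i l)"
  unfolding independent_family_def
proof (intro allI impI)
  fix c :: "nat \<Rightarrow> 'a"
  assume c: "\<forall>p\<in>{..<n} \<times> {..<n}.
    (\<Sum>j<N. c j * (case p of (i, l) \<Rightarrow> odd_power n (\<lambda>a b. if b = t a then h a else 0) j i l)) = 0"
  define q where "q = (\<Sum>j<N. monom (c j) j)"
  have coeff: "coeff q j = (if j < N then c j else 0)" for j
    by (simp add: q_def coeff_sum coeff_monom if_distrib cong: if_cong) 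
  have root: "poly q (h a * h (t a)) = 0" if a: "a \<in> A" for a
  proof -
    have "a < n" using A(1) a by auto
    then have "h a * poly q (h a * h (t a)) = 0"
      using c[rule_format, of "(a, t a)"] t[of a]
      by (simp add: odd_power_monomial[OF t] q_def poly_sum poly_monom sum_distrib_left mult_ac)
    then show ?thesis using A(3)[OF a] by simp
  qed
  have "q = 0"
  proof (rule ccontr)
    assume q: "q \<noteq> 0"
    have "(\<lambda>a. h a * h (t a)) ` A \<subseteq> {x. poly q x = 0}" using root by auto
    then have "card ((\<lambda>a. h a * h (t a)) ` A) \<le> card {x. poly q x = 0}"
      by (rule card_mono[OF poly_roots_finite[OF q]])
    also have "\<dots> \<le> degree q" using q by (rule card_poly_roots_bound)
    finally have "N \<le> degree q" using A(2) inj by (simp add: card_image)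
    then show False using coeff[of "degree q"] q by simp
  qed
  then show "\<forall>j\<in>{..<N}. c j = 0" using coeff by (metis coeff_0 lessThan_iff)
qed

section \<open>Jordan bases\<close>

lemma linear_rules:
  assumes "Vector_Spaces.linear s1 s2 f"
  shows linear_map_add: "f (x + y) = f x + f y" and linear_map_scale: "f (s1 c x) = s2 c (f x)"
    and linear_map_zero: "f 0 = 0" and linear_map_sum: "f (sum g A) = (\<Sum>a\<in>A. f (g a))"
    and linear_map_diff: "f (x - y) = f x - f y" and linear_map_neg: "f (- x) = - f x"
proof -
  interpret Vector_Spaces.linear s1 s2 f by fact
  show "f (x + y) = f x + f y" "f (s1 c x) = s2 c (f x)" "f 0 = 0"
    "f (sum g A) = (\<Sum>a\<in>A. f (g a))" "f (x - y) = f x - f y" "f (- x) = - f x"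
    by (simp_all add: add scale zero sum diff neg)
qed

lemma vector_space_mult: "vector_space ((*) :: 'k::field \<Rightarrow> 'k \<Rightarrow> 'k)"
  by unfold_locales (simp_all add: algebra_simps)

text \<open>Induction on the number of equations by elimination: \<open>b0\<close> is a pivot in the
  last equation, \<open>g\<close> are the other equations with \<open>b0\<close> eliminated, and the
  coefficient of \<open>d\<close> at \<open>b0\<close> is the one that solves the last
  equation.\<close>

lemma homogeneous_system:
  fixes f :: "nat \<Rightarrow> 'b \<Rightarrow> 'a::field"
  assumes "finite B" "N < card B"
  shows "\<exists>c. (\<exists>b\<in>B. c b \<noteq> 0) \<and> (\<forall>i<N. (\<Sum>b\<in>B. c b * f i b) = 0)"
  using assms
proof (induction N arbitrary: B f)
  case 0
  then have "B \<noteq> {}" by auto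
  then show ?case by (intro exI[of _ "\<lambda>_. 1"]) auto
next
  case (Suc N)
  show ?case
  proof (cases "\<forall>b\<in>B. f N b = 0")
    case True
    obtain c where "\<exists>b\<in>B. c b \<noteq> 0" "\<forall>i<N. (\<Sum>b\<in>B. c b * f i b) = 0"
      using Suc.IH[of B f] Suc.prems by auto
    then show ?thesis using True by (intro exI[of _ c]) (auto simp: less_Suc_eq)
  next
    case False
    then obtain b0 where b0: "b0 \<in> B" "f N b0 \<noteq> 0" by auto
    let ?B = "B - {b0}"
    define g where "g = (\<lambda>i b. f i b - f N b / f N b0 * f i b0)"
    obtain c where c: "\<exists>b\<in>?B. c b \<noteq> 0" "\<And>i. i < N \<Longrightarrow> (\<Sum>b\<in>?B. c b * g i b) = 0"
    proof -
      have "finite ?B" "N < card ?B" using Suc.prems b0(1) by (auto simp: card_Diff_singleton)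
      from Suc.IH[OF this, of g] that show ?thesis by blast
    qed
    define d where "d = c(b0 := - (\<Sum>b\<in>?B. c b * f N b) / f N b0)"
    have d: "(\<Sum>b\<in>B. d b * f i b) = (\<Sum>b\<in>?B. c b * f i b) - (\<Sum>b\<in>?B. c b * f N b) / f N b0 * f i b0" for i
    proof -
      have "(\<Sum>b\<in>?B. d b * f i b) = (\<Sum>b\<in>?B. c b * f i b)"
        by (intro sum.cong) (auto simp: d_def)
      then show ?thesis
        by (subst sum.remove[OF Suc.prems(1) b0(1)]) (simp add: d_def)
    qed
    have "(\<Sum>b\<in>B. d b * f i b) = 0" if "i < Suc N" for i
    proof (cases "i = N")
      case True
      then show ?thesis using d b0(2) by simp
    next
      case False
      have "(\<Sum>b\<in>?B. c b * g i b) = (\<Sum>b\<in>?B. c b * f i b) - (\<Sum>b\<in>?B. c b * f N b) / f N b0 * f i b0"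
        by (simp add: g_def right_diff_distrib sum_subtractf sum_divide_distrib sum_distrib_right mult.assoc)
      then show ?thesis using d[of i] c(2)[of i] that False by simp
    qed
    moreover have "\<exists>b\<in>B. d b \<noteq> 0" using c(1) by (auto simp: d_def)
    ultimately show ?thesis by blast
  qed
qed

section \<open>Independence and dimension estimates\<close>

context vector_space
begin

lemma card_le_dim:
  assumes "independent S" "S \<subseteq> U" "U \<subseteq> span T" "finite T"
  shows "finite S \<and> card S \<le> dim U"
proof -
  obtain B where B: "B \<subseteq> U" "independent B" "U \<subseteq> span B" "card B = dim U"
    using basis_exists by blast
  have "finite B" using independent_span_bound[OF assms(4) B(2)] B(1) assms(3) by auto
  then show ?thesis
    using independent_span_bound[OF _ assms(1), of B] assms(2) B(3,4) by auto
qed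

text \<open>Were the dimension larger than \<open>N\<close>, the \<open>N\<close> equations would
  have a nontrivial solution in the coefficients of a basis of \<open>U\<close>, that is, a nonzero
  vector in the common kernel.\<close>

lemma dim_le_functionals:
  fixes f :: "nat \<Rightarrow> 'b \<Rightarrow> 'a"
  assumes U: "subspace U"
    and add: "\<And>i x y. \<lbrakk>i < N; x \<in> U; y \<in> U\<rbrakk> \<Longrightarrow> f i (x + y) = f i x + f i y"
    and scale: "\<And>i x a. \<lbrakk>i < N; x \<in> U\<rbrakk> \<Longrightarrow> f i (a *s x) = a * f i x"
    and ker: "\<And>x. \<lbrakk>x \<in> U; \<And>i. i < N \<Longrightarrow> f i x = 0\<rbrakk> \<Longrightarrow> x = 0"
  shows "dim U \<le> N"
proof (rule ccontr)
  assume "\<not> dim U \<le> N"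
  obtain B where B: "B \<subseteq> U" "independent B" "U \<subseteq> span B" "card B = dim U"
    using basis_exists by blast
  have fin: "finite B" "N < card B" using B(4) \<open>\<not> dim U \<le> N\<close> by (auto intro: card_ge_0_finite)
  obtain c where c: "\<exists>b\<in>B. c b \<noteq> 0" "\<And>i. i < N \<Longrightarrow> (\<Sum>b\<in>B. c b * f i b) = 0"
    using homogeneous_system[OF fin, of f] by auto
  have sums: "(\<Sum>b\<in>C. c b *s b) \<in> U \<and> (\<forall>i<N. f i (\<Sum>b\<in>C. c b *s b) = (\<Sum>b\<in>C. c b * f i b))"
    if "finite C" "C \<subseteq> U" for C
    using that
  proof (induction C)
    case empty
    have "f i 0 = 0" if "i < N" for i
      using scale[OF that subspace_0[OF U], of 0] by simp
    then show ?case using subspace_0[OF U] by simp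
  next
    case (insert b C)
    then show ?case
      using add scale subspace_add[OF U] subspace_scale[OF U] by simp
  qed
  have "(\<Sum>b\<in>B. c b *s b) = 0"
    using sums[OF fin(1) B(1)] c(2) by (intro ker) auto
  then show False
    using B(2) dependent_finite[OF fin(1)] c(1) by auto
qed

text \<open>Two equal members would satisfy the relation with coefficients 1 and -1, so the
  hypothesis also excludes repetitions.\<close>

lemma independent_image:
  assumes "finite I" and ind: "\<And>c i. \<lbrakk>(\<Sum>j\<in>I. c j *s b j) = 0; i \<in> I\<rbrakk> \<Longrightarrow> c i = 0"
  shows "inj_on b I \<and> independent (b ` I)"
proof
  show inj: "inj_on b I"
  proof (rule inj_onI, rule ccontr)
    fix i j assume ij: "i \<in> I" "j \<in> I" "b i = b j" "i \<noteq> j"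
    let ?c = "\<lambda>l. if l = i then 1 else if l = j then - 1 else (0::'a)"
    have "(\<Sum>l\<in>I. ?c l *s b l) = ?c i *s b i + (\<Sum>l\<in>I-{i}. ?c l *s b l)"
      by (rule sum.remove[OF assms(1) ij(1)])
    also have "(\<Sum>l\<in>I-{i}. ?c l *s b l) = ?c j *s b j + (\<Sum>l\<in>I-{i}-{j}. ?c l *s b l)"
      using ij assms(1) by (intro sum.remove) auto
    also have "(\<Sum>l\<in>I-{i}-{j}. ?c l *s b l) = 0" by (intro sum.neutral) auto
    finally have "(\<Sum>l\<in>I. ?c l *s b l) = 0" using ij by simp
    then have "?c i = 0" using ij(1) by (rule ind)
    then show False by simp
  qed
  show "independent (b ` I)"
  proof
    assume "dependent (b ` I)"
    then obtain u where u: "\<exists>v\<in>b ` I. u v \<noteq> 0" "(\<Sum>v\<in>b ` I. u v *s v) = 0"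
      using dependent_finite[of "b ` I"] assms(1) by auto
    have "(\<Sum>i\<in>I. u (b i) *s b i) = 0" using u(2) inj by (simp add: sum.reindex)
    then have "u (b i) = 0" if "i \<in> I" for i using that by (rule ind[of "\<lambda>i. u (b i)"])
    then show False using u(1) by auto
  qed
qed

text \<open>Applied with the trace as \<open>f\<close>: imposing trace zero on a stabiliser costs at
  most one dimension.\<close>

lemma dim_le_Suc_dim_kernel:
  assumes U: "subspace U" "U \<subseteq> span T" "finite T"
    and f: "\<And>x y. f (x + y) = f x + f y" "\<And>a x. f (a *s x) = a * (f x :: 'a)"
  shows "dim U \<le> dim (U \<inter> {x. f x = 0}) + 1"
proof -
  let ?K = "U \<inter> {x. f x = 0}"
  obtain B where B: "B \<subseteq> ?K" "independent B" "?K \<subseteq> span B" "card B = dim ?K"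
    using basis_exists by blast
  have finB: "finite B" using card_le_dim[OF B(2), of U T] B(1) U by auto
  obtain u where u: "U \<subseteq> span (insert u B)"
  proof (cases "U \<subseteq> ?K")
    case True
    then show ?thesis using B(3) that[of 0] span_mono[of B "insert 0 B"] by blast
  next
    case False
    then obtain u where u: "u \<in> U" "f u \<noteq> 0" by auto
    have "x \<in> span (insert u B)" if x: "x \<in> U" for x
    proof -
      have "f (x + (- f x / f u) *s u) = 0" unfolding f using u(2) by simp
      moreover have "x + (- f x / f u) *s u \<in> U"
        using U(1) x u(1) by (intro subspace_add subspace_scale)
      ultimately have "x + (- f x / f u) *s u \<in> span B" using B(3) by blast
      then have "x - (f x / f u) *s u \<in> span B" by simp
      then show ?thesis by (auto simp: span_insert)
    qed
    then show ?thesis using that by blast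
  qed
  have "dim U \<le> card (insert u B)" by (rule dim_le_card[OF u]) (use finB in simp)
  also have "\<dots> \<le> dim ?K + 1" using B(4) finB by (simp add: card_insert_if)
  finally show ?thesis .
qed

end

section \<open>Jordan bases with their coordinate functionals\<close>

lemma linear_funpow:
  assumes "Vector_Spaces.linear s s f"
  shows "Vector_Spaces.linear s s (f ^^ m)"
proof (induction m)
  case 0
  interpret Vector_Spaces.linear s s f by fact
  show ?case using vs1.linear_id by (simp add: id_def)
next
  case (Suc m)
  then show ?case using Vector_Spaces.linear_compose[OF Suc assms] by (simp add: comp_def)
qed

text \<open>\<open>phi i\<close> is the coefficient of the last vector in the chain of
  \<open>w i\<close>. Every other coefficient arises from it by shifting the vector along the chain
  first: that of \<open>(e ^^ s) (w i)\<close> in v is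
  \<open>phi i ((e ^^ (n i - Suc s)) v)\<close>.\<close>

locale jordan_system = vector_space scale
  for scale :: "'k::field \<Rightarrow> 'v::ab_group_add \<Rightarrow> 'v" (infixr "*s" 75) +
  fixes e :: "'v \<Rightarrow> 'v" and k :: nat and n :: "nat \<Rightarrow> nat" and w :: "nat \<Rightarrow> 'v"
    and phi :: "nat \<Rightarrow> 'v \<Rightarrow> 'k"
  assumes e_linear: "Vector_Spaces.linear scale scale e"
    and n_pos: "i < k \<Longrightarrow> 0 < n i"
    and w_nil: "i < k \<Longrightarrow> (e ^^ n i) (w i) = 0"
    and phi_linear: "i < k \<Longrightarrow> Vector_Spaces.linear scale (*) (phi i)"
    and dual: "\<lbrakk>i < k; j < k\<rbrakk> \<Longrightarrow>
      phi i ((e ^^ s) (w j)) = (if i = j \<and> Suc s = n i then 1 else 0)"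
    and expand: "v = (\<Sum>i<k. \<Sum>s<n i. phi i ((e ^^ (n i - Suc s)) v) *s (e ^^ s) (w i))"
begin

lemmas pow_linear = linear_funpow[OF e_linear]

lemma eq_0_iff: "v = 0 \<longleftrightarrow> (\<forall>i<k. \<forall>r<n i. phi i ((e ^^ r) v) = 0)"
proof
  assume "\<forall>i<k. \<forall>r<n i. phi i ((e ^^ r) v) = 0"
  then show "v = 0" by (subst expand) (auto intro!: sum.neutral)
qed (auto simp: linear_map_zero[OF pow_linear] linear_map_zero[OF phi_linear])

lemma pow_w_zero: "\<lbrakk>i < k; n i \<le> s\<rbrakk> \<Longrightarrow> (e ^^ s) (w i) = 0"
proof -
  assume i: "i < k" "n i \<le> s"
  then have "s = (s - n i) + n i" by simp
  then have "(e ^^ s) (w i) = (e ^^ (s - n i)) ((e ^^ n i) (w i))"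
    by (metis funpow_add comp_apply)
  then show ?thesis using w_nil[OF i(1)] linear_map_zero[OF pow_linear] by simp
qed

lemma phi_sum:
  assumes "j < k"
  shows "phi j ((e ^^ r) (\<Sum>i<k. \<Sum>s<n i. c i s *s (e ^^ s) (w i))) = (if r < n j then c j (n j - Suc r) else 0)"
proof -
  have "phi j ((e ^^ r) (\<Sum>i<k. \<Sum>s<n i. c i s *s (e ^^ s) (w i))) =
    (\<Sum>i<k. \<Sum>s<n i. c i s * phi j ((e ^^ (r + s)) (w i)))"
    by (simp add: linear_map_sum[OF pow_linear] linear_map_sum[OF phi_linear[OF assms]]
        linear_map_scale[OF pow_linear] linear_map_scale[OF phi_linear[OF assms]] funpow_add)
  also have "\<dots> = (\<Sum>i<k. \<Sum>s<n i. if i = j \<and> s = n j - Suc r \<and> r < n j then c j s else 0)"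
    using assms by (intro sum.cong) (auto simp: dual)
  also have "\<dots> = (\<Sum>i<k. if i = j then (\<Sum>s<n j. if s = n j - Suc r \<and> r < n j then c j s else 0) else 0)"
    by (intro sum.cong) auto
  also have "\<dots> = (\<Sum>s<n j. if s = n j - Suc r \<and> r < n j then c j s else 0)"
    using assms by simp
  also have "\<dots> = (if r < n j then c j (n j - Suc r) else 0)"
    using n_pos[OF assms] by (cases "r < n j") (simp_all cong: if_cong)
  finally show ?thesis .
qed

lemma phi_pow_zero: "\<lbrakk>j < k; n j \<le> r\<rbrakk> \<Longrightarrow> phi j ((e ^^ r) v) = 0"
  by (subst expand[of v], subst phi_sum) auto

lemma is_jordan_basis: "jordan_basis scale e k n w"
proof -
  let ?I = "Sigma {..<k} (\<lambda>i. {..<n i})" and ?b = "\<lambda>(i, s). (e ^^ s) (w i)"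
  have sum: "(\<Sum>p\<in>?I. c p *s ?b p) = (\<Sum>i<k. \<Sum>s<n i. c (i, s) *s (e ^^ s) (w i))" for c
    by (subst sum.Sigma) (auto simp: case_prod_unfold)
  have "inj_on ?b ?I \<and> independent (?b ` ?I)"
  proof (rule independent_image)
    fix c p assume 0: "(\<Sum>p\<in>?I. c p *s ?b p) = 0" and p: "p \<in> ?I"
    from 0 have z: "(\<Sum>i<k. \<Sum>s<n i. c (i, s) *s (e ^^ s) (w i)) = 0" unfolding sum .
    obtain i s where ps: "p = (i, s)" "i < k" "s < n i" using p by auto
    have "n i - Suc (n i - Suc s) = s" "n i - Suc s < n i" using ps(3) by auto
    then show "c p = 0"
      using phi_sum[OF ps(2), of "n i - Suc s" "\<lambda>i s. c (i, s)"] ps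
      unfolding z by (simp add: linear_map_zero[OF pow_linear] linear_map_zero[OF phi_linear])
  qed auto
  moreover have "v \<in> span (?b ` ?I)" for v
    by (subst expand) (force intro!: span_sum span_scale intro: span_base)
  ultimately show ?thesis
    using n_pos w_nil unfolding jordan_basis_def Let_def by auto
qed

text \<open>The last vectors of the chains are independent in the kernel, and the
  \<open>phi i\<close> are coordinates on it. As the kernel depends on \<open>e\<close> alone, the
  number of blocks is an invariant of \<open>e\<close>.\<close>

lemma dim_kernel: "dim {v. e v = 0} = k"
proof (rule antisym)
  let ?K = "{v. e v = 0}"
  have K: "subspace ?K"
    unfolding subspace_def using linear_rules[OF e_linear] by simp
  show "dim ?K \<le> k"
  proof (rule dim_le_functionals[OF K, where f = phi])
    fix v assume v: "v \<in> ?K" and z: "\<And>i. i < k \<Longrightarrow> phi i v = 0"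
    have "(e ^^ r) v = 0" if "r > 0" for r
      using v that linear_map_zero[OF pow_linear] by (cases r) (auto simp: funpow_swap1)
    then have "phi i ((e ^^ r) v) = 0" if "i < k" for i r
      using that z by (cases "r = 0") (auto simp: linear_map_zero[OF phi_linear])
    then show "v = 0" using eq_0_iff by blast
  qed (simp_all add: linear_rules[OF phi_linear])
  define b where "b = (\<lambda>i. (e ^^ (n i - 1)) (w i))"
  have b: "inj_on b {..<k} \<and> independent (b ` {..<k})"
  proof (rule independent_image)
    fix c i assume z: "(\<Sum>j<k. c j *s b j) = 0" and i: "i \<in> {..<k}"
    have "phi i (\<Sum>j<k. c j *s b j) = (\<Sum>j<k. c j * phi i (b j))"
      using i by (simp add: linear_map_sum[OF phi_linear] linear_map_scale[OF phi_linear])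
    also have "\<dots> = (\<Sum>j<k. if j = i then c j else 0)"
      using i n_pos by (intro sum.cong) (auto simp: b_def dual)
    finally show "c i = 0" using z i by (simp add: linear_map_zero[OF phi_linear])
  qed simp
  have "e (b i) = 0" if "i < k" for i
    using w_nil[OF that] n_pos[OF that] by (cases "n i") (auto simp: b_def)
  then have sub: "b ` {..<k} \<subseteq> ?K" by auto
  have "?K \<subseteq> span ((\<lambda>(i, s). (e ^^ s) (w i)) ` Sigma {..<k} (\<lambda>i. {..<n i}))"
    using is_jordan_basis unfolding jordan_basis_def Let_def by auto
  then have "card (b ` {..<k}) \<le> dim ?K"
    using card_le_dim[OF conjunct2[OF b] sub] by auto
  then show "k \<le> dim ?K" using b by (simp add: card_image)
qed

end

lemma (in vector_space) jordan_system_of_jordan_basis: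
  assumes lin: "Vector_Spaces.linear scale scale e"
    and jb: "jordan_basis scale e k n w"
  shows "\<exists>phi. jordan_system scale e k n w phi"
proof -
  let ?I = "Sigma {..<k} (\<lambda>i. {..<n i})" and ?b = "\<lambda>(i, s). (e ^^ s) (w i)"
  have n: "\<And>i. i < k \<Longrightarrow> 0 < n i" "\<And>i. i < k \<Longrightarrow> (e ^^ n i) (w i) = 0"
    and inj: "inj_on ?b ?I" and ind: "independent (?b ` ?I)" and sp: "span (?b ` ?I) = UNIV"
    using jb unfolding jordan_basis_def Let_def by auto
  note pow = linear_funpow[OF lin]
  \<comment> \<open>\<open>psi i s\<close> is the coefficient at \<open>(e ^^ s) (w i)\<close>. The
    last one of each chain becomes \<open>phi i\<close>, from which \<open>phi_psi\<close> recovers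
    the others.\<close>
  define psi where "psi = (\<lambda>i s v. representation (?b ` ?I) v ((e ^^ s) (w i)))"
  define phi where "phi = (\<lambda>i. psi i (n i - 1))"
  have psi: "Vector_Spaces.linear scale (*) (psi i s)" for i s
    unfolding psi_def Vector_Spaces.linear_iff
    using vector_space_axioms vector_space_mult representation_add[OF ind] representation_scale[OF ind] sp by auto
  have psi_b: "psi i s ((e ^^ t) (w j)) = (if i = j \<and> s = t then 1 else 0)"
    if "i < k" "s < n i" "j < k" "t < n j" for i s j t
  proof -
    have "(i, s) \<in> ?I" "(j, t) \<in> ?I" using that by auto
    then have "(e ^^ s) (w i) = (e ^^ t) (w j) \<longleftrightarrow> (i, s) = (j, t)"
      using inj_on_eq_iff[OF inj, of "(i, s)" "(j, t)"] by auto
    moreover have "representation (?b ` ?I) ((e ^^ t) (w j)) =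
        (\<lambda>v. if v = (e ^^ t) (w j) then 1 else 0)"
      using \<open>(j, t) \<in> ?I\<close> by (intro representation_basis[OF ind]) force
    ultimately show ?thesis unfolding psi_def by auto
  qed
  have ex: "v = (\<Sum>i<k. \<Sum>s<n i. psi i s v *s (e ^^ s) (w i))" for v
  proof -
    have "v = (\<Sum>b\<in>?b ` ?I. representation (?b ` ?I) v b *s b)"
      by (rule sum_representation_eq[OF ind, symmetric]) (auto simp: sp)
    also have "\<dots> = (\<Sum>p\<in>?I. representation (?b ` ?I) v (?b p) *s ?b p)"
      by (subst sum.reindex[OF inj]) simp
    finally show ?thesis by (subst sum.Sigma) (auto simp: psi_def case_prod_unfold)
  qed
  have pw: "(e ^^ t) (w j) = 0" if "j < k" "n j \<le> t" for j t
  proof -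
    have "(e ^^ t) (w j) = (e ^^ (t - n j)) ((e ^^ n j) (w j))"
      using that(2) by (metis funpow_add comp_apply le_add_diff_inverse2)
    then show ?thesis using n(2)[OF that(1)] linear_map_zero[OF pow] by simp
  qed
  have psi_pow: "psi i s ((e ^^ t) (w j)) = (if i = j \<and> s = t then 1 else 0)"
    if "i < k" "s < n i" "j < k" for i s j t
    using psi_b[OF that, of t] pw[OF that(3), of t] that(2) linear_map_zero[OF psi]
    by (cases "t < n j") auto
  have phi_psi: "phi i ((e ^^ (n i - Suc s)) v) = psi i s v" if i: "i < k" and s: "s < n i" for i s v
  proof -
    have "phi i ((e ^^ (n i - Suc s)) v) =
      (\<Sum>j<k. \<Sum>t<n j. psi j t v * phi i ((e ^^ (n i - Suc s + t)) (w j)))"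
      by (subst ex[of v]) (simp add: phi_def linear_map_sum[OF pow] linear_map_sum[OF psi]
          linear_map_scale[OF pow] linear_map_scale[OF psi] funpow_add)
    also have "\<dots> = (\<Sum>j<k. \<Sum>t<n j. psi j t v * psi i s ((e ^^ t) (w j)))"
      using i s by (intro sum.cong) (auto simp: phi_def psi_pow)
    also have "\<dots> = psi i s v"
      using arg_cong[OF ex[of v], of "psi i s"]
      by (simp add: linear_map_sum[OF psi] linear_map_scale[OF psi])
    finally show ?thesis .
  qed
  have "jordan_system scale e k n w phi"
  proof (rule jordan_system.intro[OF vector_space_axioms], rule jordan_system_axioms.intro)
    fix i j s assume "i < k" "j < k"
    then show "phi i ((e ^^ s) (w j)) = (if i = j \<and> Suc s = n i then 1 else 0)"
      using n(1) by (auto simp: phi_def psi_pow)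
  next
    fix v show "v = (\<Sum>i<k. \<Sum>s<n i. scale (phi i ((e ^^ (n i - Suc s)) v)) ((e ^^ s) (w i)))"
      by (subst ex[of v]) (simp add: phi_psi)
  qed (use n lin psi in \<open>auto simp: phi_def\<close>)
  then show ?thesis by blast
qed

lemma (in jordan_system) num_blocks: "num_jordan_blocks scale e = k"
  unfolding num_jordan_blocks_def
proof (rule the_equality)
  show "\<exists>d w. jordan_basis scale e k d w" using is_jordan_basis by blast
next
  fix k' assume "\<exists>d w. jordan_basis scale e k' d w"
  then obtain d w' phi' where "jordan_system scale e k' d w' phi'"
    using jordan_system_of_jordan_basis[OF e_linear] by blast
  then show "k' = k" using dim_kernel jordan_system.dim_kernel by metis
qed

lemma (in vector_space) linear_functional_extend:
  assumes "independent B"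
  shows "\<exists>phi. Vector_Spaces.linear scale (*) phi \<and> (\<forall>b\<in>B. phi b = g b)"
proof -
  interpret vp: vector_space_pair scale "(*) :: 'a \<Rightarrow> 'a \<Rightarrow> 'a"
    using vector_space_axioms vector_space_mult by (rule vector_space_pair.intro)
  show ?thesis using vp.linear_independent_extend[OF assms] by blast
qed

text \<open>The version for an invariant subspace \<open>U\<close> makes it possible to split off
  one chain at a time. The functionals live on the whole space, but the expansion is claimed for
  vectors of \<open>U\<close> only.\<close>

definition jordan_on ::
  "('k::field \<Rightarrow> 'v::ab_group_add \<Rightarrow> 'v) \<Rightarrow> ('v \<Rightarrow> 'v) \<Rightarrow> 'v set \<Rightarrow>
    nat \<Rightarrow> (nat \<Rightarrow> nat) \<Rightarrow> (nat \<Rightarrow> 'v) \<Rightarrow> (nat \<Rightarrow> 'v \<Rightarrow> 'k) \<Rightarrow> bool" where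
  "jordan_on scale e U k n w phi \<longleftrightarrow>
    (\<forall>i<k. 0 < n i \<and> w i \<in> U \<and> (e ^^ n i) (w i) = 0 \<and> Vector_Spaces.linear scale (*) (phi i) \<and>
      (\<forall>j<k. \<forall>s. phi i ((e ^^ s) (w j)) = (if i = j \<and> Suc s = n i then 1 else 0))) \<and>
    (\<forall>v\<in>U. v = (\<Sum>i<k. \<Sum>s<n i. scale (phi i ((e ^^ (n i - Suc s)) v)) ((e ^^ s) (w i))))"

text \<open>Applying \<open>e ^^ (m - Suc i)\<close> moves the vector with index i to the end of the
  chain; the terms behind it vanish, and the coefficients before it are 0 by induction.\<close>

lemma (in vector_space) chain_independent:
  assumes lin: "Vector_Spaces.linear scale scale e"
    and w: "(e ^^ m) w = 0" "(e ^^ (m - 1)) w \<noteq> 0"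
  shows "inj_on (\<lambda>s. (e ^^ s) w) {..<m} \<and> independent ((\<lambda>s. (e ^^ s) w) ` {..<m})"
proof (rule independent_image)
  note pow = linear_funpow[OF lin]
  have z: "(e ^^ t) w = 0" if "m \<le> t" for t
    using that w(1) linear_map_zero[OF pow] by (metis funpow_add comp_apply le_add_diff_inverse2)
  fix c i assume c: "(\<Sum>s<m. c s *s (e ^^ s) w) = 0" and i: "i \<in> {..<m}"
  from i show "c i = 0"
  proof (induction i rule: less_induct)
    case (less i)
    have "(e ^^ (m - Suc i)) (\<Sum>s<m. c s *s (e ^^ s) w) = (\<Sum>s<m. c s *s (e ^^ (m - Suc i + s)) w)"
      by (simp add: linear_map_sum[OF pow] linear_map_scale[OF pow] funpow_add)
    also have "\<dots> = c i *s (e ^^ (m - Suc i + i)) w"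
    proof (subst sum.remove[of _ i])
      have "c s *s (e ^^ (m - Suc i + s)) w = 0" if "s \<in> {..<m} - {i}" for s
      proof (cases "s < i")
        case True
        then show ?thesis using less.IH[of s] that by auto
      next
        case False
        then have "m \<le> m - Suc i + s" using that less.prems by auto
        then show ?thesis using z by simp
      qed
      then have "(\<Sum>s\<in>{..<m}-{i}. c s *s (e ^^ (m - Suc i + s)) w) = 0" by (rule sum.neutral[rule_format])
      then show "c i *s (e ^^ (m - Suc i + i)) w + (\<Sum>s\<in>{..<m}-{i}. c s *s (e ^^ (m - Suc i + s)) w) =
          c i *s (e ^^ (m - Suc i + i)) w"
        by (simp only: add_0_right)
    qed (use less.prems in auto)
    also have "m - Suc i + i = m - 1" using less.prems by auto
    finally show ?case using c w(2) linear_map_zero[OF pow] by auto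
  qed
qed simp

lemma (in finite_dimensional_vector_space) dim_psubspace:
  assumes "subspace A" "subspace B" "A \<subseteq> B" "x \<in> B" "x \<notin> A"
  shows "dim A < dim B"
proof (rule dim_psubset)
  have sp: "span A = A" "span B = B" using assms by (simp_all add: span_eq_iff)
  show "span A \<subset> span B" unfolding sp using assms by blast
qed

lemma sum_single_row:
  fixes g :: "nat \<Rightarrow> 'a::comm_monoid_add"
  assumes "i < k"
  shows "(\<Sum>j<k. if j = i then g j else 0) = g i" "(\<Sum>j<k. if i = j then g j else 0) = g i"
  using assms by simp_all

lemma nilpotent_on_top:
  fixes e :: "'v \<Rightarrow> 'v::zero"
  assumes "\<And>v. v \<in> U \<Longrightarrow> (e ^^ N) v = 0" "x \<in> U" "x \<noteq> 0"
  shows "\<exists>d. (\<forall>v\<in>U. (e ^^ Suc d) v = 0) \<and> (\<exists>w\<in>U. (e ^^ d) w \<noteq> 0)"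
proof -
  let ?P = "\<lambda>m. \<forall>v\<in>U. (e ^^ m) v = 0"
  define m where "m = (LEAST m. ?P m)"
  have m: "?P m" unfolding m_def by (rule LeastI[of ?P N]) (use assms in auto)
  then have "m \<noteq> 0" using assms(2,3) by (cases m) auto
  then obtain d where "m = Suc d" by (cases m) auto
  moreover from this have "\<not> ?P d" using not_less_Least[of d ?P] m_def by simp
  ultimately show ?thesis using m by auto
qed

text \<open>A longest chain in \<open>U\<close>, generated by \<open>w0\<close>, has an invariant
  complement \<open>U'\<close>: the vectors v such that \<open>phi0\<close> kills every
  \<open>(e ^^ s) v\<close>, where \<open>phi0\<close> reads off the end of the chain. The induction
  hypothesis applies to \<open>U'\<close>.\<close>

lemma (in finite_dimensional_vector_space) exists_jordan_on:
  assumes lin: "Vector_Spaces.linear scale scale e" and nil: "\<And>v. (e ^^ N) v = 0"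
    and "subspace U" "\<And>v. v \<in> U \<Longrightarrow> e v \<in> U"
  shows "\<exists>k n w phi. jordan_on scale e U k n w phi"
  using assms(3,4)
proof (induction "dim U" arbitrary: U rule: less_induct)
  case less
  note pow = linear_funpow[OF lin] and U = less.prems
  have powU: "(e ^^ s) v \<in> U" if "v \<in> U" for s v
    using that U(2) by (induction s) auto
  show ?case
  proof (cases "\<forall>v\<in>U. v = 0")
    case True
    then show ?thesis by (intro exI[of _ 0]) (auto simp: jordan_on_def)
  next
    case False
    then obtain d w0 where d: "\<And>v. v \<in> U \<Longrightarrow> (e ^^ Suc d) v = 0" and w0: "w0 \<in> U" "(e ^^ d) w0 \<noteq> 0"
      using nilpotent_on_top[where U = U and e = e and N = N] nil by blast
    have top: "(e ^^ t) v = 0" if "v \<in> U" "d < t" for t v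
    proof -
      have "t = (t - Suc d) + Suc d" using that(2) by simp
      then have "(e ^^ t) v = (e ^^ (t - Suc d)) ((e ^^ Suc d) v)" by (metis funpow_add comp_apply)
      then show ?thesis using d[OF that(1)] linear_map_zero[OF pow] by simp
    qed
    note ind = chain_independent[OF lin, of "Suc d" w0]
    obtain phi0 where phi0: "Vector_Spaces.linear scale (*) phi0"
      "\<And>b. b \<in> (\<lambda>s. (e ^^ s) w0) ` {..<Suc d} \<Longrightarrow> phi0 b = (if b = (e ^^ d) w0 then 1 else 0)"
      using linear_functional_extend[OF conjunct2[OF ind], of "\<lambda>b. if b = (e ^^ d) w0 then 1 else 0"]
        d[OF w0(1)] w0(2) by auto
    have phi0_w0: "phi0 ((e ^^ s) w0) = (if s = d then 1 else 0)" for s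
    proof (cases "s \<le> d")
      case True
      then have "(e ^^ s) w0 = (e ^^ d) w0 \<longleftrightarrow> s = d"
        using inj_on_eq_iff[OF conjunct1[OF ind], of s d] d[OF w0(1)] w0(2) by auto
      then show ?thesis using phi0(2)[of "(e ^^ s) w0"] True by auto
    next
      case False
      then show ?thesis using top[OF w0(1), of s] linear_map_zero[OF phi0(1)] by simp
    qed
    define U' where "U' = {v\<in>U. \<forall>s. phi0 ((e ^^ s) v) = 0}"
    have U': "subspace U'"
    proof (rule subspaceI)
      show "0 \<in> U'"
        using subspace_0[OF U(1)] linear_map_zero[OF pow] linear_map_zero[OF phi0(1)]
        unfolding U'_def by simp
      show "x + y \<in> U'" if "x \<in> U'" "y \<in> U'" for x y
        using that subspace_add[OF U(1)] unfolding U'_def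
        by (simp add: linear_map_add[OF pow] linear_map_add[OF phi0(1)])
      show "c *s x \<in> U'" if "x \<in> U'" for c x
        using that subspace_scale[OF U(1)] unfolding U'_def
        by (simp add: linear_map_scale[OF pow] linear_map_scale[OF phi0(1)])
    qed
    have eU': "e v \<in> U'" if "v \<in> U'" for v
    proof -
      have v: "v \<in> U" "phi0 ((e ^^ s) v) = 0" for s using that unfolding U'_def by blast+
      have "phi0 ((e ^^ s) (e v)) = 0" for s
        using v(2)[of "Suc s"] by (simp only: funpow_Suc_right comp_apply)
      then show ?thesis using U(2)[OF v(1)] unfolding U'_def by blast
    qed
    have "w0 \<notin> U'"
    proof
      assume "w0 \<in> U'"
      then have "phi0 ((e ^^ d) w0) = 0" unfolding U'_def by blast
      then show False unfolding phi0_w0 by simp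
    qed
    then have "dim U' < dim U"
      using w0(1) U(1) U' by (intro dim_psubspace[of U' U w0]) (auto simp: U'_def)
    from less.hyps[OF this U' eU'] obtain k n w phi where J: "jordan_on scale e U' k n w phi" by blast
    \<comment> \<open>\<open>p\<close> projects \<open>U\<close> onto \<open>U'\<close> along the
      chain of \<open>w0\<close> and commutes there with the powers of \<open>e\<close>.\<close>
    define p where "p = (\<lambda>v. v - (\<Sum>s<Suc d. phi0 ((e ^^ (d - s)) v) *s (e ^^ s) w0))"
    have p_lin: "Vector_Spaces.linear scale scale p"
      unfolding Vector_Spaces.linear_iff
    proof (intro conjI allI vector_space_axioms)
      show "p (x + y) = p x + p y" for x y
        by (simp only: p_def linear_map_add[OF pow] linear_map_add[OF phi0(1)]
            scale_left_distrib sum.distrib) simp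
      show "p (c *s x) = c *s p x" for c x
        by (simp only: p_def linear_map_scale[OF pow] linear_map_scale[OF phi0(1)]
            scale_right_diff_distrib scale_sum_right scale_scale)
    qed
    have phi0_p: "phi0 ((e ^^ r) (p v)) = 0" if "v \<in> U" for r v
    proof -
      have "phi0 ((e ^^ r) (p v)) = phi0 ((e ^^ r) v) -
          (\<Sum>s<Suc d. phi0 ((e ^^ (d - s)) v) * phi0 ((e ^^ (r + s)) w0))"
        by (simp only: p_def linear_map_diff[OF pow] linear_map_diff[OF phi0(1)] linear_map_sum[OF pow]
            linear_map_sum[OF phi0(1)] linear_map_scale[OF pow] linear_map_scale[OF phi0(1)]
            funpow_add comp_apply)
      also have "(\<Sum>s<Suc d. phi0 ((e ^^ (d - s)) v) * phi0 ((e ^^ (r + s)) w0)) =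
          (\<Sum>s<Suc d. if s = d - r then (if r \<le> d then phi0 ((e ^^ r) v) else 0) else 0)"
        by (intro sum.cong) (auto simp: phi0_w0)
      also have "\<dots> = (if r \<le> d then phi0 ((e ^^ r) v) else 0)"
        by (rule sum_single_row(1)) simp
      finally show ?thesis using top[OF that, of r] linear_map_zero[OF phi0(1)] by auto
    qed
    have p_w0: "p ((e ^^ r) w0) = 0" for r
    proof (cases "r \<le> d")
      case True
      have "(\<Sum>s<Suc d. phi0 ((e ^^ (d - s)) ((e ^^ r) w0)) *s (e ^^ s) w0) =
          (\<Sum>s<Suc d. if s = r then (e ^^ s) w0 else 0)"
      proof (rule sum.cong[OF refl])
        fix s assume "s \<in> {..<Suc d}"
        then have "d - s + r = d \<longleftrightarrow> s = r" using True by auto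
        moreover have "(e ^^ (d - s)) ((e ^^ r) w0) = (e ^^ (d - s + r)) w0"
          by (simp only: funpow_add comp_apply)
        ultimately show "phi0 ((e ^^ (d - s)) ((e ^^ r) w0)) *s (e ^^ s) w0 = (if s = r then (e ^^ s) w0 else 0)"
          using phi0_w0 by simp
      qed
      then show ?thesis using True by (simp add: p_def del: sum.lessThan_Suc)
    next
      case False
      then show ?thesis using top[OF w0(1), of r] linear_map_zero[OF p_lin] by simp
    qed
    have p_U': "p v = v" if "v \<in> U'" for v
      using that unfolding p_def U'_def by (auto intro!: sum.neutral)
    have p_in: "p v \<in> U'" if "v \<in> U" for v
    proof -
      have "p v \<in> U"
        unfolding p_def using that w0(1) U(1) powU
        by (intro subspace_diff subspace_sum subspace_scale) auto
      then show ?thesis using phi0_p[OF that] unfolding U'_def by simp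
    qed
    have p_pow: "p ((e ^^ r) v) = (e ^^ r) (p v)" if "v \<in> U" for r v
    proof -
      have "v = p v + (\<Sum>s<Suc d. phi0 ((e ^^ (d - s)) v) *s (e ^^ s) w0)" by (simp add: p_def)
      then have "p ((e ^^ r) v) = p ((e ^^ r) (p v + (\<Sum>s<Suc d. phi0 ((e ^^ (d - s)) v) *s (e ^^ s) w0)))"
        by (rule arg_cong)
      also have "\<dots> = p ((e ^^ r) (p v)) +
        (\<Sum>s<Suc d. phi0 ((e ^^ (d - s)) v) *s p ((e ^^ (r + s)) w0))"
        by (simp only: linear_map_add[OF pow] linear_map_add[OF p_lin] linear_map_sum[OF pow]
            linear_map_sum[OF p_lin] linear_map_scale[OF pow] linear_map_scale[OF p_lin]
            funpow_add comp_apply)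
      finally have "p ((e ^^ r) v) = p ((e ^^ r) (p v)) +
        (\<Sum>s<Suc d. phi0 ((e ^^ (d - s)) v) *s p ((e ^^ (r + s)) w0))" .
      moreover have "(e ^^ r) (p v) \<in> U'"
        using p_in[OF that] eU' by (induction r) auto
      ultimately show ?thesis using p_w0 p_U' by (simp del: sum.lessThan_Suc)
    qed
    define w' where "w' = w(k := w0)"
    define n' where "n' = n(k := Suc d)"
    \<comment> \<open>Composition with \<open>p\<close> makes the old functionals vanish on the new
      chain.\<close>
    define phi' where "phi' = (\<lambda>i. if i = k then phi0 else phi i \<circ> p)"
    have Jw: "w i \<in> U'" "0 < n i" "(e ^^ n i) (w i) = 0" "Vector_Spaces.linear scale (*) (phi i)"
      "j < k \<Longrightarrow> phi i ((e ^^ s) (w j)) = (if i = j \<and> Suc s = n i then 1 else 0)"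
      if "i < k" for i j s
      using J that unfolding jordan_on_def by blast+
    have Jex: "v = (\<Sum>i<k. \<Sum>s<n i. phi i ((e ^^ (n i - Suc s)) v) *s (e ^^ s) (w i))" if "v \<in> U'" for v
      using J that unfolding jordan_on_def by blast
    have powU': "(e ^^ s) v \<in> U'" if "v \<in> U'" for s v
      using that eU' by (induction s) auto
    have "jordan_on scale e U (Suc k) n' w' phi'"
      unfolding jordan_on_def
    proof (intro conjI ballI allI impI)
      fix i assume i: "i < Suc k"
      show "0 < n' i" using i Jw by (auto simp: n'_def)
      show "w' i \<in> U" using i Jw(1)[of i] w0(1) by (auto simp: w'_def U'_def)
      show "(e ^^ n' i) (w' i) = 0" using i Jw(3)[of i] d[OF w0(1)] by (auto simp: w'_def n'_def)
      show "Vector_Spaces.linear scale (*) (phi' i)"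
        using i phi0(1) Vector_Spaces.linear_compose[OF p_lin Jw(4)] by (auto simp: phi'_def)
      fix j s assume j: "j < Suc k"
      consider "i = k" "j = k" | "i = k" "j < k" | "i < k" "j = k" | "i < k" "j < k"
        using i j by linarith
      then show "phi' i ((e ^^ s) (w' j)) = (if i = j \<and> Suc s = n' i then 1 else 0)"
      proof cases
        case 1
        then show ?thesis using phi0_w0 by (simp add: phi'_def w'_def n'_def)
      next
        case 2
        then show ?thesis using Jw(1)[of j] by (simp add: phi'_def w'_def n'_def U'_def)
      next
        case 3
        then show ?thesis
          using p_w0 linear_map_zero[OF Jw(4)] by (simp add: phi'_def w'_def n'_def)
      next
        case 4
        then show ?thesis
          using Jw(5) p_U'[OF powU'[OF Jw(1)]] by (simp add: phi'_def w'_def n'_def)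
      qed
    next
      fix v assume v: "v \<in> U"
      have "(\<Sum>i<k. \<Sum>s<n' i. phi' i ((e ^^ (n' i - Suc s)) v) *s (e ^^ s) (w' i)) =
        (\<Sum>i<k. \<Sum>s<n i. phi i ((e ^^ (n i - Suc s)) (p v)) *s (e ^^ s) (w i))"
        by (intro sum.cong) (auto simp: n'_def phi'_def w'_def p_pow[OF v])
      also have "\<dots> = p v" by (rule Jex[OF p_in[OF v], symmetric])
      finally have "(\<Sum>i<k. \<Sum>s<n' i. phi' i ((e ^^ (n' i - Suc s)) v) *s (e ^^ s) (w' i)) = p v" .
      then show "v = (\<Sum>i<Suc k. \<Sum>s<n' i. phi' i ((e ^^ (n' i - Suc s)) v) *s (e ^^ s) (w' i))"
        unfolding sum.lessThan_Suc[of _ k]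
        by (simp add: n'_def phi'_def w'_def p_def del: sum.lessThan_Suc)
    qed
    then show ?thesis by blast
  qed
qed

lemma (in finite_dimensional_vector_space) exists_jordan_system:
  assumes lin: "Vector_Spaces.linear scale scale e" and nil: "nilpotent_endo e"
  shows "\<exists>k n w phi. jordan_system scale e k n w phi"
proof -
  obtain N where "\<And>v. (e ^^ N) v = 0" using nil unfolding nilpotent_endo_def by auto
  from exists_jordan_on[OF lin this subspace_UNIV]
  obtain k n w phi where J: "jordan_on scale e UNIV k n w phi" by auto
  have "jordan_system scale e k n w phi"
    by (rule jordan_system.intro[OF vector_space_axioms], rule jordan_system_axioms.intro)
      (use J lin in \<open>unfold jordan_on_def, blast+\<close>)
  then show ?thesis by blast
qed

section \<open>Jordan bases adapted to a symmetric (\<open>eps\<close> = 1) or skew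
  (\<open>eps\<close> = -1) form\<close>

locale skew_nilpotent = finite_dimensional_vector_space scale Basis
  for scale :: "'k::field \<Rightarrow> 'v::ab_group_add \<Rightarrow> 'v" (infixr "*s" 75) and Basis :: "'v set" +
  fixes B :: "'v \<Rightarrow> 'v \<Rightarrow> 'k" and eps :: 'k and e :: "'v \<Rightarrow> 'v"
  assumes B_linear_right: "Vector_Spaces.linear scale (*) (B v)"
    and B_linear_left: "Vector_Spaces.linear scale (*) (\<lambda>v. B v x)"
    and B_nondegenerate: "(\<And>x. B v x = 0) \<Longrightarrow> v = 0"
    and B_sym: "B v x = eps * B x v"
    and eps: "eps = 1 \<or> eps = - 1"
    and two: "(2::'k) \<noteq> 0"
    and e_linear: "Vector_Spaces.linear scale scale e"
    and e_skew: "B (e v) x = - B v (e x)"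
    and e_nilpotent: "nilpotent_endo e"
begin

lemmas pow_linear = linear_funpow[OF e_linear]

lemma B_add_left: "B (x + y) z = B x z + B y z"
  and B_add_right: "B z (x + y) = B z x + B z y"
  and B_scale_left: "B (c *s x) z = c * B x z"
  and B_scale_right: "B z (c *s x) = c * B z x"
  and B_zero_left: "B 0 z = 0" and B_zero_right: "B z 0 = 0"
  and B_diff_left: "B (x - y) z = B x z - B y z"
  and B_sum_left: "B (sum g A) z = (\<Sum>a\<in>A. B (g a) z)"
  and B_sum_right: "B z (sum g A) = (\<Sum>a\<in>A. B z (g a))"
  using linear_rules[OF B_linear_left[of z]] linear_rules[OF B_linear_right[of z]] by auto

lemma skew_pow: "B ((e ^^ s) x) y = (- 1) ^ s * B x ((e ^^ s) y)"
proof (induction s arbitrary: y)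
  case (Suc s)
  have "B ((e ^^ Suc s) x) y = - B ((e ^^ s) x) (e y)" by (simp add: e_skew)
  then show ?case using Suc by (simp add: funpow_swap1)
qed simp

lemma pow_pow: "(e ^^ s) ((e ^^ t) x) = (e ^^ (s + t)) x"
  by (simp add: funpow_add)

lemma B_pow_right: "B x ((e ^^ s) y) = (- 1) ^ s * B ((e ^^ s) x) y"
  by (simp add: skew_pow flip: power_add mult.assoc)

lemma sym_pow: "B ((e ^^ s) x) y = eps * (- 1) ^ s * B ((e ^^ s) y) x"
  using skew_pow[of s x y] B_sym[of x] by simp

lemma eps_sign: "eps * (- 1) ^ s = 1 \<or> eps * (- 1) ^ s = - 1"
  using eps by (cases "even s") auto

lemma self_zero: "eps * (- 1) ^ s \<noteq> 1 \<Longrightarrow> B ((e ^^ s) x) x = 0"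
proof -
  assume "eps * (- 1) ^ s \<noteq> 1"
  then have "B ((e ^^ s) x) x = - B ((e ^^ s) x) x"
    using sym_pow[of s x x] eps_sign[of s] by simp
  then have "2 * B ((e ^^ s) x) x = 0" by (metis mult_2 add.right_inverse)
  then show ?thesis using two by simp
qed

lemma pow_zero_above:
  assumes "(e ^^ Suc d) x = 0" "d < t"
  shows "(e ^^ t) x = 0"
proof -
  have "t = (t - Suc d) + Suc d" using assms(2) by simp
  then have "(e ^^ t) x = (e ^^ (t - Suc d)) ((e ^^ Suc d) x)" by (metis pow_pow)
  then show ?thesis using assms(1) linear_map_zero[OF pow_linear] by simp
qed

text \<open>Applied with t > 0 and s + t equal to the top level d. Then the quadratic term vanishes,
  and if the sign \<open>eps * (- 1) ^ s\<close> is 1, \<open>c\<close> enters linearly, with twice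
  a pairing at the top level as factor up to sign.\<close>

lemma B_self_shift:
  "B ((e ^^ s) (x + c *s (e ^^ t) v)) (x + c *s (e ^^ t) v) =
    B ((e ^^ s) x) x + c * (eps * (- 1) ^ s + 1) * (- 1) ^ t * B ((e ^^ (s + t)) x) v
     + c * c * (- 1) ^ t * B ((e ^^ (s + t + t)) v) v"
proof -
  have 1: "B ((e ^^ s) ((e ^^ t) v)) x = eps * (- 1) ^ s * (- 1) ^ t * B ((e ^^ (s + t)) x) v"
    using sym_pow[of "s + t" v x] by (simp add: pow_pow power_add)
  have 2: "B ((e ^^ s) x) ((e ^^ t) v) = (- 1) ^ t * B ((e ^^ (s + t)) x) v"
    using B_pow_right[of "(e ^^ s) x" t v] by (simp add: pow_pow add.commute)
  have 3: "B ((e ^^ s) ((e ^^ t) v)) ((e ^^ t) v) = (- 1) ^ t * B ((e ^^ (s + t + t)) v) v"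
    using B_pow_right[of "(e ^^ (s + t)) v" t v] by (simp add: pow_pow ac_simps)
  have "B ((e ^^ s) (x + c *s (e ^^ t) v)) (x + c *s (e ^^ t) v) =
    B ((e ^^ s) x) x + c * B ((e ^^ s) ((e ^^ t) v)) x + c * B ((e ^^ s) x) ((e ^^ t) v)
     + c * c * B ((e ^^ s) ((e ^^ t) v)) ((e ^^ t) v)"
    by (simp add: linear_map_add[OF pow_linear] linear_map_scale[OF pow_linear] B_add_left
        B_add_right B_scale_left B_scale_right algebra_simps)
  then show ?thesis unfolding 1 2 3 by (simp add: algebra_simps)
qed

text \<open>Descending induction on the level: adding a multiple of \<open>(e ^^ t) v\<close> to x
  alters \<open>B ((e ^^ s) x) x\<close> only for s \<le> d - t, so the levels already cleared stay
  zero. \<open>R\<close> collects what has to survive these corrections.\<close>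

lemma make_isotropic:
  assumes v: "(e ^^ Suc d) v = 0"
    and R: "\<And>x. R x \<Longrightarrow> (e ^^ Suc d) x = 0 \<and> B ((e ^^ d) x) x = 0 \<and> B ((e ^^ d) x) v \<noteq> 0"
    and step: "\<And>x c t. \<lbrakk>R x; 0 < t\<rbrakk> \<Longrightarrow> R (x + c *s (e ^^ t) v)"
    and "R x0"
  shows "\<exists>x. R x \<and> (\<forall>s. B ((e ^^ s) x) x = 0)"
proof -
  have "\<exists>x. R x \<and> (\<forall>s\<ge>d-j. B ((e ^^ s) x) x = 0)" if "j \<le> d" for j
    using that
  proof (induction j)
    case 0
    have "B ((e ^^ s) x0) x0 = 0" if "d \<le> s" for s
      using R[OF \<open>R x0\<close>] pow_zero_above[of d x0 s] that B_zero_left by (cases "s = d") auto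
    then show ?case using \<open>R x0\<close> by auto
  next
    case (Suc j)
    then obtain x where x: "R x" "\<And>s. d - j \<le> s \<Longrightarrow> B ((e ^^ s) x) x = 0" by auto
    define t where "t = Suc j"
    define s0 where "s0 = d - t"
    have st: "s0 + t = d" "0 < t" using Suc.prems by (auto simp: s0_def t_def)
    show ?case
    proof (cases "eps * (- 1) ^ s0 = 1")
      case False
      have "B ((e ^^ s) x) x = 0" if "s0 \<le> s" for s
      proof (cases "s = s0")
        case True
        then show ?thesis using self_zero False by simp
      next
        case False
        then show ?thesis using x(2)[of s] that by (simp add: s0_def t_def)
      qed
      then show ?thesis using x(1) by (auto simp: s0_def t_def)
    next
      case True
      \<comment> \<open>The solution of the linear equation that \<open>B_self_shift\<close> gives
        at level \<open>s0\<close>; for the opposite sign the value is 0 by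
        \<open>self_zero\<close>.\<close>
      define c where "c = - B ((e ^^ s0) x) x / (2 * (- 1) ^ t * B ((e ^^ d) x) v)"
      let ?x = "x + c *s (e ^^ t) v"
      have "B ((e ^^ s) ?x) ?x = 0" if "s0 \<le> s" for s
      proof (cases "s = s0")
        case True
        have "d < s0 + t + t" using st by simp
        then have "(e ^^ (s0 + t + t)) v = 0" by (rule pow_zero_above[OF v])
        then have "B ((e ^^ s0) ?x) ?x = B ((e ^^ s0) x) x + c * 2 * (- 1) ^ t * B ((e ^^ d) x) v"
          unfolding B_self_shift st(1) \<open>eps * (- 1) ^ s0 = 1\<close> by (simp add: B_zero_left)
        also have "\<dots> = 0" using R[OF x(1)] two by (simp add: c_def)
        finally show ?thesis using True by simp
      next
        case False
        then have lt: "d < s + t" "d < s + t + t" using that st by auto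
        have "(e ^^ (s + t)) x = 0" using pow_zero_above lt(1) R[OF x(1)] by blast
        moreover have "(e ^^ (s + t + t)) v = 0" by (rule pow_zero_above[OF v lt(2)])
        moreover have "B ((e ^^ s) x) x = 0" using x(2)[of s] that False by (simp add: s0_def t_def)
        ultimately show ?thesis unfolding B_self_shift by (simp add: B_zero_left)
      qed
      then show ?thesis using step[OF x(1) st(2)] by (auto simp: s0_def t_def)
    qed
  qed
  from this[of d] show ?thesis by auto
qed

text \<open>The descent of \<open>make_isotropic\<close> with x itself in the role of v: the
  corrections leave the value at the top level \<open>d\<close> unchanged.\<close>

lemma normalise_single:
  assumes U: "subspace U" "\<And>x. x \<in> U \<Longrightarrow> e x \<in> U" "\<And>x. x \<in> U \<Longrightarrow> (e ^^ Suc d) x = 0"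
    and w0: "w0 \<in> U" "B ((e ^^ d) w0) w0 \<noteq> 0"
  shows "\<exists>w\<in>U. B ((e ^^ d) w) w \<noteq> 0 \<and> (\<forall>s. s \<noteq> d \<longrightarrow> B ((e ^^ s) w) w = 0)"
proof -
  have powU: "(e ^^ s) x \<in> U" if "x \<in> U" for s x
    using that U(2) by (induction s) auto
  have "\<exists>w\<in>U. B ((e ^^ d) w) w \<noteq> 0 \<and> (\<forall>s\<ge>d-j. s \<noteq> d \<longrightarrow> B ((e ^^ s) w) w = 0)" if "j \<le> d" for j
    using that
  proof (induction j)
    case 0
    have "B ((e ^^ s) w0) w0 = 0" if "d \<le> s" "s \<noteq> d" for s
      using pow_zero_above[OF U(3)[OF w0(1)], of s] that by (simp add: B_zero_left)
    then show ?case using w0 by auto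
  next
    case (Suc j)
    then obtain x where x: "x \<in> U" "B ((e ^^ d) x) x \<noteq> 0"
      "\<And>s. \<lbrakk>d - j \<le> s; s \<noteq> d\<rbrakk> \<Longrightarrow> B ((e ^^ s) x) x = 0" by auto
    define t where "t = Suc j"
    define s0 where "s0 = d - t"
    have st: "s0 + t = d" "0 < t" "s0 \<noteq> d" using Suc.prems by (auto simp: s0_def t_def)
    show ?case
    proof (cases "eps * (- 1) ^ s0 = 1")
      case False
      have "B ((e ^^ s) x) x = 0" if "s0 \<le> s" "s \<noteq> d" for s
      proof (cases "s = s0")
        case True
        then show ?thesis using self_zero False by simp
      next
        case False
        then show ?thesis using x(3)[of s] that by (simp add: s0_def t_def)
      qed
      then show ?thesis using x(1,2) by (auto simp: s0_def t_def)
    next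
      case True
      define c where "c = - B ((e ^^ s0) x) x / (2 * (- 1) ^ t * B ((e ^^ d) x) x)"
      let ?x = "x + c *s (e ^^ t) x"
      have high: "(e ^^ r) x = 0" if "d < r" for r using pow_zero_above[OF U(3)[OF x(1)] that] .
      have "B ((e ^^ s) ?x) ?x = 0" if "s0 \<le> s" "s \<noteq> d" for s
      proof (cases "s = s0")
        case True
        have "(e ^^ (s0 + t + t)) x = 0" using st by (intro high) simp
        then have "B ((e ^^ s0) ?x) ?x = B ((e ^^ s0) x) x + c * 2 * (- 1) ^ t * B ((e ^^ d) x) x"
          unfolding B_self_shift st(1) \<open>eps * (- 1) ^ s0 = 1\<close> by (simp add: B_zero_left)
        also have "\<dots> = 0" using x(2) two by (simp add: c_def)
        finally show ?thesis using True by simp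
      next
        case False
        then have lt: "d < s + t" "d < s + t + t" using that st by auto
        have "B ((e ^^ s) x) x = 0" using x(3)[of s] that False by (simp add: s0_def t_def)
        then show ?thesis unfolding B_self_shift high[OF lt(1)] high[OF lt(2)] by (simp add: B_zero_left)
      qed
      moreover have "B ((e ^^ d) ?x) ?x \<noteq> 0"
      proof -
        have lt: "d < d + t" "d < d + t + t" using st by auto
        show ?thesis unfolding B_self_shift high[OF lt(1)] high[OF lt(2)]
          using x(2) by (simp add: B_zero_left)
      qed
      moreover have "?x \<in> U" using x(1) U(1) powU by (intro subspace_add subspace_scale)
      ultimately show ?thesis by (auto simp: s0_def t_def)
    qed
  qed
  from this[of d] show ?thesis by auto
qed

text \<open>The same descent with \<open>u\<close> kept fixed. The pairing is linear in the vector
  that is corrected, so no case distinction on signs arises.\<close>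

lemma normalise_dual:
  assumes U: "subspace U" "\<And>x. x \<in> U \<Longrightarrow> e x \<in> U" "\<And>x. x \<in> U \<Longrightarrow> (e ^^ Suc d) x = 0"
    and u: "u \<in> U" "v0 \<in> U" "B ((e ^^ d) u) v0 \<noteq> 0"
  shows "\<exists>v\<in>U. B ((e ^^ d) u) v \<noteq> 0 \<and> (\<forall>s. s \<noteq> d \<longrightarrow> B ((e ^^ s) u) v = 0)"
proof -
  have powU: "(e ^^ s) x \<in> U" if "x \<in> U" for s x
    using that U(2) by (induction s) auto
  have high: "(e ^^ r) u = 0" if "d < r" for r using pow_zero_above[OF U(3)[OF u(1)] that] .
  have shift: "B ((e ^^ s) u) (v + c *s (e ^^ t) v) =
      B ((e ^^ s) u) v + c * (- 1) ^ t * B ((e ^^ (s + t)) u) v" for s t v c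
    using B_pow_right[of "(e ^^ s) u" t v]
    by (simp add: B_add_right B_scale_right pow_pow add.commute)
  have "\<exists>v\<in>U. B ((e ^^ d) u) v \<noteq> 0 \<and> (\<forall>s\<ge>d-j. s \<noteq> d \<longrightarrow> B ((e ^^ s) u) v = 0)" if "j \<le> d" for j
    using that
  proof (induction j)
    case 0
    have "B ((e ^^ s) u) v0 = 0" if "d \<le> s" "s \<noteq> d" for s
      using high[of s] that by (simp add: B_zero_left)
    then show ?case using u by auto
  next
    case (Suc j)
    then obtain v where v: "v \<in> U" "B ((e ^^ d) u) v \<noteq> 0"
      "\<And>s. \<lbrakk>d - j \<le> s; s \<noteq> d\<rbrakk> \<Longrightarrow> B ((e ^^ s) u) v = 0" by auto
    define t where "t = Suc j"
    define s0 where "s0 = d - t"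
    have st: "s0 + t = d" "0 < t" "s0 \<noteq> d" using Suc.prems by (auto simp: s0_def t_def)
    define c where "c = - B ((e ^^ s0) u) v / ((- 1) ^ t * B ((e ^^ d) u) v)"
    let ?v = "v + c *s (e ^^ t) v"
    have "B ((e ^^ s) u) ?v = 0" if "s0 \<le> s" "s \<noteq> d" for s
    proof (cases "s = s0")
      case True
      then show ?thesis unfolding shift using v(2) st(1) by (simp add: c_def)
    next
      case False
      then have lt: "d < s + t" using that st by auto
      have "B ((e ^^ s) u) v = 0" using v(3)[of s] that False by (simp add: s0_def t_def)
      then show ?thesis unfolding shift high[OF lt] by (simp add: B_zero_left)
    qed
    moreover have "B ((e ^^ d) u) ?v \<noteq> 0"
    proof -
      have lt: "d < d + t" using st by auto
      show ?thesis unfolding shift high[OF lt] using v(2) by (simp add: B_zero_left)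
    qed
    moreover have "?v \<in> U" using v(1) U(1) powU by (intro subspace_add subspace_scale)
    ultimately show ?case by (auto simp: s0_def t_def)
  qed
  from this[of d] show ?thesis by auto
qed

text \<open>First \<open>u0\<close> is made isotropic with the help of \<open>v0\<close>, then
  \<open>v0\<close> is corrected so as to pair with u at level \<open>d\<close> alone. Adding
  multiples of \<open>(e ^^ t) u\<close> finally makes v isotropic; this preserves its pairing with
  u because u is already isotropic.\<close>

lemma normalise_pair:
  assumes U: "subspace U" "\<And>x. x \<in> U \<Longrightarrow> e x \<in> U" "\<And>x. x \<in> U \<Longrightarrow> (e ^^ Suc d) x = 0"
    and u0: "u0 \<in> U" "v0 \<in> U" "B ((e ^^ d) u0) v0 \<noteq> 0"
    and self: "\<And>x. x \<in> U \<Longrightarrow> B ((e ^^ d) x) x = 0"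
  shows "\<exists>u\<in>U. \<exists>v\<in>U. B ((e ^^ d) u) v \<noteq> 0 \<and> (\<forall>s. s \<noteq> d \<longrightarrow> B ((e ^^ s) u) v = 0) \<and>
    (\<forall>s. B ((e ^^ s) u) u = 0) \<and> (\<forall>s. B ((e ^^ s) v) v = 0)"
proof -
  have powU: "(e ^^ s) x \<in> U" if "x \<in> U" for s x
    using that U(2) by (induction s) auto
  have inU: "x + c *s (e ^^ t) v \<in> U" if "x \<in> U" "v \<in> U" for x c t v
    using that U(1) powU by (intro subspace_add subspace_scale)
  have high: "(e ^^ r) x = 0" if "x \<in> U" "d < r" for r x using pow_zero_above[OF U(3)[OF that(1)] that(2)] .
  have top: "(e ^^ d) (x + c *s (e ^^ t) v) = (e ^^ d) x" if "v \<in> U" "0 < t" for x c t v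
    using that high[of v "d + t"]
    by (simp add: linear_map_add[OF pow_linear] linear_map_scale[OF pow_linear] pow_pow)
  have "\<exists>u. (u \<in> U \<and> B ((e ^^ d) u) v0 \<noteq> 0) \<and> (\<forall>s. B ((e ^^ s) u) u = 0)"
    by (rule make_isotropic[where R = "\<lambda>u. u \<in> U \<and> B ((e ^^ d) u) v0 \<noteq> 0", OF U(3)[OF u0(2)]])
      (use u0 U(3) self inU top in auto)
  then obtain u where u: "u \<in> U" "B ((e ^^ d) u) v0 \<noteq> 0" "\<And>s. B ((e ^^ s) u) u = 0" by blast
  obtain v1 where v1: "v1 \<in> U" "B ((e ^^ d) u) v1 \<noteq> 0" "\<And>s. s \<noteq> d \<Longrightarrow> B ((e ^^ s) u) v1 = 0"
    using normalise_dual[OF U u(1) u0(2) u(2)] by blast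
  let ?R = "\<lambda>v. v \<in> U \<and> B ((e ^^ d) u) v \<noteq> 0 \<and> (\<forall>s. s \<noteq> d \<longrightarrow> B ((e ^^ s) u) v = 0)"
  have shift: "B ((e ^^ s) u) (x + c *s (e ^^ t) u) = B ((e ^^ s) u) x" for s x c t
    using B_pow_right[of "(e ^^ s) u" t u] u(3)
    by (simp add: B_add_right B_scale_right pow_pow)
  have nz: "B ((e ^^ d) x) u \<noteq> 0" if "B ((e ^^ d) u) x \<noteq> 0" for x
    using that sym_pow[of d u x] by auto
  have "\<exists>v. ?R v \<and> (\<forall>s. B ((e ^^ s) v) v = 0)"
  proof (rule make_isotropic[OF U(3)[OF u(1)]])
    show "?R v1" using v1 by blast
    show "(e ^^ Suc d) x = 0 \<and> B ((e ^^ d) x) x = 0 \<and> B ((e ^^ d) x) u \<noteq> 0" if "?R x" for x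
      using that U(3) self nz by blast
    show "?R (x + c *s (e ^^ t) u)" if "?R x" for x c t
      unfolding shift using that inU[OF _ u(1)] by blast
  qed
  then show ?thesis using u by blast
qed

text \<open>A Jordan basis of \<open>U\<close> in which the chain of \<open>w i\<close> pairs only
  with the chain of its dual generator \<open>w (pr i)\<close>. The sign condition says which sizes
  are self-dual: odd ones for a symmetric form, even ones for a skew form. The last clause uses
  \<open>B x (w (pr i)) / kap i\<close> as the functional \<open>phi i\<close> of a Jordan
  system.\<close>

definition gram_on ::
  "'v set \<Rightarrow> nat \<Rightarrow> (nat \<Rightarrow> nat) \<Rightarrow> (nat \<Rightarrow> 'v) \<Rightarrow> (nat \<Rightarrow> nat) \<Rightarrow> (nat \<Rightarrow> 'k) \<Rightarrow> bool" where
  "gram_on U k n w pr kap \<longleftrightarrow>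
    (\<forall>i<k. 0 < n i \<and> w i \<in> U \<and> (e ^^ n i) (w i) = 0 \<and> pr i < k \<and> pr (pr i) = i \<and>
      n (pr i) = n i \<and> kap i \<noteq> 0 \<and> (pr i = i \<longleftrightarrow> eps * (- 1) ^ (n i - 1) = 1) \<and>
      (\<forall>j<k. \<forall>s. B ((e ^^ s) (w i)) (w j) = (if j = pr i \<and> Suc s = n i then kap i else 0))) \<and>
    (\<forall>i j. i \<le> j \<longrightarrow> j < k \<longrightarrow> n i \<le> n j) \<and>
    (\<forall>x\<in>U. x = (\<Sum>i<k. \<Sum>s<n i. (B ((e ^^ (n i - Suc s)) x) (w (pr i)) / kap i) *s (e ^^ s) (w i)))"

lemma gram_onD:
  assumes "gram_on U k n w pr kap"
  shows "i < k \<Longrightarrow> 0 < n i" "i < k \<Longrightarrow> w i \<in> U" "i < k \<Longrightarrow> (e ^^ n i) (w i) = 0"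
    "i < k \<Longrightarrow> pr i < k" "i < k \<Longrightarrow> pr (pr i) = i" "i < k \<Longrightarrow> n (pr i) = n i" "i < k \<Longrightarrow> kap i \<noteq> 0"
    "i < k \<Longrightarrow> pr i = i \<longleftrightarrow> eps * (- 1) ^ (n i - 1) = 1"
    "\<lbrakk>i < k; j < k\<rbrakk> \<Longrightarrow> B ((e ^^ s) (w i)) (w j) = (if j = pr i \<and> Suc s = n i then kap i else 0)"
    "\<lbrakk>i \<le> j; j < k\<rbrakk> \<Longrightarrow> n i \<le> n j"
    "x \<in> U \<Longrightarrow> x = (\<Sum>i<k. \<Sum>s<n i. (B ((e ^^ (n i - Suc s)) x) (w (pr i)) / kap i) *s (e ^^ s) (w i))"
  using assms unfolding gram_on_def by blast+

lemma B_pow_double_sum: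
  "B ((e ^^ r) (\<Sum>i\<in>K. \<Sum>s\<in>S i. c i s *s (e ^^ s) (w i))) y =
    (\<Sum>i\<in>K. \<Sum>s\<in>S i. c i s * B ((e ^^ (r + s)) (w i)) y)"
  by (simp only: linear_map_sum[OF pow_linear] linear_map_scale[OF pow_linear] B_sum_left B_scale_left pow_pow)

text \<open>The chains with indices from \<open>k\<close> to \<open>l - 1\<close> are split off;
  they are put behind the \<open>k\<close> others, so that the sizes ascend. Demanding all levels s
  yields the orthogonal complement of the whole chains, which is invariant under
  \<open>e\<close>.\<close>

definition new_complement :: "'v set \<Rightarrow> nat \<Rightarrow> nat \<Rightarrow> (nat \<Rightarrow> 'v) \<Rightarrow> 'v set" where
  "new_complement U k l w = {x\<in>U. \<forall>i\<in>{k..<l}. \<forall>s. B ((e ^^ s) x) (w i) = 0}"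

text \<open>The orthogonal projection to the new chains, all of length d + 1, with the coefficients
  read off by the dual generators \<open>w (pr i)\<close>.\<close>

definition new_part ::
  "nat \<Rightarrow> nat \<Rightarrow> nat \<Rightarrow> (nat \<Rightarrow> 'v) \<Rightarrow> (nat \<Rightarrow> nat) \<Rightarrow> (nat \<Rightarrow> 'k) \<Rightarrow> 'v \<Rightarrow> 'v" where
  "new_part d k l w pr kap x =
    (\<Sum>i\<in>{k..<l}. \<Sum>s<Suc d. (B ((e ^^ (d - s)) x) (w (pr i)) / kap i) *s (e ^^ s) (w i))"

context
  fixes U :: "'v set" and d k l :: nat and n :: "nat \<Rightarrow> nat" and w :: "nat \<Rightarrow> 'v"
    and pr :: "nat \<Rightarrow> nat" and kap :: "nat \<Rightarrow> 'k"
  assumes U: "subspace U" "\<And>x. x \<in> U \<Longrightarrow> e x \<in> U" "\<And>x. x \<in> U \<Longrightarrow> (e ^^ Suc d) x = 0"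
    and kl: "k < l"
    and new: "\<And>i. \<lbrakk>k \<le> i; i < l\<rbrakk> \<Longrightarrow> n i = Suc d \<and> w i \<in> U \<and> k \<le> pr i \<and> pr i < l \<and> pr (pr i) = i \<and>
        kap i \<noteq> 0 \<and> (pr i = i \<longleftrightarrow> eps * (- 1) ^ d = 1)"
    and gram: "\<And>i j s. \<lbrakk>k \<le> i; i < l; k \<le> j; j < l\<rbrakk> \<Longrightarrow>
        B ((e ^^ s) (w i)) (w j) = (if j = pr i \<and> s = d then kap i else 0)"
begin

lemma powU: "x \<in> U \<Longrightarrow> (e ^^ s) x \<in> U"
  using U(2) by (induction s) auto

lemma highU: "\<lbrakk>x \<in> U; d < r\<rbrakk> \<Longrightarrow> (e ^^ r) x = 0"
  using pow_zero_above[OF U(3)] by blast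

lemma new_part_in: "new_part d k l w pr kap x \<in> U"
  unfolding new_part_def using new powU U(1) by (intro subspace_sum subspace_scale) auto

lemma complement_projection:
  assumes x: "x \<in> U"
  shows "x - new_part d k l w pr kap x \<in> (new_complement U k l w)"
proof -
  have "B ((e ^^ r) (x - new_part d k l w pr kap x)) (w j) = 0" if j: "j \<in> {k..<l}" for j r
  proof -
    have pj: "k \<le> pr j" "pr j < l" "pr (pr j) = j" "kap (pr j) \<noteq> 0" using new[of j] new[of "pr j"] j by auto
    have "B ((e ^^ r) (new_part d k l w pr kap x)) (w j) =
      (\<Sum>i\<in>{k..<l}. \<Sum>s<Suc d. (B ((e ^^ (d - s)) x) (w (pr i)) / kap i) * B ((e ^^ (r + s)) (w i)) (w j))"
      unfolding new_part_def by (rule B_pow_double_sum)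
    also have "\<dots> = (\<Sum>i\<in>{k..<l}. if i = pr j then (\<Sum>s<Suc d. if s = d - r then
        (if r \<le> d then B ((e ^^ r) x) (w j) else 0) else 0) else 0)"
    proof (intro sum.cong refl)
      fix i assume i: "i \<in> {k..<l}"
      show "(\<Sum>s<Suc d. (B ((e ^^ (d - s)) x) (w (pr i)) / kap i) * B ((e ^^ (r + s)) (w i)) (w j)) =
        (if i = pr j then (\<Sum>s<Suc d. if s = d - r then (if r \<le> d then B ((e ^^ r) x) (w j) else 0) else 0) else 0)"
      proof (cases "i = pr j")
        case True
        have "(B ((e ^^ (d - s)) x) (w (pr i)) / kap i) * B ((e ^^ (r + s)) (w i)) (w j) =
          (if s = d - r then (if r \<le> d then B ((e ^^ r) x) (w j) else 0) else 0)" if "s < Suc d" for s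
        proof (cases "r + s = d")
          case True
          then have "s = d - r" "d - s = r" "r \<le> d" by auto
          then show ?thesis using gram[of i j "r + s"] i j pj \<open>i = pr j\<close> True by simp
        next
          case False
          then have "\<not> (s = d - r \<and> r \<le> d)" using that by auto
          then show ?thesis using gram[of i j "r + s"] i j False by auto
        qed
        then have "(\<Sum>s<Suc d. (B ((e ^^ (d - s)) x) (w (pr i)) / kap i) * B ((e ^^ (r + s)) (w i)) (w j)) =
          (\<Sum>s<Suc d. if s = d - r then (if r \<le> d then B ((e ^^ r) x) (w j) else 0) else 0)"
          by (intro sum.cong) auto
        then show ?thesis using True by (simp only: if_True simp_thms)
      next
        case False
        then have "j \<noteq> pr i" using new[of i] i by auto
        then have "(\<Sum>s<Suc d. (B ((e ^^ (d - s)) x) (w (pr i)) / kap i) * B ((e ^^ (r + s)) (w i)) (w j)) = 0"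
          using gram[of i j] i j by (intro sum.neutral) auto
        then show ?thesis using False by (simp only: if_False simp_thms)
      qed
    qed
    also have "\<dots> = (\<Sum>s<Suc d. if s = d - r then (if r \<le> d then B ((e ^^ r) x) (w j) else 0) else 0)"
      using pj by (simp del: sum.lessThan_Suc)
    also have "\<dots> = (if r \<le> d then B ((e ^^ r) x) (w j) else 0)"
      by (rule sum_single_row(1)) simp
    also have "\<dots> = B ((e ^^ r) x) (w j)"
      using highU[OF x, of r] by (simp add: B_zero_left)
    finally show ?thesis by (simp add: linear_map_diff[OF pow_linear] B_diff_left)
  qed
  then show ?thesis
    using subspace_diff[OF U(1) x new_part_in] unfolding new_complement_def by auto
qed

lemma complement_subspace: "subspace (new_complement U k l w)"
proof (rule subspaceI)
  show "0 \<in> (new_complement U k l w)"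
    using subspace_0[OF U(1)] linear_map_zero[OF pow_linear]
    unfolding new_complement_def by (simp add: B_zero_left)
  show "x + y \<in> (new_complement U k l w)" if "x \<in> (new_complement U k l w)" "y \<in> (new_complement U k l w)" for x y
    using that subspace_add[OF U(1)] unfolding new_complement_def
    by (simp add: linear_map_add[OF pow_linear] B_add_left)
  show "c *s x \<in> (new_complement U k l w)" if "x \<in> (new_complement U k l w)" for c x
    using that subspace_scale[OF U(1)] unfolding new_complement_def
    by (simp add: linear_map_scale[OF pow_linear] B_scale_left)
qed

lemma complement_invariant: "x \<in> (new_complement U k l w) \<Longrightarrow> e x \<in> (new_complement U k l w)"
proof -
  assume x: "x \<in> (new_complement U k l w)"
  have "B ((e ^^ s) (e x)) (w i) = 0" if "i \<in> {k..<l}" for i s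
  proof -
    have "B ((e ^^ Suc s) x) (w i) = 0" using x that unfolding new_complement_def by blast
    then show ?thesis by (simp only: funpow_Suc_right comp_apply)
  qed
  moreover have "e x \<in> U" using x U(2) unfolding new_complement_def by blast
  ultimately show ?thesis unfolding new_complement_def by blast
qed

lemma complement_orthogonal: "x \<in> (new_complement U k l w) \<Longrightarrow> B x (new_part d k l w pr kap y) = 0"
proof -
  assume x: "x \<in> (new_complement U k l w)"
  have z: "B x ((e ^^ s) (w i)) = 0" if "i \<in> {k..<l}" for i s
    using x that B_pow_right[of x s "w i"] unfolding new_complement_def by simp
  show ?thesis
    unfolding new_part_def B_sum_right B_scale_right by (intro sum.neutral ballI) (simp add: z)
qed

lemma complement_nondegenerate:
  assumes nd: "\<And>x. \<lbrakk>x \<in> U; \<And>y. y \<in> U \<Longrightarrow> B x y = 0\<rbrakk> \<Longrightarrow> x = 0"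
    and x: "x \<in> (new_complement U k l w)" "\<And>y. y \<in> (new_complement U k l w) \<Longrightarrow> B x y = 0"
  shows "x = 0"
proof (rule nd)
  show "x \<in> U" using x(1) unfolding new_complement_def by blast
  fix y assume "y \<in> U"
  then have "B x (y - new_part d k l w pr kap y) = 0" using x(2) complement_projection by blast
  moreover have "B x y = B x (y - new_part d k l w pr kap y) + B x (new_part d k l w pr kap y)" by (simp flip: B_add_right)
  ultimately show "B x y = 0" using complement_orthogonal[OF x(1)] by simp
qed

lemma complement_dim: "dim (new_complement U k l w) < dim U"
proof (rule dim_psubspace[OF complement_subspace U(1), of "w k"])
  show "(new_complement U k l w) \<subseteq> U" unfolding new_complement_def by blast
  have nk: "w k \<in> U" "k \<le> pr k" "pr k < l" "kap k \<noteq> 0" using new[of k] kl by auto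
  show "w k \<in> U" by fact
  have "B ((e ^^ d) (w k)) (w (pr k)) \<noteq> 0" using gram[of k "pr k" d] nk kl by simp
  then show "w k \<notin> (new_complement U k l w)" using nk unfolding new_complement_def by auto
qed

lemma gram_on_extend:
  assumes "gram_on (new_complement U k l w) k n w pr kap"
  shows "gram_on U l n w pr kap"
proof -
  note old = gram_onD[OF assms]
  have cU: "(new_complement U k l w) \<subseteq> U" unfolding new_complement_def by blast
  have cross: "B ((e ^^ s) (w i)) (w j) = 0" if "i < k" "k \<le> j" "j < l" for i j s
    using old(2)[OF that(1)] that(2,3) unfolding new_complement_def by auto
  have cross': "B ((e ^^ s) (w i)) (w j) = 0" if "j < k" "k \<le> i" "i < l" for i j s
    using cross[OF that, of s] sym_pow[of s "w i" "w j"] by simp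
  \<comment> \<open>The last vector of an old chain is nonzero because it pairs to
    \<open>kap i\<close>, so no old chain is longer than the new ones and the sizes ascend.\<close>
  have size: "n i \<le> Suc d" if "i < k" for i
  proof (rule ccontr)
    assume "\<not> n i \<le> Suc d"
    then have "(e ^^ (n i - 1)) (w i) = 0" using old(2)[OF that] cU by (intro highU) auto
    then show False using old(9)[OF that old(4)[OF that], of "n i - 1"] old(1,7)[OF that] by (simp add: B_zero_left)
  qed
  show ?thesis
    unfolding gram_on_def
  proof (intro conjI allI ballI impI)
    fix i assume i: "i < l"
    show "0 < n i" "w i \<in> U" "(e ^^ n i) (w i) = 0" "pr i < l" "pr (pr i) = i" "n (pr i) = n i" "kap i \<noteq> 0"
      "(pr i = i) = (eps * (- 1) ^ (n i - 1) = 1)"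
      using old(1-8)[of i] new[of i] new[of "pr i"] i kl cU U(3)[of "w i"] by (cases "i < k"; force)+
    fix j s assume j: "j < l"
    show "B ((e ^^ s) (w i)) (w j) = (if j = pr i \<and> Suc s = n i then kap i else 0)"
    proof (cases "i < k")
      case True
      then show ?thesis using old(4)[OF True] old(9)[OF True, of j s] cross[OF True, of j s] j by (cases "j < k") auto
    next
      case False
      then show ?thesis using new[of i] gram[of i j s] cross'[of j i s] i j by (cases "j < k") auto
    qed
  next
    fix i j assume ij: "i \<le> j" "j < l"
    show "n i \<le> n j"
    proof (cases "j < k")
      case True
      then show ?thesis using old(10) ij by blast
    next
      case False
      then show ?thesis using new[of j] new[of i] size[of i] ij by (cases "i < k") auto
    qed
  next
    fix x assume x: "x \<in> U"
    have eq: "B ((e ^^ r) (x - new_part d k l w pr kap x)) (w j) = B ((e ^^ r) x) (w j)" if "j < k" for r j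
    proof -
      have "B ((e ^^ r) (new_part d k l w pr kap x)) (w j) = 0"
        unfolding new_part_def B_pow_double_sum using cross'[OF that] by (intro sum.neutral) auto
      then show ?thesis by (simp add: linear_map_diff[OF pow_linear] B_diff_left)
    qed
    let ?f = "\<lambda>i. \<Sum>s<n i. (B ((e ^^ (n i - Suc s)) x) (w (pr i)) / kap i) *s (e ^^ s) (w i)"
    have 1: "x - new_part d k l w pr kap x = (\<Sum>i<k. ?f i)"
    proof (rule trans[OF old(11)[OF complement_projection[OF x]]])
      show "(\<Sum>i<k. \<Sum>s<n i. (B ((e ^^ (n i - Suc s)) (x - new_part d k l w pr kap x)) (w (pr i)) / kap i) *s (e ^^ s) (w i)) =
        (\<Sum>i<k. ?f i)"
        using eq[OF old(4)] by (intro sum.cong) auto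
    qed
    have 2: "new_part d k l w pr kap x = (\<Sum>i\<in>{k..<l}. ?f i)"
      unfolding new_part_def using new by (intro sum.cong) auto
    have "(\<Sum>i<l. ?f i) = (\<Sum>i<k. ?f i) + (\<Sum>i\<in>{k..<l}. ?f i)"
      unfolding lessThan_atLeast0 using kl by (simp add: sum.atLeastLessThan_concat)
    also have "\<dots> = x" unfolding 1[symmetric] 2[symmetric] by simp
    finally show "x = (\<Sum>i<l. ?f i)" ..
  qed
qed

end

lemma gram_on_cong:
  assumes "\<And>i. i < k \<Longrightarrow> n i = n' i \<and> w i = w' i \<and> pr i = pr' i \<and> kap i = kap' i" "gram_on U k n w pr kap"
  shows "gram_on U k n' w' pr' kap'"
proof -
  note g = gram_onD[OF assms(2)]
  have pr: "w (pr i) = w' (pr' i)" "n (pr i) = n' (pr' i)" "pr (pr i) = pr' (pr' i)" if "i < k" for i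
    using assms(1)[OF that] assms(1)[OF g(4)[OF that]] by auto
  show ?thesis
    unfolding gram_on_def
  proof (intro conjI allI ballI impI)
    fix x assume "x \<in> U"
    from g(11)[OF this]
    show "x = (\<Sum>i<k. \<Sum>s<n' i. (B ((e ^^ (n' i - Suc s)) x) (w' (pr' i)) / kap' i) *s (e ^^ s) (w' i))"
      by (rule trans) (intro sum.cong, use assms(1) pr in auto)
  next
    fix i j :: nat assume "i \<le> j" "j < k"
    then show "n' i \<le> n' j" using g(10) assms(1) by (metis order.strict_trans1)
  next
    fix i assume i: "i < k"
    show "0 < n' i" "w' i \<in> U" "(e ^^ n' i) (w' i) = 0" "pr' i < k" "pr' (pr' i) = i" "n' (pr' i) = n' i" "kap' i \<noteq> 0"
      "(pr' i = i) = (eps * (- 1) ^ (n' i - 1) = 1)"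
      using g(1-8)[OF i] assms(1)[OF i] pr[OF i] by simp_all
    fix j s assume "j < k"
    then show "B ((e ^^ s) (w' i)) (w' j) = (if j = pr' i \<and> Suc s = n' i then kap' i else 0)"
      using g(9)[OF i, of j s] assms(1)[of i] assms(1)[of j] i by simp
  qed
qed

text \<open>Longest chains are split off: a single one if B(e^d x, x) is nonzero for some x, a dual
  pair otherwise. The orthogonal complement is again invariant and nondegenerate.\<close>

lemma exists_gram_on:
  assumes "subspace U" "\<And>x. x \<in> U \<Longrightarrow> e x \<in> U"
    "\<And>x. \<lbrakk>x \<in> U; \<And>y. y \<in> U \<Longrightarrow> B x y = 0\<rbrakk> \<Longrightarrow> x = 0"
  shows "\<exists>k n w pr kap. gram_on U k n w pr kap"
  using assms
proof (induction "dim U" arbitrary: U rule: less_induct)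
  case less
  note U = less.prems
  show ?case
  proof (cases "\<forall>v\<in>U. v = 0")
    case True
    then show ?thesis by (intro exI[of _ 0]) (auto simp: gram_on_def)
  next
    case False
    obtain N where "\<And>v. (e ^^ N) v = 0" using e_nilpotent unfolding nilpotent_endo_def by blast
    then obtain d w0 where d: "\<And>v. v \<in> U \<Longrightarrow> (e ^^ Suc d) v = 0" and w0: "w0 \<in> U" "(e ^^ d) w0 \<noteq> 0"
      using nilpotent_on_top[where U = U and e = e and N = N] False by blast
    have powU: "(e ^^ s) x \<in> U" if "x \<in> U" for s x
      using that U(2) by (induction s) auto
    \<comment> \<open>\<open>m\<close> chains are split off, 1 or 2. They are numbered from 0 to
      apply the induction hypothesis to their complement, and then from \<open>k\<close> on, where
      \<open>k\<close> is the number of blocks that the hypothesis provides.\<close>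
    have build: ?thesis
      if "m < 3" and kl: "0 < m"
        and new: "\<And>i. i < m \<Longrightarrow> u i \<in> U \<and> q i < m \<and> q (q i) = i \<and> c i \<noteq> 0 \<and> (q i = i \<longleftrightarrow> eps * (- 1) ^ d = 1)"
        and gram: "\<And>i j s. \<lbrakk>i < m; j < m\<rbrakk> \<Longrightarrow>
          B ((e ^^ s) (u i)) (u j) = (if j = q i \<and> s = d then c i else 0)"
      for m u and q :: "nat \<Rightarrow> nat" and c
    proof -
      define U' where "U' = {x\<in>U. \<forall>i\<in>{0..<m}. \<forall>s. B ((e ^^ s) x) (u i) = 0}"
      have a: "0 < m"
        "\<And>i. \<lbrakk>0 \<le> i; i < m\<rbrakk> \<Longrightarrow> (\<lambda>_. Suc d) i = Suc d \<and> u i \<in> U \<and> 0 \<le> q i \<and> q i < m \<and> q (q i) = i \<and>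
          c i \<noteq> 0 \<and> (q i = i \<longleftrightarrow> eps * (- 1) ^ d = 1)"
        "\<And>i j s. \<lbrakk>0 \<le> i; i < m; 0 \<le> j; j < m\<rbrakk> \<Longrightarrow>
          B ((e ^^ s) (u i)) (u j) = (if j = q i \<and> s = d then c i else 0)"
        using kl new gram by auto
      note ctx = U(1,2) d a
      have U'_eq: "new_complement U 0 m u = U'"
        unfolding U'_def new_complement_def by simp
      obtain k n w pr kap where J: "gram_on U' k n w pr kap"
        using less.hyps[of U'] complement_dim[where U = U and d = d and k = 0 and l = m and n = "\<lambda>_. Suc d" and w = u and pr = q and kap = c, OF ctx] complement_subspace[where U = U and d = d and k = 0 and l = m and n = "\<lambda>_. Suc d" and w = u and pr = q and kap = c, OF ctx]
          complement_invariant[where U = U and d = d and k = 0 and l = m and n = "\<lambda>_. Suc d" and w = u and pr = q and kap = c, OF ctx] complement_nondegenerate[where U = U and d = d and k = 0 and l = m and n = "\<lambda>_. Suc d" and w = u and pr = q and kap = c, OF ctx U(3)]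
        unfolding U'_eq by blast
      define l where "l = k + m"
      define n' where "n' = (\<lambda>i. if i < k then n i else Suc d)"
      define w' where "w' = (\<lambda>i. if i < k then w i else u (i - k))"
      define pr' where "pr' = (\<lambda>i. if i < k then pr i else k + q (i - k))"
      define kap' where "kap' = (\<lambda>i. if i < k then kap i else c (i - k))"
      have b: "k < l"
        "\<And>i. \<lbrakk>k \<le> i; i < l\<rbrakk> \<Longrightarrow> n' i = Suc d \<and> w' i \<in> U \<and> k \<le> pr' i \<and> pr' i < l \<and> pr' (pr' i) = i \<and>
          kap' i \<noteq> 0 \<and> (pr' i = i \<longleftrightarrow> eps * (- 1) ^ d = 1)"
        "\<And>i j s. \<lbrakk>k \<le> i; i < l; k \<le> j; j < l\<rbrakk> \<Longrightarrow>
          B ((e ^^ s) (w' i)) (w' j) = (if j = pr' i \<and> s = d then kap' i else 0)"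
      proof -
        show "k < l" using kl by (simp add: l_def)
        fix i assume i: "k \<le> i" "i < l"
        then have i': "i - k < m" by (auto simp: l_def)
        have "k + q (i - k) = i \<longleftrightarrow> q (i - k) = i - k" using i by auto
        then show "n' i = Suc d \<and> w' i \<in> U \<and> k \<le> pr' i \<and> pr' i < l \<and> pr' (pr' i) = i \<and>
          kap' i \<noteq> 0 \<and> (pr' i = i \<longleftrightarrow> eps * (- 1) ^ d = 1)"
          using new[OF i'] i by (auto simp: n'_def w'_def pr'_def kap'_def l_def)
        fix j s assume j: "k \<le> j" "j < l"
        then have j': "j - k < m" by (auto simp: l_def)
        have "j = k + q (i - k) \<longleftrightarrow> j - k = q (i - k)" using j by auto
        then show "B ((e ^^ s) (w' i)) (w' j) = (if j = pr' i \<and> s = d then kap' i else 0)"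
          using gram[OF i' j', of s] i j by (simp add: w'_def pr'_def kap'_def)
      qed
      note ctx' = U(1,2) d b
      have "new_complement U k l w' = U'"
      proof -
        have "(\<forall>i\<in>{k..<l}. P (w' i)) \<longleftrightarrow> (\<forall>i\<in>{0..<m}. P (u i))" for P
        proof
          assume h: "\<forall>i\<in>{k..<l}. P (w' i)"
          show "\<forall>i\<in>{0..<m}. P (u i)"
          proof
            fix i assume "i \<in> {0..<m}"
            then have "P (w' (k + i))" using h by (auto simp: l_def)
            then show "P (u i)" by (simp add: w'_def)
          qed
        next
          assume "\<forall>i\<in>{0..<m}. P (u i)"
          then show "\<forall>i\<in>{k..<l}. P (w' i)" by (auto simp: l_def w'_def)
        qed
        from this[of "\<lambda>y. \<forall>s. B ((e ^^ s) x) y = 0" for x] show ?thesis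
          unfolding U'_def new_complement_def by blast
      qed
      then have "gram_on (new_complement U k l w') k n' w' pr' kap'"
        using J by (auto simp: n'_def w'_def pr'_def kap'_def intro: gram_on_cong[rotated])
      then show ?thesis using gram_on_extend[where U = U and d = d and k = k and l = l and n = n' and w = w' and pr = pr' and kap = kap', OF ctx'] by blast
    qed
    show ?thesis
    proof (cases "\<exists>x\<in>U. B ((e ^^ d) x) x \<noteq> 0")
      case True
      then obtain w where w: "w \<in> U" "B ((e ^^ d) w) w \<noteq> 0" "\<And>s. s \<noteq> d \<Longrightarrow> B ((e ^^ s) w) w = 0"
        using normalise_single[OF U(1,2) d] by blast
      have "eps * (- 1) ^ d = 1" using self_zero w(2) by blast
      then show ?thesis
        using w by (intro build[where m = 1 and u = "\<lambda>_. w" and q = "\<lambda>_. 0" and c = "\<lambda>_. B ((e ^^ d) w) w"]) auto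
    next
      case False
      then have self: "\<And>x. x \<in> U \<Longrightarrow> B ((e ^^ d) x) x = 0" by blast
      obtain v0 where v0: "v0 \<in> U" "B ((e ^^ d) w0) v0 \<noteq> 0"
        using U(3)[OF powU[OF w0(1)]] w0(2) by blast
      \<comment> \<open>For the sign 1 the form B(e^d x, y) would be symmetric with all its values
        on the diagonal 0; polarisation would make it vanish on \<open>U\<close>, against
        \<open>v0\<close>.\<close>
      have sign: "eps * (- 1) ^ d \<noteq> 1"
      proof
        assume s: "eps * (- 1) ^ d = 1"
        have "w0 + v0 \<in> U" using U(1) w0(1) v0(1) by (rule subspace_add)
        then have "B ((e ^^ d) (w0 + v0)) (w0 + v0) = 0" by (rule self)
        then have "B ((e ^^ d) w0) v0 + B ((e ^^ d) v0) w0 = 0"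
          using self[OF w0(1)] self[OF v0(1)]
          by (simp add: linear_map_add[OF pow_linear] B_add_left B_add_right add.commute)
        then have "2 * B ((e ^^ d) w0) v0 = 0"
          using sym_pow[of d v0 w0] s by simp
        then show False using two v0(2) by simp
      qed
      obtain u v where uv: "u \<in> U" "v \<in> U" "B ((e ^^ d) u) v \<noteq> 0"
        "\<And>s. s \<noteq> d \<Longrightarrow> B ((e ^^ s) u) v = 0" "\<And>s. B ((e ^^ s) u) u = 0" "\<And>s. B ((e ^^ s) v) v = 0"
        using normalise_pair[OF U(1,2) d w0(1) v0 self] by blast
      have vu1: "B ((e ^^ d) v) u \<noteq> 0"
        using uv(3) sym_pow[of d u v] by auto
      have vu2: "B ((e ^^ s) v) u = 0" if "s \<noteq> d" for s
        using uv(4)[OF that] sym_pow[of s v u] by simp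
      define f where "f = (\<lambda>i::nat. if i = 0 then u else v)"
      have f: "f 0 = u" "f (Suc 0) = v" by (simp_all add: f_def)
      show ?thesis
      proof (rule build[where m = 2 and u = f and q = "\<lambda>i. 1 - i" and
            c = "\<lambda>i. if i = 0 then B ((e ^^ d) u) v else B ((e ^^ d) v) u"])
        fix i :: nat assume i: "i < 2"
        then consider (a) "i = 0" | (b) "i = Suc 0" by linarith
        note ci = this
        show "f i \<in> U \<and> 1 - i < 2 \<and> 1 - (1 - i) = i \<and> (if i = 0 then B ((e ^^ d) u) v else B ((e ^^ d) v) u) \<noteq> 0 \<and>
          (1 - i = i \<longleftrightarrow> eps * (- 1) ^ d = 1)"
          using ci
        proof cases
          case a
          show ?thesis unfolding a f using uv(1,3) sign by simp
        next
          case b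
          show ?thesis unfolding b f using uv(2) vu1 sign by simp
        qed
        fix j s assume "j < (2::nat)"
        then consider (c) "j = 0" | (d) "j = Suc 0" by linarith
        note cj = this
        show "B ((e ^^ s) (f i)) (f j) = (if j = 1 - i \<and> s = d then
            (if i = 0 then B ((e ^^ d) u) v else B ((e ^^ d) v) u) else 0)"
          using ci
        proof cases
          case a
          from cj show ?thesis
          proof cases
            case c
            show ?thesis unfolding a c f using uv(5)[of s] by simp
          next
            case d
            show ?thesis unfolding a d f using uv(4)[of s] by (cases "s = d") simp_all
          qed
        next
          case b
          from cj show ?thesis
          proof cases
            case c
            show ?thesis unfolding b c f using vu2[of s] by (cases "s = d") simp_all
          next
            case d
            show ?thesis unfolding b d f using uv(6)[of s] by simp
          qed
        qed
      qed simp_all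
    qed
  qed
qed

lemma exists_gram:
  "\<exists>k n w pr kap. gram_on UNIV k n w pr kap"
  using B_nondegenerate by (intro exists_gram_on subspace_UNIV) auto

lemma gram_jordan_system:
  assumes "gram_on UNIV k n w pr kap"
  shows "jordan_system scale e k n w (\<lambda>i v. B v (w (pr i)) / kap i)"
proof (rule jordan_system.intro[OF vector_space_axioms], rule jordan_system_axioms.intro)
  note g = gram_onD[OF assms]
  fix i assume i: "i < k"
  show "0 < n i" "(e ^^ n i) (w i) = 0" using g(1,3)[OF i] by auto
  show "Vector_Spaces.linear scale (*) (\<lambda>v. B v (w (pr i)) / kap i)"
    unfolding Vector_Spaces.linear_iff
    using vector_space_axioms vector_space_mult by (simp add: B_add_left B_scale_left add_divide_distrib)
  fix j s assume j: "j < k"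
  have "pr i = pr j \<longleftrightarrow> i = j" using g(5)[OF i] g(5)[OF j] by metis
  then show "B ((e ^^ s) (w j)) (w (pr i)) / kap i = (if i = j \<and> Suc s = n i then 1 else 0)"
    using g(9)[OF j g(4)[OF i], of s] g(7)[OF i] by auto
next
  fix v show "v = (\<Sum>i<k. \<Sum>s<n i. (B ((e ^^ (n i - Suc s)) v) (w (pr i)) / kap i) *s (e ^^ s) (w i))"
    by (rule gram_onD(11)[OF assms]) simp
qed (rule e_linear)

end

section \<open>Coordinates of stabilising elements\<close>

text \<open>
  \<open>c m j \<rho>\<close> stands for the coefficient of \<open>e\<^sup>s w\<^sub>j\<close>, \<open>s = n j - 1 - \<rho>\<close>, in \<open>\<xi> w\<^sub>m\<close>, where \<open>\<xi>\<close>
  commutes with \<open>e\<close>. The assumption \<open>stab\<close> says that \<open>\<xi>\<close> stabilises the functional with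
  coefficient matrix \<open>X\<close> at the level \<open>s = n j - 1\<close> and diagonal \<open>Y\<close> at the level \<open>s = n j - 2\<close>.
\<close>

locale stabiliser_coordinates =
  fixes k :: nat and n :: "nat \<Rightarrow> nat" and X :: "nat \<Rightarrow> nat \<Rightarrow> 'k::field" and Y :: "nat \<Rightarrow> 'k"
    and c :: "nat \<Rightarrow> nat \<Rightarrow> nat \<Rightarrow> 'k"
  assumes n_pos: "i < k \<Longrightarrow> 0 < n i"
    and range: "\<lbrakk>m < k; j < k; n m \<le> \<rho> \<or> n j \<le> \<rho>\<rbrakk> \<Longrightarrow> c m j \<rho> = 0"
    and stab: "\<lbrakk>i < k; m < k; r < n i; r < n m\<rbrakk> \<Longrightarrow>
      (\<Sum>j<k. X i j * c m j (n m - 1 - r)) + Y i * c m i (n m - r) =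
      (\<Sum>l<k. X l m * c l i (n i - 1 - r)) + Y m * c m i (n i - r)"

lemma sum_lessThan_single:
  fixes g :: "nat \<Rightarrow> 'a::comm_monoid_add"
  assumes "l < k" "\<And>j. \<lbrakk>j < k; j \<noteq> l\<rbrakk> \<Longrightarrow> g j = 0"
  shows "(\<Sum>j<k. g j) = g l"
  using assms by (subst sum.remove[of _ l]) (auto intro: sum.neutral)

text \<open>For a diagonal \<open>X\<close> each equation compares \<open>c m i\<close> at two
  levels that differ by the difference of the block sizes. For equal sizes the distinct weights give
  zero; for different sizes the higher level vanishes by induction and the nonzero weight of the
  larger block does the rest. A block of the smallest size may thus have weight 0, which saves a
  field element.\<close>

lemma (in stabiliser_coordinates) off_diagonal_zero:
  assumes Y: "\<And>i. i < k \<Longrightarrow> Y i = 0"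
    and X: "\<And>i j. \<lbrakk>i < k; j < k; i \<noteq> j\<rbrakk> \<Longrightarrow> X i j = 0"
    and eq: "\<And>i j. \<lbrakk>i < k; j < k; i \<noteq> j; n i = n j\<rbrakk> \<Longrightarrow> X i i \<noteq> X j j"
    and nz: "\<And>i j. \<lbrakk>i < k; j < k; n i < n j\<rbrakk> \<Longrightarrow> X j j \<noteq> 0"
    and im: "i < k" "m < k" "i \<noteq> m"
  shows "c m i \<rho> = 0"
proof -
  have E: "X i i * c m i (n m - 1 - r) = X m m * c m i (n i - 1 - r)" if "r < n i" "r < n m" for r
    using stab[OF im(1,2) that] X Y im
      sum_lessThan_single[OF im(1), of "\<lambda>j. X i j * c m j (n m - 1 - r)"]
      sum_lessThan_single[OF im(2), of "\<lambda>l. X l m * c l i (n i - 1 - r)"] by simp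
  show ?thesis
  proof (induction "n i - \<rho>" arbitrary: \<rho> rule: less_induct)
    case less
    show ?case
    proof (cases "n m \<le> \<rho> \<or> n i \<le> \<rho>")
      case True
      then show ?thesis using range im by blast
    next
      case False
      consider "n i = n m" | "n i < n m" | "n m < n i" by linarith
      then show ?thesis
      proof cases
        case 1
        then show ?thesis using E[of "n i - 1 - \<rho>"] eq[of i m] False im by auto
      next
        case 2
        have "c m i (\<rho> + (n m - n i)) = 0" using 2 False by (intro less) linarith
        moreover have "n m - 1 - (n i - 1 - \<rho>) = \<rho> + (n m - n i)"
          "n i - 1 - (n i - 1 - \<rho>) = \<rho>" using 2 False by linarith+
        ultimately show ?thesis
          using E[of "n i - 1 - \<rho>"] nz[OF im(1,2) 2] 2 False by simp
      next
        case 3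
        have "c m i (\<rho> + (n i - n m)) = 0" using 3 False by (intro less) linarith
        moreover have "n i - 1 - (n m - 1 - \<rho>) = \<rho> + (n i - n m)"
          "n m - 1 - (n m - 1 - \<rho>) = \<rho>" using 3 False by linarith+
        ultimately show ?thesis
          using E[of "n m - 1 - \<rho>"] nz[OF im(2,1) 3] 3 False by simp
      qed
    qed
  qed
qed

text \<open>The equation is renumbered so that one side stands at level \<open>s\<close> and the
  other at \<open>s\<close> plus the difference of the sizes; the inductions on levels live on this
  shift.\<close>

lemma (in stabiliser_coordinates) stab_le:
  assumes "i < k" "j < k" "n j \<le> n i" "s < n j"
  shows "(\<Sum>l<k. X i l * c j l s) + Y i * c j i (Suc s) =
    (\<Sum>l<k. X l j * c l i (s + (n i - n j))) + Y j * c j i (Suc (s + (n i - n j)))"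
proof -
  have e: "n j - 1 - (n j - 1 - s) = s" "n j - (n j - 1 - s) = Suc s"
    "n i - 1 - (n j - 1 - s) = s + (n i - n j)" "n i - (n j - 1 - s) = Suc (s + (n i - n j))"
    using assms by linarith+
  show ?thesis using stab[OF assms(1,2), of "n j - 1 - s"] assms(3,4) unfolding e by simp
qed

lemma (in stabiliser_coordinates) stab_ge:
  assumes "i < k" "j < k" "n i \<le> n j" "s < n i"
  shows "(\<Sum>l<k. X i l * c j l (s + (n j - n i))) + Y i * c j i (Suc (s + (n j - n i))) =
    (\<Sum>l<k. X l j * c l i s) + Y j * c j i (Suc s)"
proof -
  have e: "n i - 1 - (n i - 1 - s) = s" "n i - (n i - 1 - s) = Suc s"
    "n j - 1 - (n i - 1 - s) = s + (n j - n i)" "n j - (n i - 1 - s) = Suc (s + (n j - n i))"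
    using assms by linarith+
  show ?thesis using stab[OF assms(1,2), of "n i - 1 - s"] assms(3,4) unfolding e by simp
qed

text \<open>
  Blocks of odd size are the indices in \<open>S\<close>, matched with each other by \<open>st\<close> (fixed points are
  unmatched); a block \<open>p \<in> Q\<close> of even size is paired with \<open>pr p\<close>. A pair with \<open>lk p\<close>
  is linked to the block \<open>mu p \<in> S\<close>. These links cannot be omitted: without them, the stabiliser
  contains the map \<open>w\<^sub>m \<mapsto> e\<^bsup>n p - 1\<^esup> w\<^sub>p\<close> (and its adjoint) if \<open>n (st m) < n p < n m\<close>.
\<close>

locale orthogonal_coordinates = stabiliser_coordinates k n X Y c
  for k n and X :: "nat \<Rightarrow> nat \<Rightarrow> 'k::field" and Y c +
  fixes pr st mu :: "nat \<Rightarrow> nat" and S Q :: "nat set" and lk :: "nat \<Rightarrow> bool"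
  assumes S: "S = {i. i < k \<and> pr i = i}"
    and Q: "Q \<subseteq> {..<k}"
    and pr: "i < k \<Longrightarrow> pr i < k \<and> pr (pr i) = i \<and> n (pr i) = n i"
    and pr_Q: "\<lbrakk>i < k; pr i \<noteq> i\<rbrakk> \<Longrightarrow> i \<in> Q \<longleftrightarrow> pr i \<notin> Q"
    and Q_pr: "p \<in> Q \<Longrightarrow> pr p \<noteq> p"
    and parity: "i < k \<Longrightarrow> odd (n i) \<longleftrightarrow> i \<in> S"
    and st: "i \<in> S \<Longrightarrow> st i \<in> S \<and> st (st i) = i"
    and X_zero: "\<lbrakk>i < k; j < k; X i j \<noteq> 0\<rbrakk> \<Longrightarrow>
      (i \<in> S \<and> j = st i \<and> j \<noteq> i) \<or> (i \<notin> S \<and> j = i) \<or> (i \<in> Q \<and> lk i \<and> j = mu i) \<or>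
      (\<exists>p\<in>Q. lk p \<and> i = mu p \<and> j = pr p)"
    and X_match: "\<lbrakk>i \<in> S; st i \<noteq> i\<rbrakk> \<Longrightarrow> X i (st i) \<noteq> 0"
    and X_diag: "p \<in> Q \<Longrightarrow> X p p \<noteq> 0 \<and> X (pr p) (pr p) = X p p"
    and X_diag_eq: "\<lbrakk>p \<in> Q; q \<in> Q; p \<noteq> q; n p = n q\<rbrakk> \<Longrightarrow> X p p \<noteq> X q q"
    and X_link: "\<lbrakk>p \<in> Q; lk p\<rbrakk> \<Longrightarrow> X p (mu p) \<noteq> 0 \<and> X (mu p) (pr p) \<noteq> 0"
    and Y_S: "i \<in> S \<Longrightarrow> Y i = 0"
    and Y_Q: "p \<in> Q \<Longrightarrow> Y (pr p) = - Y p \<and> Y p \<noteq> 0"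
    and two: "(2::'k) \<noteq> 0"
    and link: "\<lbrakk>p \<in> Q; lk p\<rbrakk> \<Longrightarrow>
      mu p \<in> S \<and> n p < n (mu p) \<and> (st (mu p) = mu p \<or> n (st (mu p)) < n p)"
    and cover: "\<lbrakk>p \<in> Q; m \<in> S; n p < n m; \<not> (lk p \<and> m = mu p)\<rbrakk> \<Longrightarrow> st m \<noteq> m \<and> n p < n (st m)"
    and nested: "\<lbrakk>i \<in> S; j \<in> S; st i \<noteq> i; st j \<noteq> j; j \<noteq> i; j \<noteq> st i\<rbrakk> \<Longrightarrow>
      max (n j) (n (st j)) \<le> min (n i) (n (st i)) \<or> max (n i) (n (st i)) \<le> min (n j) (n (st j))"
    and X_match_eq: "\<lbrakk>i \<in> S; j \<in> S; st i \<noteq> i; st j \<noteq> j; j \<noteq> i; j \<noteq> st i;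
        n i = n j; n (st i) = n j; n (st j) = n j\<rbrakk> \<Longrightarrow>
      X j (st j) * X (st j) j \<noteq> X i (st i) * X (st i) i"
    and unmatched: "\<lbrakk>j \<in> S; st j = j; i \<in> S; i \<noteq> j\<rbrakk> \<Longrightarrow> st i \<noteq> i \<and> n j \<le> n i"
    and skew: "\<lbrakk>m < k; j < k\<rbrakk> \<Longrightarrow> c m j \<rho> = 0 \<longleftrightarrow> c (pr j) (pr m) \<rho> = 0"
    and skew_self: "\<lbrakk>m < k; even \<rho>\<rbrakk> \<Longrightarrow> c m (pr m) \<rho> = 0"
    and skew_odd: "\<lbrakk>m \<in> S; st m \<noteq> m; odd \<rho>\<rbrakk> \<Longrightarrow> X m (st m) * c m (st m) \<rho> = - (X (st m) m * c (st m) m \<rho>)"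
    and par_link: "\<lbrakk>p \<in> Q; lk p\<rbrakk> \<Longrightarrow> c (mu p) p \<rho> = 0"
    and par_unlinked: "\<lbrakk>p \<in> Q; \<not> lk p\<rbrakk> \<Longrightarrow> c p p \<rho> = 0"
    and par_self: "\<lbrakk>m \<in> S; st m \<le> m; odd \<rho>\<rbrakk> \<Longrightarrow> c m m \<rho> = 0"
    and large: "\<lbrakk>m \<in> S; st m \<le> m\<rbrakk> \<Longrightarrow> n (st m) \<le> n m"
    and par_match: "\<lbrakk>m \<in> S; st m < m; even \<rho>\<rbrakk> \<Longrightarrow> c m (st m) \<rho> = 0"
begin

section \<open>Solving the stabiliser equations for a symmetric form\<close>

lemma S_lt: "i \<in> S \<Longrightarrow> i < k" and Q_lt: "p \<in> Q \<Longrightarrow> p < k" and S_pr: "i \<in> S \<Longrightarrow> pr i = i"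
  using S Q by auto

lemma Q_S: "p \<in> Q \<Longrightarrow> p \<notin> S" and prQ_S: "p \<in> Q \<Longrightarrow> pr p \<notin> S" and prQ_Q: "p \<in> Q \<Longrightarrow> pr p \<notin> Q"
  using S Q_lt pr Q_pr pr_Q by (auto, metis)

lemma index_cases: "i < k \<Longrightarrow> i \<in> S \<or> i \<in> Q \<or> (\<exists>p\<in>Q. i = pr p)"
  using S pr pr_Q by (metis (mono_tags, lifting) mem_Collect_eq)

lemma prQ_lt: "p \<in> Q \<Longrightarrow> pr p < k" and n_prQ: "p \<in> Q \<Longrightarrow> n (pr p) = n p"
  and pr_prQ: "p \<in> Q \<Longrightarrow> pr (pr p) = p"
  using pr Q_lt by auto

lemma mu_S: "\<lbrakk>p \<in> Q; lk p\<rbrakk> \<Longrightarrow> mu p \<in> S"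
  using link by blast

lemma mu_lt: "\<lbrakk>p \<in> Q; lk p\<rbrakk> \<Longrightarrow> mu p < k"
  using link S_lt by blast

lemma pr_inj: "\<lbrakk>p \<in> Q; q \<in> Q; pr p = pr q\<rbrakk> \<Longrightarrow> p = q"
  using pr_prQ by metis

lemma size_ne: "\<lbrakk>p \<in> Q; m \<in> S\<rbrakk> \<Longrightarrow> n m \<noteq> n p"
  using parity[of p] parity[of m] Q_lt S_lt Q_S by metis

lemma row_Q: "p \<in> Q \<Longrightarrow> (\<Sum>j<k. X p j * f j) = X p p * f p + (if lk p then X p (mu p) * f (mu p) else 0)"
proof -
  assume p: "p \<in> Q"
  have z: "X p j = 0" if "j < k" "j \<noteq> p" "\<not> (lk p \<and> j = mu p)" for j
    using X_zero[OF Q_lt[OF p] that(1)] that Q_S[OF p] mu_S by (cases "X p j = 0") auto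
  show ?thesis
  proof (cases "lk p")
    case True
    have "mu p \<noteq> p" using link[OF p True] Q_S[OF p] by auto
    then show ?thesis
      using z True Q_lt[OF p] mu_lt[OF p True]
      by (subst sum.remove[of _ p], simp, simp, subst sum.remove[of _ "mu p"]) (auto intro!: sum.neutral)
  next
    case False
    then show ?thesis using z Q_lt[OF p] by (subst sum_lessThan_single[of p]) auto
  qed
qed

lemma row_prQ: "p \<in> Q \<Longrightarrow> (\<Sum>j<k. X (pr p) j * f j) = X p p * f (pr p)"
proof -
  assume p: "p \<in> Q"
  have "X (pr p) j = 0" if "j < k" "j \<noteq> pr p" for j
    using X_zero[OF prQ_lt[OF p] that(1)] that prQ_S[OF p] prQ_Q[OF p] mu_S
    by (cases "X (pr p) j = 0") auto
  then show ?thesis using X_diag[OF p] prQ_lt[OF p] by (subst sum_lessThan_single[of "pr p"]) auto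
qed

lemma col_Q: "p \<in> Q \<Longrightarrow> (\<Sum>l<k. X l p * f l) = X p p * f p"
proof -
  assume p: "p \<in> Q"
  have "X l p = 0" if "l < k" "l \<noteq> p" for l
    using X_zero[OF that(1) Q_lt[OF p]] that mu_S st Q_S[OF p] prQ_Q p
    by (cases "X l p = 0") auto
  then show ?thesis using Q_lt[OF p] by (subst sum_lessThan_single[of p]) auto
qed

lemma col_prQ: "p \<in> Q \<Longrightarrow>
  (\<Sum>l<k. X l (pr p) * f l) = X p p * f (pr p) + (if lk p then X (mu p) (pr p) * f (mu p) else 0)"
proof -
  assume p: "p \<in> Q"
  have z: "X l (pr p) = 0" if "l < k" "l \<noteq> pr p" "\<not> (lk p \<and> l = mu p)" for l
    using X_zero[OF that(1) prQ_lt[OF p]] that mu_S st prQ_S[OF p] pr_inj[OF p]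
    by (cases "X l (pr p) = 0") auto
  show ?thesis
  proof (cases "lk p")
    case True
    have "mu p \<noteq> pr p" using link[OF p True] prQ_S[OF p] by auto
    then show ?thesis
      using z True prQ_lt[OF p] mu_lt[OF p True] X_diag[OF p]
      by (subst sum.remove[of _ "pr p"], simp, simp, subst sum.remove[of _ "mu p"])
        (auto intro!: sum.neutral)
  next
    case False
    then show ?thesis using z prQ_lt[OF p] X_diag[OF p]
      by (subst sum_lessThan_single[of "pr p"]) auto
  qed
qed

lemma col_S:
  assumes m: "m \<in> S" and f: "\<And>q. \<lbrakk>q \<in> Q; lk q; mu q = m\<rbrakk> \<Longrightarrow> f q = 0"
  shows "(\<Sum>l<k. X l m * f l) = (if st m = m then 0 else X (st m) m * f (st m))"
proof -
  have z: "X l m * f l = 0" if "l < k" "\<not> (l = st m \<and> st m \<noteq> m)" for l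
    using X_zero[OF that(1) S_lt[OF m]] that st prQ_S m f by (cases "X l m = 0") auto
  show ?thesis
  proof (cases "st m = m")
    case True
    then show ?thesis using z by (auto intro!: sum.neutral)
  next
    case False
    then show ?thesis using z st[OF m] S_lt by (subst sum_lessThan_single[of "st m"]) auto
  qed
qed

lemma row_S:
  assumes m: "m \<in> S" and f: "\<And>q. \<lbrakk>q \<in> Q; lk q; mu q = m\<rbrakk> \<Longrightarrow> f (pr q) = 0"
  shows "(\<Sum>j<k. X m j * f j) = (if st m = m then 0 else X m (st m) * f (st m))"
proof -
  have z: "X m j * f j = 0" if "j < k" "\<not> (j = st m \<and> st m \<noteq> m)" for j
    using X_zero[OF S_lt[OF m] that(1)] that Q_S m f by (cases "X m j = 0") auto
  show ?thesis
  proof (cases "st m = m")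
    case True
    then show ?thesis using z by (auto intro!: sum.neutral)
  next
    case False
    then show ?thesis using z st[OF m] S_lt by (subst sum_lessThan_single[of "st m"]) auto
  qed
qed

lemma two_mult: "(x::'k) = - x \<Longrightarrow> x = 0"
proof -
  assume "x = - x"
  then have "2 * x = 0" by (metis mult_2 add.right_inverse)
  then show "x = 0" using two by simp
qed

text \<open>In the equation for the pair (p, p) the diagonal terms cancel and only the link
  remains.\<close>

lemma c_Q_mu: "\<lbrakk>p \<in> Q; lk p\<rbrakk> \<Longrightarrow> c p (mu p) \<rho> = 0"
proof -
  assume p: "p \<in> Q" "lk p"
  show ?thesis
  proof (cases "\<rho> < n p")
    case True
    have "X p (mu p) * c p (mu p) (n p - 1 - (n p - 1 - \<rho>)) = 0"
      using stab[OF Q_lt[OF p(1)] Q_lt[OF p(1)], of "n p - 1 - \<rho>"] True p(2)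
      unfolding row_Q[OF p(1)] col_Q[OF p(1)] by simp
    then show ?thesis using X_link[OF p] True by simp
  next
    case False
    then show ?thesis using range Q_lt[OF p(1)] mu_lt[OF p] by simp
  qed
qed

lemma c_mu_pr: "\<lbrakk>p \<in> Q; lk p\<rbrakk> \<Longrightarrow> c (mu p) (pr p) \<rho> = 0"
  using c_Q_mu[of p \<rho>] skew[OF Q_lt mu_lt, of p p \<rho>] link S_pr by metis

lemma c_pr_mu: "\<lbrakk>p \<in> Q; lk p\<rbrakk> \<Longrightarrow> c (pr p) (mu p) \<rho> = 0"
  using par_link[of p \<rho>] skew[OF mu_lt Q_lt, of p p \<rho>] link S_pr by metis

text \<open>The weights of \<open>p\<close> and \<open>pr p\<close> at the top level agree, so these
  terms cancel. What is left comes from the level below, where \<open>Y\<close> takes opposite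
  values; this is the purpose of \<open>Y\<close>. Level 0 is settled by skewness.\<close>

lemma c_p_pr: "p \<in> Q \<Longrightarrow> c p (pr p) \<rho> = 0"
proof (cases "\<rho> < n p \<and> \<rho> \<noteq> 0")
  case True
  assume p: "p \<in> Q"
  have \<rho>: "n p - 1 - (n p - \<rho>) = \<rho> - 1" "n p - (n p - \<rho>) = \<rho>" "n p - \<rho> < n p" using True by auto
  have "Y (pr p) * c p (pr p) \<rho> = Y p * c p (pr p) \<rho>"
    using stab[OF prQ_lt[OF p] Q_lt[OF p], of "n p - \<rho>"] True
    unfolding row_prQ[OF p] col_Q[OF p] n_prQ[OF p] \<rho> by simp
  then have "c p (pr p) \<rho> = - c p (pr p) \<rho>" using Y_Q[OF p] by (simp add: minus_equation_iff)
  then show ?thesis by (rule two_mult)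
next
  case False
  assume "p \<in> Q"
  then show ?thesis using False skew_self range Q_lt prQ_lt by auto
qed

lemma c_pr_p: "p \<in> Q \<Longrightarrow> c (pr p) p \<rho> = 0"
proof (cases "\<rho> < n p \<and> \<rho> \<noteq> 0")
  case True
  assume p: "p \<in> Q"
  have \<rho>: "n p - 1 - (n p - \<rho>) = \<rho> - 1" "n p - (n p - \<rho>) = \<rho>" "n p - \<rho> < n p" using True by auto
  have "Y p * c (pr p) p \<rho> = Y (pr p) * c (pr p) p \<rho>"
    using stab[OF Q_lt[OF p] prQ_lt[OF p], of "n p - \<rho>"] True par_link[OF p] c_pr_mu[OF p]
    unfolding row_Q[OF p] col_prQ[OF p] n_prQ[OF p] \<rho> by (simp split: if_splits)
  then have "c (pr p) p \<rho> = - c (pr p) p \<rho>" using Y_Q[OF p] by (simp add: minus_equation_iff)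
  then show ?thesis by (rule two_mult)
next
  case False
  assume p: "p \<in> Q"
  then show ?thesis using False skew_self[of "pr p" \<rho>] range Q_lt prQ_lt pr_prQ by auto
qed

text \<open>The equation for the pair (m, m) makes the two products in \<open>skew_odd\<close>
  equal, while skewness makes them opposite.\<close>

lemma skew_match:
  assumes m: "m \<in> S" "st m \<noteq> m" "odd \<rho>"
  shows "c m (st m) \<rho> = 0"
proof (cases "\<rho> < n m")
  case True
  have "(\<Sum>l<k. X m l * c m l \<rho>) = X m (st m) * c m (st m) \<rho>"
    using row_S[OF m(1), of "\<lambda>l. c m l \<rho>"] c_mu_pr m(2) by auto
  moreover have "(\<Sum>l<k. X l m * c l m \<rho>) = X (st m) m * c (st m) m \<rho>"
    using col_S[OF m(1), of "\<lambda>l. c l m \<rho>"] c_Q_mu m(2) by auto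
  ultimately have "X m (st m) * c m (st m) \<rho> = X (st m) m * c (st m) m \<rho>"
    using stab_le[OF S_lt[OF m(1)] S_lt[OF m(1)] order_refl True] by simp
  then have "X m (st m) * c m (st m) \<rho> = 0" using skew_odd[OF m] two_mult by metis
  then show ?thesis using X_match[OF m(1,2)] by simp
next
  case False
  then show ?thesis using range[OF S_lt[OF m(1)] S_lt[OF conjunct1[OF st[OF m(1)]]]] by simp
qed

text \<open>Higher levels vanish by \<open>IH\<close>, so an equation between blocks of different
  sizes loses one side. Indices in \<open>Q\<close> come first, then \<open>S\<close>, then the
  remaining ones, since the columns of \<open>X\<close> at the later indices contain links to the
  earlier ones.\<close>

lemma column_pr_step:
  assumes p: "p \<in> Q" and s: "s < n p"
    and IH: "\<And>j t. \<lbrakk>j < k; j \<noteq> pr p; s < t\<rbrakk> \<Longrightarrow> c j (pr p) t = 0"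
    and j: "j < k" "j \<noteq> pr p"
  shows "c j (pr p) s = 0"
proof -
  note np = n_prQ[OF p] and lt = prQ_lt[OF p]
  have col: "(\<Sum>l<k. X l j * c l (pr p) t) = 0" if "s < t" "j < k" "j \<noteq> pr p" for t j
  proof (rule sum.neutral, clarify)
    fix l assume l: "l < k"
    show "X l j * c l (pr p) t = 0"
    proof (cases "l = pr p")
      case True
      have "X (pr p) j = 0"
        using X_zero[OF lt that(2)] that(3) prQ_S[OF p] prQ_Q[OF p] mu_S
        by (cases "X (pr p) j = 0") auto
      then show ?thesis using True by simp
    qed (use IH[OF l _ that(1)] in simp)
  qed
  have small: "X p p * c j (pr p) s = 0" if "n j < n p" "j < k" "j \<noteq> pr p" for j
  proof (cases "s < n j")
    case True
    show ?thesis
      using stab_le[OF lt that(2), of s] that np True IH[OF that(2,3)]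
      unfolding row_prQ[OF p] by (simp add: col)
  next
    case False
    then show ?thesis using range[OF that(2) lt, of s] by simp
  qed
  have equal: "X p p * c j (pr p) s = (\<Sum>l<k. X l j * c l (pr p) s)"
    if "n j = n p" "j < k" "j \<noteq> pr p" for j
    using stab_le[OF lt that(2), of s] that np s IH[OF that(2,3)] unfolding row_prQ[OF p] by simp
  have large: "(\<Sum>l<k. X l j * c l (pr p) s) = 0" if "n p < n j" "j < k" "j \<noteq> pr p" for j
    using stab_ge[OF lt that(2), of s] that np s IH[OF that(2,3)] unfolding row_prQ[OF p] by simp
  have 1: "c q (pr p) s = 0" if q: "q \<in> Q" for q
  proof -
    have ne: "q \<noteq> pr p" using q prQ_Q[OF p] by auto
    consider "q = p" | "n q < n p" | "q \<noteq> p" "n q = n p" | "n p < n q" by linarith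
    then show ?thesis
    proof cases
      case 1
      then show ?thesis using c_p_pr[OF p] by simp
    next
      case 2
      then show ?thesis using small[OF 2 Q_lt[OF q] ne] X_diag[OF p] by simp
    next
      case 3
      then show ?thesis
        using equal[OF 3(2) Q_lt[OF q] ne] X_diag_eq[OF q p 3] unfolding col_Q[OF q] by simp
    next
      case 4
      then show ?thesis
        using large[OF 4 Q_lt[OF q] ne] X_diag[OF q] unfolding col_Q[OF q] by simp
    qed
  qed
  have 2: "c m (pr p) s = 0" if m: "m \<in> S" for m
  proof -
    have ne: "m \<noteq> pr p" "st m \<noteq> pr p" using m st[OF m] prQ_S[OF p] by auto
    consider "lk p" "m = mu p" | "n m < n p" | "n p < n m" "\<not> (lk p \<and> m = mu p)"
      using size_ne[OF p m] by linarith
    then show ?thesis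
    proof cases
      case 1
      then show ?thesis using c_mu_pr[OF p] by simp
    next
      case 2
      then show ?thesis using small[OF 2 S_lt[OF m] ne(1)] X_diag[OF p] by simp
    next
      case 3
      have sm: "st m \<in> S" "st (st m) = m" "st m \<noteq> m" "n p < n (st m)"
        using st[OF m] cover[OF p m 3] by auto
      \<comment> \<open>The equation at \<open>st m\<close> isolates the entry at \<open>m\<close>;
        by \<open>cover\<close> the block \<open>st m\<close> is larger than \<open>p\<close> as
        well.\<close>
      have "(\<Sum>l<k. X l (st m) * c l (pr p) s) = X m (st m) * c m (pr p) s"
        using col_S[OF sm(1), of "\<lambda>l. c l (pr p) s"] 1 sm by simp
      then show ?thesis
        using large[OF sm(4) S_lt[OF sm(1)] ne(2)] X_match[OF m sm(3)] by simp
    qed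
  qed
  have 3: "c (pr q) (pr p) s = 0" if q: "q \<in> Q" "q \<noteq> p" for q
  proof -
    have ne: "pr q \<noteq> pr p" using pr_inj q p by blast
    have col: "(\<Sum>l<k. X l (pr q) * c l (pr p) s) = X q q * c (pr q) (pr p) s"
      unfolding col_prQ[OF q(1)] using 2 mu_S[OF q(1)] by simp
    consider "n q < n p" | "n q = n p" | "n p < n q" by linarith
    then show ?thesis
    proof cases
      case 1
      then show ?thesis using small[of "pr q"] prQ_lt[OF q(1)] ne n_prQ[OF q(1)] X_diag[OF p] by simp
    next
      case 2
      then show ?thesis
        using equal[of "pr q"] prQ_lt[OF q(1)] ne n_prQ[OF q(1)] X_diag_eq[OF q(1) p q(2) 2] col by simp
    next
      case 3
      then show ?thesis
        using large[of "pr q"] prQ_lt[OF q(1)] ne n_prQ[OF q(1)] X_diag[OF q(1)] col by simp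
    qed
  qed
  show ?thesis using index_cases[OF j(1)] 1 2 3 j(2) by blast
qed

lemma column_pr: "\<lbrakk>p \<in> Q; j < k; j \<noteq> pr p\<rbrakk> \<Longrightarrow> c j (pr p) s = 0"
proof (induction "n p - s" arbitrary: j s rule: less_induct)
  case less
  show ?case
  proof (cases "s < n p")
    case True
    show ?thesis
    proof (rule column_pr_step[OF less.prems(1) True _ less.prems(2,3)])
      fix j t assume jt: "j < k" "j \<noteq> pr p" "s < t"
      then have "n p - t < n p - s" using True by linarith
      then show "c j (pr p) t = 0" by (rule less.hyps[OF _ less.prems(1) jt(1,2)])
    qed
  next
    case False
    then show ?thesis
      using range[OF less.prems(2) prQ_lt[OF less.prems(1)], of s] n_prQ[OF less.prems(1)] by simp
  qed
qed

lemma row_zero: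
  assumes "p \<in> Q" "j < k" "j \<noteq> p"
  shows "c p j s = 0"
proof -
  have "pr j \<noteq> pr p" using pr[OF assms(2)] pr_prQ[OF assms(1)] assms(3) by metis
  then have "c (pr j) (pr p) s = 0" using column_pr[OF assms(1)] pr[OF assms(2)] by blast
  then show ?thesis using skew[OF Q_lt[OF assms(1)] assms(2)] by blast
qed

text \<open>\<open>E\<close> carries an entry at (j, st i) to (st j, i) and raises its level by a
  difference of sizes; a second move leads back. Fixed points of \<open>st\<close> are easier: for
  them one side of \<open>E\<close> is 0.\<close>

lemma S_S_zero:
  assumes "i \<in> S" "j \<in> S"
  shows "c i j s = 0"
proof -
  have E: "(if st a = a then 0 else X a (st a) * c b (st a) s) =
      (if st b = b then 0 else X (st b) b * c (st b) a (s + (n a - n b)))"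
    if ab: "a \<in> S" "b \<in> S" "n b \<le> n a" and s: "s < n b" for a b s
  proof -
    have "c b (pr q) t = 0" if "q \<in> Q" for q t
      using column_pr[OF that S_lt[OF ab(2)]] prQ_S[OF that] ab(2) by blast
    moreover have "c q a t = 0" if "q \<in> Q" for q t
      using row_zero[OF that S_lt[OF ab(1)]] Q_S[OF that] ab(1) by blast
    ultimately show ?thesis
      using stab_le[OF S_lt[OF ab(1)] S_lt[OF ab(2)] ab(3) s]
        row_S[OF ab(1), of "\<lambda>l. c b l s"] col_S[OF ab(2), of "\<lambda>l. c l a (s + (n a - n b))"]
        Y_S[OF ab(1)] Y_S[OF ab(2)] by simp
  qed
  have skS: "c a b s = 0 \<longleftrightarrow> c b a s = 0" if "a \<in> S" "b \<in> S" for a b s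
    using skew[of a b s] that S_lt S_pr by metis
  have big: "c m m s = 0" if m: "m \<in> S" "st m \<le> m" for m s
    using par_self[OF m] skew_self[OF S_lt[OF m(1)]] S_pr[OF m(1)] by (cases "even s") auto
  have self: "c m m s = 0" if m: "m \<in> S" for m s
  proof (cases "st m \<le> m")
    case True
    then show ?thesis using big m by blast
  next
    case False
    \<comment> \<open>Only one member of a matched pair has parameters on its diagonal;
      \<open>E\<close> transfers the vanishing to the other member.\<close>
    define b where "b = st m"
    have b: "b \<in> S" "st b = m" "st b < b" "n m \<le> n b"
      using False st[OF m] large[of b] by (auto simp: b_def)
    show ?thesis
    proof (cases "s < n m")
      case True
      have "X b m * c m m s = X b m * c b b (s + (n b - n m))"
        using E[OF b(1) m b(4) True] b False by (simp add: b_def)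
      then show ?thesis using big[OF b(1)] b X_match[OF b(1)] by simp
    next
      case F: False
      then show ?thesis using range S_lt[OF m] by simp
    qed
  qed
  have matched: "c m (st m) s = 0" if m: "m \<in> S" "st m \<noteq> m" for m s
  proof (cases "even s")
    case True
    show ?thesis
    proof (cases "st m < m")
      case lt: True
      show ?thesis by (rule par_match[OF m(1) lt True])
    next
      case False
      then have "c (st m) m s = 0"
        using par_match[of "st m" s] True st[OF m(1)] m(2) by simp
      then show ?thesis using skS st[OF m(1)] m(1) by blast
    qed
  next
    case False
    then show ?thesis using skew_match[OF m] by blast
  qed
  have unm: "c j i s = 0" if ij: "i \<in> S" "j \<in> S" "i \<noteq> j" "st j = j" for i j s
  proof (cases "s < n j")
    case True
    have i: "st i \<noteq> i" "n j \<le> n i" using unmatched[OF ij(2,4,1)] ij(3) by auto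
    have si: "st i \<in> S" "st (st i) = i" "st i \<noteq> j" using st[OF ij(1)] ij by auto
    have sn: "n j \<le> n (st i)" using unmatched[OF ij(2,4) si(1)] si by auto
    have "X (st i) i * c j i s = 0"
      using E[OF si(1) ij(2) sn True] ij(4) si i(1) by simp
    then show ?thesis using X_match[OF si(1)] si i(1) by simp
  next
    case False
    then show ?thesis using range S_lt ij by simp
  qed
  have gen: "c j (st i) s = 0"
    if ij: "i \<in> S" "j \<in> S" "st i \<noteq> i" "st j \<noteq> j" "j \<noteq> i" "j \<noteq> st i"
      and le: "max (n j) (n (st j)) \<le> min (n i) (n (st i))" for i j s
  proof (induction "n j - s" arbitrary: s rule: less_induct)
    case less
    have si: "st i \<in> S" "st (st i) = i" and sj: "st j \<in> S" "st (st j) = j" using st ij by auto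
    show ?case
    proof (cases "s < n j")
      case True
      \<comment> \<open>After the first move the level is \<open>u\<close>, after the second
        \<open>v\<close>. If \<open>v\<close> exceeds \<open>s\<close>, induction applies;
        \<open>v = s\<close> forces all four sizes to agree, and then the distinct products in
        \<open>X_match_eq\<close> leave only 0.\<close>
      define u where "u = s + (n i - n j)"
      define v where "v = u + (n (st i) - n (st j))"
      have e1: "X i (st i) * c j (st i) s = X (st j) j * c (st j) i u"
        using E[OF ij(1,2) _ True] ij le by (simp add: u_def)
      show ?thesis
      proof (cases "u < n (st j)")
        case u: True
        have e2: "X (st i) i * c (st j) i u = X j (st j) * c j (st i) v"
          using E[OF si(1) sj(1) _ u] ij si sj le by (auto simp: v_def)
        show ?thesis
        proof (cases "v = s")
          case True
          then have eqs: "n i = n j" "n (st i) = n (st j)" using le by (auto simp: u_def v_def)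
          then have eqs': "n (st i) = n j" "n (st j) = n j" using le by auto
          have "X i (st i) * X (st i) i * c j (st i) s = X (st i) i * (X (st j) j * c (st j) i u)"
            using e1 by (simp add: mult_ac)
          also have "\<dots> = X (st j) j * (X j (st j) * c j (st i) s)"
            using e2 True by (simp add: mult_ac)
          finally have "(X j (st j) * X (st j) j) * c j (st i) s = (X i (st i) * X (st i) i) * c j (st i) s"
            by (simp only: mult_ac)
          then show ?thesis using X_match_eq[OF ij eqs(1) eqs'] mult_cancel_right by blast
        next
          case False
          moreover have "s \<le> v" by (simp add: u_def v_def)
          ultimately have "s < v" by linarith
          then have "n j - v < n j - s" using True by linarith
          then have "c j (st i) v = 0" by (rule less)
          then have "c (st j) i u = 0" using e2 X_match[OF si(1)] si ij by simp
          then show ?thesis using e1 X_match[OF ij(1,3)] by simp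
        qed
      next
        case False
        then have "c (st j) i u = 0" using range S_lt sj(1) ij(1) by simp
        then show ?thesis using e1 X_match[OF ij(1,3)] by simp
      qed
    next
      case False
      then show ?thesis using range S_lt ij(2) si(1) by simp
    qed
  qed
  have gen2: "c j i s = 0"
    if ij: "i \<in> S" "j \<in> S" "st i \<noteq> i" "st j \<noteq> j" "j \<noteq> i" "j \<noteq> st i" for i j
  proof -
    have si: "st i \<in> S" "st (st i) = i" and sj: "st j \<in> S" "st (st j) = j" using st ij by auto
    from nested[OF ij] show ?thesis
    proof
      assume "max (n j) (n (st j)) \<le> min (n i) (n (st i))"
      then have "max (n j) (n (st j)) \<le> min (n (st i)) (n (st (st i)))"
        unfolding si(2) by (simp only: min.commute)
      moreover have "st (st i) \<noteq> st i" "j \<noteq> st (st i)" unfolding si(2) using ij by auto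
      ultimately have "c j (st (st i)) s = 0"
        using gen[OF si(1) ij(2) _ ij(4) ij(6)] by blast
      then show ?thesis unfolding si(2) .
    next
      assume "max (n i) (n (st i)) \<le> min (n j) (n (st j))"
      then have "max (n i) (n (st i)) \<le> min (n (st j)) (n (st (st j)))"
        unfolding sj(2) by (simp only: min.commute)
      moreover have "st (st j) \<noteq> st j" "i \<noteq> st (st j)" "i \<noteq> st j" unfolding sj(2) using ij si(2) sj(2) by auto
      ultimately have "c i (st (st j)) s = 0"
        using gen[OF sj(1) ij(1) _ ij(3)] by blast
      then show ?thesis unfolding sj(2) using skS ij by blast
    qed
  qed
  show ?thesis
  proof (cases "i = j \<or> st i = j")
    case True
    then show ?thesis using self matched assms by metis
  next
    case False
    then have "st j \<noteq> i" using st assms by blast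
    consider "st i = i" | "st j = j" | "st i \<noteq> i" "st j \<noteq> j" by blast
    then show ?thesis
    proof cases
      case 1
      then show ?thesis using unm[OF assms(2,1)] False by blast
    next
      case 2
      then show ?thesis using unm[OF assms] False skS[OF assms] by blast
    next
      case 3
      then show ?thesis using gen2[OF assms(2,1) 3(2,1)] False \<open>st j \<noteq> i\<close> by blast
    qed
  qed
qed

text \<open>The argument of \<open>column_pr_step\<close> for the columns \<open>p\<close>: for a
  larger block that is not linked to \<open>p\<close>, the equation is taken at its partner.\<close>

lemma S_column_zero_step:
  assumes p: "p \<in> Q" and s: "s < n p"
    and IH: "\<And>m t. \<lbrakk>m \<in> S; s < t\<rbrakk> \<Longrightarrow> c m p t = 0"
    and m: "m \<in> S"
  shows "c m p s = 0"
proof -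
  have row: "(\<Sum>l<k. X p l * c b l t) = X p p * c b p t" if "b \<in> S" for b t
    unfolding row_Q[OF p] using S_S_zero[OF that mu_S[OF p]] by simp
  have col: "(\<Sum>l<k. X l b * c l p t) = (if st b = b then 0 else X (st b) b * c (st b) p t)"
    if "b \<in> S" "\<not> (lk p \<and> b = mu p)" for b t
  proof (rule col_S[OF that(1)])
    fix q assume "q \<in> Q" "lk q" "mu q = b"
    then show "c q p t = 0" using row_zero[of q p t] Q_lt[OF p] that(2) by auto
  qed
  consider "lk p" "m = mu p" | "n m < n p" "\<not> (lk p \<and> m = mu p)" | "n p < n m" "\<not> (lk p \<and> m = mu p)"
    using size_ne[OF p m] by linarith
  then show ?thesis
  proof cases
    case 1
    then show ?thesis using par_link[OF p] by simp
  next
    case 2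
    show ?thesis
    proof (cases "s < n m")
      case True
      have "X p p * c m p s = 0"
        using stab_le[OF Q_lt[OF p] S_lt[OF m], of s] True 2 IH[OF m] IH[OF conjunct1[OF st[OF m]]]
        unfolding row[OF m] col[OF m 2(2)] by (simp split: if_splits)
      then show ?thesis using X_diag[OF p] by simp
    next
      case False
      then show ?thesis using range[OF S_lt[OF m] Q_lt[OF p]] by simp
    qed
  next
    case 3
    have sm: "st m \<in> S" "st (st m) = m" "st m \<noteq> m" "n p < n (st m)"
      using st[OF m] cover[OF p m 3] by auto
    have nl: "\<not> (lk p \<and> st m = mu p)"
      using link[OF p] 3 sm by (metis less_asym')
    have "X m (st m) * c m p s = 0"
      using stab_ge[OF Q_lt[OF p] S_lt[OF sm(1)], of s] sm s IH[OF sm(1)]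
      unfolding row[OF sm(1)] col[OF sm(1) nl] by simp
    then show ?thesis using X_match[OF m sm(3)] by simp
  qed
qed

lemma S_column_zero: "\<lbrakk>p \<in> Q; m \<in> S\<rbrakk> \<Longrightarrow> c m p s = 0"
proof (induction "n p - s" arbitrary: m s rule: less_induct)
  case less
  show ?case
  proof (cases "s < n p")
    case True
    show ?thesis
    proof (rule S_column_zero_step[OF less.prems(1) True _ less.prems(2)])
      fix m t assume mt: "m \<in> S" "s < t"
      then have "n p - t < n p - s" using True by linarith
      then show "c m p t = 0" by (rule less.hyps[OF _ less.prems(1) mt(1)])
    qed
  next
    case False
    then show ?thesis using range[OF S_lt Q_lt] less.prems by simp
  qed
qed

lemma pr_row_S: "\<lbrakk>p \<in> Q; m \<in> S\<rbrakk> \<Longrightarrow> c (pr p) m s = 0"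
  using S_column_zero[of p m s] skew[OF S_lt Q_lt, of m p s] S_pr by metis

lemma pr_Q_zero: "\<lbrakk>p \<in> Q; q \<in> Q\<rbrakk> \<Longrightarrow> c (pr q) p s = 0"
proof (induction "n p - s" arbitrary: s rule: less_induct)
  case less
  note p = less.prems(1) and q = less.prems(2)
  have row: "(\<Sum>l<k. X p l * c (pr q) l t) = X p p * c (pr q) p t" for t
    unfolding row_Q[OF p] using pr_row_S[OF q mu_S[OF p]] by simp
  have col: "(\<Sum>l<k. X l (pr q) * c l p t) = X q q * c (pr q) p t" for t
    unfolding col_prQ[OF q] using S_column_zero[OF p mu_S[OF q]] by simp
  show ?case
  proof (cases "s < n p \<and> s < n q")
    case True
    have IH: "c (pr q) p t = 0" if "s < t" for t
    proof (rule less.hyps[OF _ p q])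
      show "n p - t < n p - s" using that True by linarith
    qed
    consider "n q < n p" | "q = p" | "n q = n p" "q \<noteq> p" | "n p < n q" by linarith
    then show ?thesis
    proof cases
      case 1
      then have "X p p * c (pr q) p s = 0"
        using stab_le[OF Q_lt[OF p] prQ_lt[OF q], of s] True IH n_prQ[OF q]
        unfolding row col by simp
      then show ?thesis using X_diag[OF p] by simp
    next
      case 2
      then show ?thesis using c_pr_p[OF p] by simp
    next
      case 3
      then have "X p p * c (pr q) p s = X q q * c (pr q) p s"
        using stab_le[OF Q_lt[OF p] prQ_lt[OF q], of s] True IH n_prQ[OF q]
        unfolding row col by simp
      then show ?thesis using X_diag_eq[OF q p 3(2,1)] by simp
    next
      case 4
      then have "X q q * c (pr q) p s = 0"
        using stab_ge[OF Q_lt[OF p] prQ_lt[OF q], of s] True IH n_prQ[OF q]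
        unfolding row col by simp
      then show ?thesis using X_diag[OF q] by simp
    qed
  next
    case False
    then show ?thesis using range[OF prQ_lt[OF q] Q_lt[OF p]] n_prQ[OF q] by auto
  qed
qed

text \<open>If \<open>p\<close> is not linked, its diagonal coordinate is itself a parameter. For a
  linked \<open>p\<close> the parameter is \<open>c (mu p) p\<close> instead, and in the equation at
  \<open>mu p\<close> and \<open>pr p\<close> the only remaining term is
  \<open>X (mu p) (pr p)\<close> times the diagonal coordinate of \<open>pr p\<close>.\<close>

lemma diagonal_zero: "p \<in> Q \<Longrightarrow> c (pr p) (pr p) s = 0"
proof (cases "lk p")
  case False
  assume p: "p \<in> Q"
  then show ?thesis
    using par_unlinked[OF p False, of s] skew[OF Q_lt[OF p] Q_lt[OF p], of s] by simp
next
  case True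
  assume p: "p \<in> Q"
  note m = mu_S[OF p True]
  have np: "n (pr p) \<le> n (mu p)" using link[OF p True] n_prQ[OF p] by simp
  show ?thesis
  proof (cases "s < n p")
    case s: True
    have "X (mu p) j * c (pr p) j s = 0" if j: "j < k" "j \<noteq> pr p" for j
    proof (cases "X (mu p) j = 0")
      case False
      from X_zero[OF S_lt[OF m] j(1) this] consider "j = st (mu p)" | q where "q \<in> Q" "j = pr q"
        using m Q_S by blast
      then show ?thesis
      proof cases
        case 1
        then show ?thesis using pr_row_S[OF p conjunct1[OF st[OF m]]] by simp
      next
        case 2
        then have "pr p \<noteq> pr q" using j(2) by simp
        then show ?thesis using column_pr[OF 2(1) prQ_lt[OF p]] 2(2) by simp
      qed
    qed simp
    then have "(\<Sum>l<k. X (mu p) l * c (pr p) l s) = X (mu p) (pr p) * c (pr p) (pr p) s"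
      using prQ_lt[OF p] by (intro sum_lessThan_single) auto
    moreover have "(\<Sum>l<k. X l (pr p) * c l (mu p) t) = 0" for t
      unfolding col_prQ[OF p] using pr_row_S[OF p m] S_S_zero[OF m m] by simp
    ultimately have "X (mu p) (pr p) * c (pr p) (pr p) s = 0"
      using stab_le[OF S_lt[OF m] prQ_lt[OF p] np, of s] s n_prQ[OF p] Y_S[OF m] pr_row_S[OF p m]
      by simp
    then show ?thesis using X_link[OF p True] by simp
  next
    case False
    then show ?thesis using range[OF prQ_lt[OF p] prQ_lt[OF p]] n_prQ[OF p] by simp
  qed
qed

text \<open>The assumptions \<open>par_link\<close>, \<open>par_unlinked\<close>,
  \<open>par_self\<close> and \<open>par_match\<close> set certain coordinates to 0. As all others
  then vanish too, these coordinates are injective on the stabiliser, and counting them bounds its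
  dimension.\<close>

theorem all_zero:
  assumes "i < k" "j < k"
  shows "c i j s = 0"
proof -
  have d: "c p p s = 0" if "p \<in> Q" for p
    using diagonal_zero[OF that, of s] skew[OF Q_lt[OF that] Q_lt[OF that], of s] by simp
  have pp: "c (pr q) (pr p) s = 0" if "p \<in> Q" "q \<in> Q" for p q
    using column_pr[OF that(1) prQ_lt[OF that(2)]] diagonal_zero[OF that(1)]
    by (cases "pr q = pr p") auto
  have mp: "c m (pr p) s = 0" if "p \<in> Q" "m \<in> S" for p m
    using column_pr[OF that(1) S_lt[OF that(2)]] prQ_S[OF that(1)] that(2) by blast
  from index_cases[OF assms(1)] consider "i \<in> S" | "i \<in> Q" | q where "q \<in> Q" "i = pr q" by blast
  then show ?thesis
  proof cases
    case 1
    then show ?thesis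
      using index_cases[OF assms(2)] S_S_zero[OF 1] S_column_zero[OF _ 1] mp[OF _ 1] by blast
  next
    case 2
    then show ?thesis using row_zero[OF 2 assms(2)] d[OF 2] by (cases "j = i") auto
  next
    case 3
    then show ?thesis
      using index_cases[OF assms(2)] pr_row_S[OF 3(1)] pr_Q_zero[OF _ 3(1)] pp[OF _ 3(1)] by blast
  qed
qed

end

section \<open>Coordinates of maps that commute with a nilpotent map\<close>

lemma vector_space_endo:
  assumes "vector_space scale"
  shows "vector_space (endo_scale scale)"
proof -
  interpret vector_space scale by fact
  show ?thesis
    by unfold_locales
      (simp_all add: endo_scale_def plus_fun_def scale_right_distrib scale_left_distrib)
qed

context jordan_system
begin

definition centralising :: "('v \<Rightarrow> 'v) \<Rightarrow> bool" where
  "centralising f \<longleftrightarrow> Vector_Spaces.linear scale scale f \<and> (\<forall>v. f (e v) = e (f v))"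

lemma centralising_pow: "centralising f \<Longrightarrow> f ((e ^^ s) v) = (e ^^ s) (f v)"
  by (induction s) (simp_all add: centralising_def)

definition coord :: "('v \<Rightarrow> 'v) \<Rightarrow> nat \<Rightarrow> nat \<Rightarrow> nat \<Rightarrow> 'k" where
  "coord f m j r = phi j ((e ^^ r) (f (w m)))"

lemma coord_range:
  assumes "centralising f" "m < k" "j < k" "n m \<le> r \<or> n j \<le> r"
  shows "coord f m j r = 0"
proof (cases "n j \<le> r")
  case True
  then show ?thesis unfolding coord_def by (rule phi_pow_zero[OF assms(3)])
next
  case False
  then have "(e ^^ r) (w m) = 0" using assms(4) pow_w_zero[OF assms(2)] by blast
  then have "(e ^^ r) (f (w m)) = f 0" using centralising_pow[OF assms(1)] by metis
  then show ?thesis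
    using assms(1) linear_map_zero[of scale scale f] linear_map_zero[OF phi_linear[OF assms(3)]]
    unfolding coord_def centralising_def by simp
qed

lemma coord_zero:
  assumes f: "centralising f" and z: "\<And>m j r. \<lbrakk>m < k; j < k\<rbrakk> \<Longrightarrow> coord f m j r = 0"
  shows "f = 0"
proof
  fix v
  have lin: "Vector_Spaces.linear scale scale f" using f unfolding centralising_def by blast
  have "f (w m) = 0" if "m < k" for m
    unfolding eq_0_iff[of "f (w m)"] using z[OF that] unfolding coord_def by blast
  then have "f ((e ^^ s) (w m)) = 0" if "m < k" for m s
    using that centralising_pow[OF f] linear_map_zero[OF pow_linear] by simp
  then show "f v = 0 v"
    by (subst expand[of v]) (simp add: linear_map_sum[OF lin] linear_map_scale[OF lin])
qed

text \<open>\<open>phi j\<close> reads the top coefficient of a chain, and \<open>phi i\<close>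
  after \<open>e\<close> the coefficient just below it; for a chain of length 1 the latter is
  0.\<close>

definition level_functional :: "(nat \<Rightarrow> nat \<Rightarrow> 'k) \<Rightarrow> (nat \<Rightarrow> 'k) \<Rightarrow> ('v \<Rightarrow> 'v) \<Rightarrow> 'k" where
  "level_functional X Y z =
    (\<Sum>i<k. \<Sum>j<k. X i j * phi j (z (w i))) + (\<Sum>i<k. Y i * phi i (e (z (w i))))"

lemma level_functional_add: "level_functional X Y (f + g) = level_functional X Y f + level_functional X Y g"
  unfolding level_functional_def plus_fun_def
  by (simp add: linear_map_add[OF phi_linear] linear_map_add[OF e_linear] distrib_left sum.distrib)

lemma level_functional_scale: "level_functional X Y (endo_scale scale c f) = c * level_functional X Y f"
  unfolding level_functional_def endo_scale_def
  by (simp add: linear_map_scale[OF phi_linear] linear_map_scale[OF e_linear] distrib_left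
      sum_distrib_left mult.left_commute)

text \<open>Among the maps commuting with \<open>e\<close>, this one sends the generator
  \<open>w i\<close> to \<open>(e ^^ (n m - Suc r)) (w m)\<close> and the other generators to 0.
  Such a map exists because \<open>r < n i\<close> lets \<open>e ^^ n i\<close> kill that
  image.\<close>

definition elementary :: "nat \<Rightarrow> nat \<Rightarrow> nat \<Rightarrow> 'v \<Rightarrow> 'v" where
  "elementary i m r v = (\<Sum>t<n i. phi i ((e ^^ (n i - Suc t)) v) *s (e ^^ (t + (n m - Suc r))) (w m))"

lemma elementary_centralising:
  assumes "i < k" "m < k" "r < n i" "r < n m"
  shows "centralising (elementary i m r)"
  unfolding centralising_def
proof (intro conjI allI)
  show "Vector_Spaces.linear scale scale (elementary i m r)"
    unfolding Vector_Spaces.linear_iff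
  proof (intro conjI allI vector_space_axioms)
    show "elementary i m r (x + y) = elementary i m r x + elementary i m r y" for x y
      unfolding elementary_def
      by (simp only: linear_map_add[OF pow_linear] linear_map_add[OF phi_linear[OF assms(1)]]
          scale_left_distrib sum.distrib)
    show "elementary i m r (c *s x) = c *s elementary i m r x" for c x
      unfolding elementary_def
      by (simp only: linear_map_scale[OF pow_linear] linear_map_scale[OF phi_linear[OF assms(1)]]
          scale_sum_right scale_scale)
  qed
  fix v
  let ?c = "n m - Suc r"
  let ?g = "\<lambda>t. phi i ((e ^^ (n i - t)) v) *s (e ^^ (t + ?c)) (w m)"
  have "elementary i m r (e v) = (\<Sum>t<n i. ?g t)"
    unfolding elementary_def
  proof (intro sum.cong refl arg_cong2[where f = scale] arg_cong[where f = "phi i"])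
    fix t assume "t \<in> {..<n i}"
    then have "n i - t = Suc (n i - Suc t)" by auto
    then show "(e ^^ (n i - Suc t)) (e v) = (e ^^ (n i - t)) v"
      by (simp only: funpow_Suc_right comp_apply)
  qed
  also have "\<dots> = (\<Sum>t<Suc (n i). ?g t)"
  proof -
    have "n m \<le> n i + ?c" using assms(3,4) by linarith
    then show ?thesis using pow_w_zero[OF assms(2)] by simp
  qed
  also have "\<dots> = (\<Sum>t<n i. ?g (Suc t))"
    using phi_pow_zero[OF assms(1), of "n i" v] by (subst sum.lessThan_Suc_shift) simp
  also have "\<dots> = e (elementary i m r v)"
    unfolding elementary_def
    by (simp add: linear_map_sum[OF e_linear] linear_map_scale[OF e_linear])
  finally show "elementary i m r (e v) = e (elementary i m r v)" .
qed

lemma elementary_w: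
  assumes "i < k" "l < k"
  shows "elementary i m r (w l) = (if l = i then (e ^^ (n m - Suc r)) (w m) else 0)"
proof -
  have "elementary i m r (w l) = (\<Sum>t<n i. if t = 0 then (if l = i then (e ^^ (n m - Suc r)) (w m) else 0) else 0)"
    unfolding elementary_def using assms n_pos[OF assms(1)]
    by (intro sum.cong) (auto simp: dual)
  then show ?thesis using n_pos[OF assms(1)] by simp
qed

lemma phi_elementary:
  assumes "i < k" "m < k" "j < k" "r < n i" "r < n m"
  shows "phi j (elementary i m r x) = (if j = m then phi i ((e ^^ (n i - Suc r)) x) else 0)"
proof -
  have "phi j (elementary i m r x) =
      (\<Sum>t<n i. phi i ((e ^^ (n i - Suc t)) x) * phi j ((e ^^ (t + (n m - Suc r))) (w m)))"
    unfolding elementary_def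
    by (simp only: linear_map_sum[OF phi_linear[OF assms(3)]] linear_map_scale[OF phi_linear[OF assms(3)]])
  also have "\<dots> = (\<Sum>t<n i. if t = r then (if j = m then phi i ((e ^^ (n i - Suc r)) x) else 0) else 0)"
    using assms by (intro sum.cong) (auto simp: dual)
  finally show ?thesis using assms(4) by simp
qed

text \<open>The equation with indices \<open>i\<close>, \<open>m\<close>, \<open>r\<close> is the
  value of the functional on the commutator of \<open>f\<close> with the elementary map of the same
  indices.\<close>

theorem stabiliser_coordinates:
  assumes f: "centralising f"
    and stab: "\<And>g. centralising g \<Longrightarrow> level_functional X Y (commutator f g) = 0"
  shows "stabiliser_coordinates k n X Y (coord f)"
proof
  fix i m r assume im: "i < k" "m < k" "r < n i" "r < n m"
  let ?g = "elementary i m r"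
  note g = elementary_centralising[OF im]
  have fw: "f ((e ^^ s) (w m)) = (e ^^ s) (f (w m))" for s by (rule centralising_pow[OF f])
  have f0: "f 0 = 0" using f linear_map_zero[of scale scale f] unfolding centralising_def by blast
  have 1: "phi j (f (?g (w l)) - ?g (f (w l))) =
    (if l = i then coord f m j (n m - Suc r) else 0) - (if j = m then coord f l i (n i - Suc r) else 0)"
    if "l < k" "j < k" for l j
    using that im elementary_w[OF im(1) that(1)] phi_elementary[OF im(1,2) that(2) im(3,4)]
    by (simp add: linear_map_diff[OF phi_linear] fw f0 coord_def linear_map_zero[OF phi_linear])
  have e2: "e ((e ^^ (n m - Suc r)) x) = (e ^^ (n m - r)) x" for x
    using im(4) by (metis Suc_diff_Suc comp_apply funpow.simps(2))
  have e3: "(e ^^ (n i - Suc r)) (e x) = (e ^^ (n i - r)) x" for x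
    using im(3) by (metis Suc_diff_Suc comp_apply funpow_Suc_right)
  have 2: "phi l (e (f (?g (w l)) - ?g (f (w l)))) =
    (if l = i then coord f m l (n m - r) else 0) - (if l = m then coord f m i (n i - r) else 0)"
    if "l < k" for l
  proof -
    have "phi l (e (?g (f (w l)))) = phi l (?g (e (f (w l))))"
      using g unfolding centralising_def by simp
    also have "\<dots> = (if l = m then coord f m i (n i - r) else 0)"
      using phi_elementary[OF im(1,2) that im(3,4)] by (simp add: e3 coord_def)
    finally have "phi l (e (?g (f (w l)))) = (if l = m then coord f m i (n i - r) else 0)" .
    moreover have "phi l (e (f (?g (w l)))) = (if l = i then coord f m l (n m - r) else 0)"
      using elementary_w[OF im(1) that] that
      by (simp add: fw f0 e2 coord_def linear_map_zero[OF e_linear] linear_map_zero[OF phi_linear])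
    ultimately show ?thesis
      using that by (simp add: linear_map_diff[OF phi_linear] linear_map_diff[OF e_linear])
  qed
  have "0 = level_functional X Y (commutator f ?g)" using stab[OF g] by simp
  also have "\<dots> = (\<Sum>l<k. \<Sum>j<k. X l j * ((if l = i then coord f m j (n m - Suc r) else 0) -
      (if j = m then coord f l i (n i - Suc r) else 0))) +
    (\<Sum>l<k. Y l * ((if l = i then coord f m l (n m - r) else 0) - (if l = m then coord f m i (n i - r) else 0)))"
    unfolding level_functional_def commutator_def using 1 2 by simp
  also have "(\<Sum>l<k. \<Sum>j<k. X l j * ((if l = i then coord f m j (n m - Suc r) else 0) -
      (if j = m then coord f l i (n i - Suc r) else 0))) =
     (\<Sum>l<k. if l = i then (\<Sum>j<k. X l j * coord f m j (n m - Suc r)) else 0) -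
     (\<Sum>l<k. \<Sum>j<k. if j = m then X l j * coord f l i (n i - Suc r) else 0)"
  proof -
    have "(\<Sum>j<k. X l j * ((if l = i then coord f m j (n m - Suc r) else 0) -
        (if j = m then coord f l i (n i - Suc r) else 0))) =
       (\<Sum>j<k. if l = i then X l j * coord f m j (n m - Suc r) else 0) -
       (\<Sum>j<k. if j = m then X l j * coord f l i (n i - Suc r) else 0)" for l
      unfolding sum_subtractf[symmetric] by (intro sum.cong refl) (simp add: right_diff_distrib)
    moreover have "(\<Sum>j<k. if l = i then X l j * coord f m j (n m - Suc r) else 0) =
      (if l = i then (\<Sum>j<k. X l j * coord f m j (n m - Suc r)) else 0)" for l
      by simp
    ultimately show ?thesis by (simp only: sum_subtractf)
  qed
  also have "\<dots> = (\<Sum>j<k. X i j * coord f m j (n m - Suc r)) - (\<Sum>l<k. X l m * coord f l i (n i - Suc r))"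
    using im by simp
  also have "(\<Sum>l<k. Y l * ((if l = i then coord f m l (n m - r) else 0) - (if l = m then coord f m i (n i - r) else 0))) =
     (\<Sum>l<k. if l = i then Y l * coord f m l (n m - r) else 0) - (\<Sum>l<k. if l = m then Y l * coord f m i (n i - r) else 0)"
    unfolding sum_subtractf[symmetric] by (intro sum.cong refl) (auto simp: right_diff_distrib)
  also have "\<dots> = Y i * coord f m i (n m - r) - Y m * coord f m i (n i - r)"
    using im by simp
  finally show "(\<Sum>j<k. X i j * coord f m j (n m - 1 - r)) + Y i * coord f m i (n m - r) =
     (\<Sum>l<k. X l m * coord f l i (n i - 1 - r)) + Y m * coord f m i (n i - r)"
    by (simp add: algebra_simps)
qed (use n_pos coord_range[OF f] in auto)

end

section \<open>Adjoints and the centraliser in the algebra of a form\<close>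

context skew_nilpotent
begin

lemma exists_adjoint:
  assumes g: "gram_on UNIV k n w pr kap" and f: "Vector_Spaces.linear scale scale f"
  shows "\<exists>f'. Vector_Spaces.linear scale scale f' \<and> (\<forall>x y. B (f x) y = B x (f' y))"
proof -
  \<comment> \<open>Expand x in the adapted Jordan basis and move the power of \<open>e\<close> in
    each coefficient to the other argument of the form, which produces the sign.\<close>
  define f' where "f' = (\<lambda>y. \<Sum>i<k. \<Sum>s<n i.
    ((- 1) ^ (n i - Suc s) / kap i * B (f ((e ^^ s) (w i))) y) *s (e ^^ (n i - Suc s)) (w (pr i)))"
  have "B (f x) y = B x (f' y)" for x y
  proof -
    have "f x = (\<Sum>i<k. \<Sum>s<n i. (B ((e ^^ (n i - Suc s)) x) (w (pr i)) / kap i) *s f ((e ^^ s) (w i)))"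
      by (subst gram_onD(11)[OF g UNIV_I, of x]) (simp only: linear_map_sum[OF f] linear_map_scale[OF f])
    then have "B (f x) y = (\<Sum>i<k. \<Sum>s<n i. (B ((e ^^ (n i - Suc s)) x) (w (pr i)) / kap i) * B (f ((e ^^ s) (w i))) y)"
      by (simp only: B_sum_left B_scale_left)
    also have "\<dots> = B x (f' y)"
      unfolding f'_def B_sum_right B_scale_right B_pow_right
      by (intro sum.cong refl) (simp add: skew_pow flip: power_add mult.assoc)
    finally show ?thesis .
  qed
  moreover have "Vector_Spaces.linear scale scale f'"
    unfolding Vector_Spaces.linear_iff
  proof (intro conjI allI vector_space_axioms)
    show "f' (x + y) = f' x + f' y" for x y
      unfolding f'_def by (simp only: B_add_right distrib_left scale_left_distrib sum.distrib)
    show "f' (c *s x) = c *s f' x" for c x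
      unfolding f'_def B_scale_right scale_sum_right scale_scale
      by (intro sum.cong refl arg_cong2[where f = scale]) (simp add: mult_ac)
  qed
  ultimately show ?thesis by blast
qed

lemma B_nondegenerate_right: "(\<And>x. B x v = 0) \<Longrightarrow> v = 0"
  using B_sym[of v] by (intro B_nondegenerate) simp

lemma kap_pr:
  assumes g: "gram_on UNIV k n w pr kap" and i: "i < k"
  shows "kap (pr i) = eps * (- 1) ^ (n i - 1) * kap i"
proof -
  note G = gram_onD[OF g]
  have s: "Suc (n i - 1) = n i" using G(1)[OF i] by simp
  have "B ((e ^^ (n i - 1)) (w i)) (w (pr i)) = kap i"
    using G(9)[OF i G(4)[OF i], of "n i - 1"] s by simp
  moreover have "B ((e ^^ (n i - 1)) (w (pr i))) (w i) = kap (pr i)"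
    using G(9)[OF G(4)[OF i] i, of "n i - 1"] G(5,6)[OF i] s by simp
  ultimately show ?thesis using sym_pow[of "n i - 1" "w (pr i)" "w i"] by simp
qed

text \<open>These maps form the Lie algebra whose index is sought when a form is given.\<close>

definition in_algebra :: "('v \<Rightarrow> 'v) \<Rightarrow> bool" where
  "in_algebra f \<longleftrightarrow> Vector_Spaces.linear scale scale f \<and> (\<forall>x y. B (f x) y + B x (f y) = 0) \<and> (\<forall>v. f (e v) = e (f v))"

context
  fixes k n w pr kap
  assumes g: "gram_on UNIV k n w pr kap"
begin

interpretation js: jordan_system scale e k n w "\<lambda>i v. B v (w (pr i)) / kap i"
  by (rule gram_jordan_system[OF g])

lemma pr_bij: "bij_betw pr {..<k} {..<k}"
  by (rule bij_betw_byWitness[where f' = pr]) (use gram_onD(4,5)[OF g] in auto)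

text \<open>Skewness exchanges the coordinate from block \<open>m\<close> to block \<open>j\<close>
  with the one from the dual of \<open>j\<close> to the dual of \<open>m\<close>; moving the power
  of \<open>e\<close> across the form gives the sign.\<close>

lemma coord_skew:
  assumes f: "in_algebra f" and mj: "m < k" "j < k"
  shows "kap j * js.coord f m j r = - (eps * (- 1) ^ r * (kap (pr m) * js.coord f (pr j) (pr m) r))"
proof -
  note G = gram_onD[OF g]
  have c: "js.centralising f" using f unfolding in_algebra_def js.centralising_def by blast
  have sk: "B (f x) y = - B x (f y)" for x y
    using f unfolding in_algebra_def by (simp add: eq_neg_iff_add_eq_0)
  have "kap j * js.coord f m j r = B ((e ^^ r) (f (w m))) (w (pr j))"
    using G(7)[OF mj(2)] by (simp add: js.coord_def)
  also have "\<dots> = (- 1) ^ r * B (f (w m)) ((e ^^ r) (w (pr j)))" by (rule skew_pow)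
  also have "\<dots> = - ((- 1) ^ r * B (w m) ((e ^^ r) (f (w (pr j)))))"
    by (simp add: sk js.centralising_pow[OF c])
  also have "B (w m) ((e ^^ r) (f (w (pr j)))) = eps * B ((e ^^ r) (f (w (pr j)))) (w m)" by (rule B_sym)
  also have "B ((e ^^ r) (f (w (pr j)))) (w m) = kap (pr m) * js.coord f (pr j) (pr m) r"
    using G(7)[OF G(4)[OF mj(1)]] G(5)[OF mj(1)] by (simp add: js.coord_def)
  finally show ?thesis by (simp add: mult_ac)
qed

text \<open>Taking adjoints exchanges the position (i, j) with (pr j, pr i), up to the factors from
  \<open>kap\<close>. The conditions on \<open>X\<close> and \<open>Y\<close> are chosen so that the
  functional becomes skew under this exchange.\<close>

lemma level_functional_adjoint:
  assumes X: "\<And>i j. \<lbrakk>i < k; j < k\<rbrakk> \<Longrightarrow> X i j * kap (pr i) = - (eps * X (pr j) (pr i) * kap j)"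
    and Y: "\<And>i. i < k \<Longrightarrow> Y i * kap (pr i) = eps * Y (pr i) * kap i"
    and z: "js.centralising z" "js.centralising z'" and adj: "\<And>x y. B (z x) y = B x (z' y)"
  shows "js.level_functional X Y z' = - js.level_functional X Y z"
proof -
  note G = gram_onD[OF g]
  have adj': "B (z' x) y = eps * B (z y) x" for x y
    using adj B_sym[of "z' x" y] by simp
  have "(\<Sum>i<k. \<Sum>j<k. X i j * (B (z' (w i)) (w (pr j)) / kap j)) =
    (\<Sum>i<k. \<Sum>j<k. - (X (pr j) (pr i) * (B (z (w (pr j))) (w (pr (pr i))) / kap (pr i))))"
  proof (intro sum.cong refl)
    fix i j assume "i \<in> {..<k}" "j \<in> {..<k}"
    then have ij: "i < k" "j < k" by auto
    have nz: "kap j \<noteq> 0" "kap (pr i) \<noteq> 0" using G(7) G(4) ij by auto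
    have "X i j * (B (z' (w i)) (w (pr j)) / kap j) =
       (X i j * kap (pr i)) * (eps * B (z (w (pr j))) (w i)) / (kap j * kap (pr i))"
      using nz by (simp add: adj')
    also have "\<dots> = - ((eps * eps) * (X (pr j) (pr i) * B (z (w (pr j))) (w i) / kap (pr i)))"
      unfolding X[OF ij] using nz by (simp add: divide_simps)
    also have "eps * eps = 1" using eps by auto
    finally show "X i j * (B (z' (w i)) (w (pr j)) / kap j) =
      - (X (pr j) (pr i) * (B (z (w (pr j))) (w (pr (pr i))) / kap (pr i)))"
      using G(5)[OF ij(1)] by simp
  qed
  also have "\<dots> = (\<Sum>j<k. \<Sum>i<k. - (X (pr j) (pr i) * (B (z (w (pr j))) (w (pr (pr i))) / kap (pr i))))"
    by (rule sum.swap)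
  also have "\<dots> = (\<Sum>j<k. \<Sum>i<k. - (X (pr j) i * (B (z (w (pr j))) (w (pr i)) / kap i)))"
    by (intro sum.cong refl sum.reindex_bij_betw[OF pr_bij])
  also have "\<dots> = (\<Sum>j<k. \<Sum>i<k. - (X j i * (B (z (w j)) (w (pr i)) / kap i)))"
    by (rule sum.reindex_bij_betw[OF pr_bij])
  finally have 1: "(\<Sum>i<k. \<Sum>j<k. X i j * (B (z' (w i)) (w (pr j)) / kap j)) =
    - (\<Sum>i<k. \<Sum>j<k. X i j * (B (z (w i)) (w (pr j)) / kap j))"
    by (simp add: sum_negf)
  have ec: "e (z x) = z (e x)" for x using z(1) unfolding js.centralising_def by simp
  have "(\<Sum>i<k. Y i * (B (e (z' (w i))) (w (pr i)) / kap i)) =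
      (\<Sum>i<k. - (Y (pr i) * (B (e (z (w (pr i)))) (w (pr (pr i))) / kap (pr i))))"
  proof (intro sum.cong refl)
    fix i assume "i \<in> {..<k}"
    then have i: "i < k" by auto
    have nz: "kap i \<noteq> 0" "kap (pr i) \<noteq> 0" using G(7) G(4) i by auto
    have "B (e (z' (w i))) (w (pr i)) = - (eps * B (e (z (w (pr i)))) (w i))"
      by (simp add: e_skew adj' ec)
    then have "Y i * (B (e (z' (w i))) (w (pr i)) / kap i) =
       - ((Y i * kap (pr i)) * (eps * B (e (z (w (pr i)))) (w i)) / (kap i * kap (pr i)))"
      using nz by simp
    also have "\<dots> = - ((eps * eps) * (Y (pr i) * B (e (z (w (pr i)))) (w i) / kap (pr i)))"
      unfolding Y[OF i] using nz by (simp add: divide_simps)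
    also have "eps * eps = 1" using eps by auto
    finally show "Y i * (B (e (z' (w i))) (w (pr i)) / kap i) =
       - (Y (pr i) * (B (e (z (w (pr i)))) (w (pr (pr i))) / kap (pr i)))"
      using G(5)[OF i] by simp
  qed
  also have "\<dots> = (\<Sum>i<k. - (Y i * (B (e (z (w i))) (w (pr i)) / kap i)))"
    by (rule sum.reindex_bij_betw[OF pr_bij])
  finally have 2: "(\<Sum>i<k. Y i * (B (e (z' (w i))) (w (pr i)) / kap i)) =
    - (\<Sum>i<k. Y i * (B (e (z (w i))) (w (pr i)) / kap i))"
    by (simp add: sum_negf)
  show ?thesis unfolding js.level_functional_def 1 2 by simp
qed

text \<open>Testing with the algebra amounts to testing with all maps commuting with
  \<open>e\<close>: if h has adjoint h', then h - h' lies in the algebra, the adjoint of [f, h] is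
  [f, h'], and a functional that is skew under the adjoint has on [f, h - h'] twice its value on
  [f, h]. Hence the equations of the general linear case hold.\<close>

theorem form_stabiliser_coordinates:
  assumes X: "\<And>i j. \<lbrakk>i < k; j < k\<rbrakk> \<Longrightarrow> X i j * kap (pr i) = - (eps * X (pr j) (pr i) * kap j)"
    and Y: "\<And>i. i < k \<Longrightarrow> Y i * kap (pr i) = eps * Y (pr i) * kap i"
    and f: "in_algebra f"
    and stab: "\<And>h. in_algebra h \<Longrightarrow> js.level_functional X Y (commutator f h) = 0"
  shows "stabiliser_coordinates k n X Y (js.coord f)"
proof (rule js.stabiliser_coordinates)
  show cf: "js.centralising f" using f unfolding in_algebra_def js.centralising_def by blast
  have sk: "B (f x) y = - B x (f y)" for x y
    using f unfolding in_algebra_def by (simp add: eq_neg_iff_add_eq_0)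
  fix h assume h: "js.centralising h"
  then obtain h' where h': "Vector_Spaces.linear scale scale h'" "\<And>x y. B (h x) y = B x (h' y)"
    using exists_adjoint[OF g] unfolding js.centralising_def by blast
  have h'': "B (h' x) y = B x (h y)" for x y
    using h'(2)[of y x] B_sym[of "h' x" y] B_sym[of x "h y"] by simp
  have comm: "h' (e x) = e (h' x)" for x
  proof -
    have "B y (h' (e x) - e (h' x)) = 0" for y
    proof -
      have "B y (h' (e x)) = - B (e (h y)) x" using h'(2)[of y "e x"] e_skew[of "h y" x] by simp
      also have "\<dots> = - B (h (e y)) x" using h unfolding js.centralising_def by simp
      also have "\<dots> = B y (e (h' x))" using h'(2)[of "e y" x] e_skew[of y "h' x"] by simp
      finally show ?thesis using linear_map_diff[OF B_linear_right] by simp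
    qed
    then have "h' (e x) - e (h' x) = 0" by (rule B_nondegenerate_right)
    then show ?thesis by simp
  qed
  have ch': "js.centralising h'" using h'(1) comm unfolding js.centralising_def by blast
  have lins: "Vector_Spaces.linear scale scale f" "Vector_Spaces.linear scale scale h"
    using cf h unfolding js.centralising_def by auto
  have cc: "js.centralising (commutator f u)" if "js.centralising u" for u
  proof -
    have u: "Vector_Spaces.linear scale scale u" "\<And>v. u (e v) = e (u v)" using that unfolding js.centralising_def by auto
    have fe: "\<And>v. f (e v) = e (f v)" using cf unfolding js.centralising_def by auto
    show ?thesis
      unfolding js.centralising_def Vector_Spaces.linear_iff commutator_def
      by (intro conjI allI vector_space_axioms)
        (simp_all add: linear_map_add[OF lins(1)] linear_map_add[OF u(1)] linear_map_scale[OF lins(1)]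
          linear_map_scale[OF u(1)] linear_map_diff[OF e_linear] scale_right_diff_distrib u(2) fe)
  qed
  have adj: "B (commutator f h x) y = B x (commutator f h' y)" for x y
    unfolding commutator_def
    by (simp add: B_diff_left linear_map_diff[OF B_linear_right] sk h'(2))
  have neg: "js.level_functional X Y (commutator f h') = - js.level_functional X Y (commutator f h)"
    by (rule level_functional_adjoint[OF X Y cc[OF h] cc[OF ch'] adj])
  define d where "d = (\<lambda>x. h x - h' x)"
  have "in_algebra d"
    unfolding in_algebra_def Vector_Spaces.linear_iff
  proof (intro conjI allI vector_space_axioms)
    show "d (x + y) = d x + d y" "d (c *s x) = c *s d x" for x y c
      by (simp_all add: d_def linear_map_add[OF lins(2)] linear_map_add[OF h'(1)]
          linear_map_scale[OF lins(2)] linear_map_scale[OF h'(1)] scale_right_diff_distrib)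
    show "B (d x) y + B x (d y) = 0" for x y
      by (simp add: d_def B_diff_left linear_map_diff[OF B_linear_right] h'(2) h'')
    show "d (e v) = e (d v)" for v
      using h comm unfolding d_def js.centralising_def by (simp add: linear_map_diff[OF e_linear])
  qed
  then have "0 = js.level_functional X Y (commutator f d)" using stab by simp
  also have "commutator f d = commutator f h + endo_scale scale (- 1) (commutator f h')"
    by (rule ext) (simp add: commutator_def d_def endo_scale_def linear_map_diff[OF lins(1)])
  also have "js.level_functional X Y \<dots> = 2 * js.level_functional X Y (commutator f h)"
    unfolding js.level_functional_add js.level_functional_scale neg by simp
  finally show "js.level_functional X Y (commutator f h) = 0" using two by simp
qed

end

end

section \<open>Matchings of blocks\<close>

lemma exists_injection:
  assumes "finite A" "infinite B \<or> card A \<le> card B"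
  shows "\<exists>f. inj_on f A \<and> f ` A \<subseteq> B"
proof -
  have "\<exists>C\<subseteq>B. finite C \<and> card A \<le> card C"
  proof (cases "finite B")
    case True
    then show ?thesis using assms(2) by (intro exI[of _ B]) simp
  next
    case False
    then obtain C where "finite C" "card C = card A" "C \<subseteq> B"
      using infinite_arbitrarily_large[of B "card A"] by blast
    then show ?thesis by (intro exI[of _ C]) simp
  qed
  then obtain C where C: "C \<subseteq> B" "finite C" "card A \<le> card C" by blast
  then obtain f where "f ` A \<subseteq> C" "inj_on f A" using card_le_inj[OF assms(1) C(2,3)] by blast
  then show ?thesis using C(1) by blast
qed

lemma finite_square_fibre: "finite {t::'k::field. t * t = d} \<and> card {t. t * t = d} \<le> 2"
proof (cases "{t::'k. t * t = d} = {}")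
  case False
  then obtain s where s: "s * s = d" by auto
  have "{t. t * t = d} \<subseteq> {s, - s}"
    using s by (auto simp: square_eq_iff)
  moreover have "card {s, - s} \<le> 2" by (cases "s = - s") (simp_all add: card_insert_if)
  ultimately show ?thesis by (meson card_mono finite.simps finite_subset le_trans)
qed simp

text \<open>Greedy choice: each earlier value excludes at most two elements \<open>t\<close>, and 0
  is excluded as well, so at most 2 |I| + 1 field elements are bad when one more index is
  added.\<close>

lemma exists_square_values:
  fixes r :: "'i \<Rightarrow> 'k::field"
  assumes "finite I" "\<And>i. i \<in> I \<Longrightarrow> r i \<noteq> 0"
    "infinite (UNIV :: 'k set) \<or> 2 * card I \<le> card (UNIV :: 'k set)"
  shows "\<exists>T. (\<forall>i\<in>I. T i \<noteq> 0) \<and> inj_on (\<lambda>i. r i * (T i * T i)) I"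
  using assms
proof (induction I)
  case (insert i I)
  then have "\<exists>T. (\<forall>i\<in>I. T i \<noteq> 0) \<and> inj_on (\<lambda>i. r i * (T i * T i)) I"
    by (auto simp: card_insert_if)
  then obtain T where T: "\<And>j. j \<in> I \<Longrightarrow> T j \<noteq> 0" "inj_on (\<lambda>i. r i * (T i * T i)) I"
    by blast
  let ?bad = "insert 0 (\<Union>j\<in>I. {t. t * t = r j * (T j * T j) / r i})"
  have fin: "finite ?bad" using insert.hyps(1) finite_square_fibre by auto
  have "card (\<Union>j\<in>I. {t. t * t = r j * (T j * T j) / r i}) \<le>
      (\<Sum>j\<in>I. card {t. t * t = r j * (T j * T j) / r i})"
    by (rule card_UN_le[OF insert.hyps(1)])
  also have "\<dots> \<le> (\<Sum>j\<in>I. 2)" by (intro sum_mono) (use finite_square_fibre in blast)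
  finally have "card ?bad \<le> 2 * card I + 1" using fin by (simp add: card_insert_if)
  then have "infinite (UNIV :: 'k set) \<or> card ?bad < card (UNIV :: 'k set)"
    using insert.prems(2) insert.hyps by auto
  then have "?bad \<noteq> UNIV" using fin by (metis less_irrefl)
  then obtain t where t: "t \<noteq> 0" "\<And>j. j \<in> I \<Longrightarrow> t * t \<noteq> r j * (T j * T j) / r i" by auto
  have ne: "r i * (t * t) \<noteq> r j * (T j * T j)" "r j * (T j * T j) \<noteq> r i * (t * t)" if "j \<in> I" for j
    using t(2)[OF that] insert.prems(1)[of i] by (auto simp: field_simps)
  have "inj_on (\<lambda>j. r j * ((T(i := t)) j * (T(i := t)) j)) (insert i I)"
  proof (intro inj_onI)
    fix a b assume ab: "a \<in> insert i I" "b \<in> insert i I"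
      "r a * ((T(i := t)) a * (T(i := t)) a) = r b * ((T(i := t)) b * (T(i := t)) b)"
    consider "a = i" "b = i" | "a = i" "b \<in> I" "b \<noteq> i" | "b = i" "a \<in> I" "a \<noteq> i"
      | "a \<in> I" "b \<in> I" "a \<noteq> i" "b \<noteq> i"
      using ab(1,2) by blast
    then show "a = b"
    proof cases
      case 4
      then show ?thesis using ab(3) inj_onD[OF T(2), of a b] by simp
    qed (use ab(3) ne in simp_all)
  qed
  then show ?case
    using T(1) t(1) by (intro exI[of _ "T(i := t)"]) simp
qed simp

lemma initial_segment:
  assumes "finite A" "\<And>a b. \<lbrakk>a \<in> A; b \<le> a\<rbrakk> \<Longrightarrow> b \<in> (A :: nat set)"
  shows "A = {..<card A}"
proof (cases "A = {}")
  case False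
  have "A = {..Max A}"
  proof
    show "A \<subseteq> {..Max A}" using Max_ge[OF assms(1)] by blast
    show "{..Max A} \<subseteq> A" using assms(2)[OF Max_in[OF assms(1) False]] by blast
  qed
  then show ?thesis by (metis card_atMost lessThan_Suc_atMost)
qed simp

text \<open>
  The elements of \<open>S\<close> are matched consecutively, starting with the two largest. The clause about
  \<open>p\<close> says that a size \<open>p\<close> lies in the gap of at most one matched pair, where the smallest
  element is regarded as matched with the size \<open>0\<close> if \<open>card S\<close> is odd.
\<close>

lemma exists_matching:
  fixes S :: "nat set" and n :: "nat \<Rightarrow> nat"
  assumes fin: "finite S" and mono: "\<And>i j. \<lbrakk>i \<in> S; j \<in> S; i \<le> j\<rbrakk> \<Longrightarrow> n i \<le> n j"
  shows "\<exists>st. (\<forall>i\<in>S. st i \<in> S \<and> st (st i) = i) \<and>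
    (\<forall>i\<in>S. \<forall>j\<in>S. st i \<noteq> i \<longrightarrow> st j \<noteq> j \<longrightarrow> j \<noteq> i \<longrightarrow> j \<noteq> st i \<longrightarrow>
      max (n j) (n (st j)) \<le> min (n i) (n (st i)) \<or> max (n i) (n (st i)) \<le> min (n j) (n (st j))) \<and>
    (\<forall>i\<in>S. \<forall>j\<in>S. st j = j \<longrightarrow> i \<noteq> j \<longrightarrow> st i \<noteq> i \<and> n j \<le> n i) \<and>
    (\<forall>p. (\<forall>m\<in>S. n m \<noteq> p) \<longrightarrow>
      (\<forall>m\<in>S. p < n m \<longrightarrow> st m \<noteq> m \<and> p < n (st m)) \<or>
      (\<exists>u\<in>S. p < n u \<and> (st u = u \<or> n (st u) < p) \<and>
        (\<forall>m\<in>S. p < n m \<longrightarrow> m \<noteq> u \<longrightarrow> st m \<noteq> m \<and> p < n (st m))))"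
proof -
  define h where "h = card S"
  obtain f where f: "bij_betw f {..<h} S" "strict_mono_on {..<h} f"
    using ex_bij_betw_strict_mono_card[OF fin] unfolding h_def by blast
  \<comment> \<open>\<open>s\<close> lists \<open>S\<close> in descending order, \<open>pos\<close>
    is the inverse numbering, and \<open>pa\<close> below pairs the positions 2b and 2b + 1.\<close>
  define s where "s = (\<lambda>a. f (h - Suc a))"
  define pos where "pos = (\<lambda>i. h - Suc (inv_into {..<h} f i))"
  have s_S: "s a \<in> S" if "a < h" for a
    using that bij_betwE[OF f(1)] by (auto simp: s_def)
  have pos_lt: "pos i < h" and s_pos: "s (pos i) = i" if "i \<in> S" for i
  proof -
    have i: "inv_into {..<h} f i < h" "f (inv_into {..<h} f i) = i"
      using that f(1) inv_into_into[of i f "{..<h}"] f_inv_into_f[of i f "{..<h}"]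
      by (auto simp: bij_betw_def)
    then show "pos i < h" by (simp add: pos_def)
    have "h - Suc (h - Suc (inv_into {..<h} f i)) = inv_into {..<h} f i" using i(1) by simp
    then show "s (pos i) = i" using i(2) by (simp add: s_def pos_def)
  qed
  have pos_s: "pos (s a) = a" if "a < h" for a
  proof -
    have "inv_into {..<h} f (f (h - Suc a)) = h - Suc a"
      using f(1) that by (intro inv_into_f_f) (auto simp: bij_betw_def)
    then show ?thesis using that by (simp add: s_def pos_def)
  qed
  have anti: "n (s b) \<le> n (s a)" if "a \<le> b" "b < h" for a b
  proof -
    have "f (h - Suc b) \<le> f (h - Suc a)"
      using that by (intro strict_mono_on_leD[OF f(2)]) auto
    then show ?thesis using mono[OF s_S s_S] that by (simp add: s_def)
  qed
  have antiS: "n j \<le> n i" if "i \<in> S" "j \<in> S" "pos i \<le> pos j" for i j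
    using anti[OF that(3) pos_lt[OF that(2)]] s_pos that by simp
  define pa where "pa = (\<lambda>a. if even a then (if Suc a < h then Suc a else a) else a - 1)"
  have pa: "pa a < h" "pa (pa a) = a" "pa a div 2 = a div 2" if "a < h" for a
  proof -
    have "pa a < h \<and> pa (pa a) = a \<and> pa a div 2 = a div 2"
    proof (cases "even a")
      case True
      then show ?thesis using that by (simp add: pa_def)
    next
      case False
      then have "even (a - 1)" "Suc (a - 1) = a" "(a - 1) div 2 = a div 2" by presburger+
      then show ?thesis using that False by (simp add: pa_def)
    qed
    then show "pa a < h" "pa (pa a) = a" "pa a div 2 = a div 2" by blast+
  qed
  define st where "st = (\<lambda>i. s (pa (pos i)))"
  have st: "st i \<in> S" "st (st i) = i" "pos (st i) = pa (pos i)" if "i \<in> S" for i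
    using pos_lt[OF that] pa[OF pos_lt[OF that]] pos_s s_S s_pos[OF that] by (auto simp: st_def)
  have fix_iff: "st i = i \<longleftrightarrow> pa (pos i) = pos i" if "i \<in> S" for i
    using st[OF that] s_pos[OF that] by (metis st_def)
  have nested: "max (n j) (n (st j)) \<le> min (n i) (n (st i))"
    if "i \<in> S" "j \<in> S" "pos i div 2 < pos j div 2" for i j
  proof -
    have lt: "a \<le> b" if "a div 2 = pos i div 2" "b div 2 = pos j div 2" for a b
      using that \<open>pos i div 2 < pos j div 2\<close> by linarith
    have d: "pos (st i) div 2 = pos i div 2" "pos (st j) div 2 = pos j div 2"
      using st(3) pa(3) pos_lt that by auto
    show ?thesis
      using antiS[OF that(1,2) lt] antiS[OF that(1) st(1)[OF that(2)] lt]
        antiS[OF st(1)[OF that(1)] that(2) lt] antiS[OF st(1)[OF that(1)] st(1)[OF that(2)] lt] d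
      by simp
  qed
  have eq_cases: "j = i \<or> j = st i" if "i \<in> S" "j \<in> S" "st i \<noteq> i" "pos i div 2 = pos j div 2" for i j
  proof -
    have "pa (pos i) \<noteq> pos i" using fix_iff that by blast
    have "pos j = pos i \<or> pos j = pa (pos i)"
    proof (cases "even (pos i)")
      case True
      then have "pa (pos i) = Suc (pos i)"
        using \<open>pa (pos i) \<noteq> pos i\<close> by (simp add: pa_def split: if_splits)
      then show ?thesis using True that(4) by presburger
    next
      case False
      then have "pa (pos i) = pos i - 1" by (simp add: pa_def)
      then show ?thesis using False that(4) by presburger
    qed
    then show ?thesis using s_pos that st(3)[OF that(1)] st(1)[OF that(1)] by metis
  qed
  have gap: "(\<forall>m\<in>S. p < n m \<longrightarrow> st m \<noteq> m \<and> p < n (st m)) \<or>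
      (\<exists>u\<in>S. p < n u \<and> (st u = u \<or> n (st u) < p) \<and>
        (\<forall>m\<in>S. p < n m \<longrightarrow> m \<noteq> u \<longrightarrow> st m \<noteq> m \<and> p < n (st m)))"
    if p: "\<forall>m\<in>S. n m \<noteq> p" for p
  proof -
    \<comment> \<open>The elements of size above \<open>p\<close> occupy the positions below
      \<open>c\<close>. For even \<open>c\<close> these are closed under \<open>pa\<close>; for odd
      \<open>c\<close> the one exception is the last of them, at position c - 1.\<close>
    define c where "c = card {a. a < h \<and> p < n (s a)}"
    have "{a. a < h \<and> p < n (s a)} = {..<c}"
      unfolding c_def using anti by (intro initial_segment) (auto intro: less_le_trans)
    then have seg: "p < n (s a) \<longleftrightarrow> a < c" if "a < h" for a using that by blast
    have ch: "c \<le> h" unfolding c_def using card_mono[of "{..<h}" "{a. a < h \<and> p < n (s a)}"] by auto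
    have segS: "p < n m \<longleftrightarrow> pos m < c" if "m \<in> S" for m
      using seg[OF pos_lt[OF that]] s_pos[OF that] by simp
    have inner: "st m \<noteq> m \<and> p < n (st m)" if "m \<in> S" "pos m < c'" "even c'" "c' \<le> c" for m c'
    proof -
      have "Suc (pos m) < c' \<or> odd (pos m)" using that(2,3) by presburger
      then have "pa (pos m) \<noteq> pos m \<and> pa (pos m) < c'"
        using that(2,4) ch by (auto simp: pa_def elim!: oddE)
      then show ?thesis using fix_iff[OF that(1)] segS[OF st(1)[OF that(1)]] st(3)[OF that(1)] that(4) by simp
    qed
    show ?thesis
    proof (cases "even c")
      case True
      then show ?thesis using inner segS by blast
    next
      case False
      then have c: "0 < c" "even (c - 1)" "c - 1 < h" using ch by (auto elim!: oddE)
      define u where "u = s (c - 1)"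
      have u: "u \<in> S" "pos u = c - 1" using s_S[OF c(3)] pos_s[OF c(3)] by (auto simp: u_def)
      have "p < n u" using segS[OF u(1)] u(2) c(1) by simp
      moreover have "st u = u \<or> n (st u) < p"
      proof (cases "c < h")
        case True
        then have "pos (st u) = c" using st(3)[OF u(1)] u(2) c by (simp add: pa_def)
        then have "\<not> p < n (st u)" using segS[OF st(1)[OF u(1)]] by simp
        then show ?thesis using p st(1)[OF u(1)] by (metis linorder_neqE_nat)
      next
        case False
        then show ?thesis using fix_iff[OF u(1)] u(2) c by (simp add: pa_def)
      qed
      moreover have "st m \<noteq> m \<and> p < n (st m)" if "m \<in> S" "p < n m" "m \<noteq> u" for m
      proof -
        have "pos m \<noteq> pos u" using s_pos that(1,3) u(1) by metis
        then have "pos m < c - 1" using segS[OF that(1)] that(2) u(2) by simp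
        then show ?thesis using inner[OF that(1) _ c(2)] by simp
      qed
      ultimately show ?thesis using u(1) by blast
    qed
  qed
  have unm: "st i \<noteq> i \<and> n j \<le> n i" if "i \<in> S" "j \<in> S" "st j = j" "i \<noteq> j" for i j
  proof -
    have j: "even (pos j)" "\<not> Suc (pos j) < h"
      using fix_iff[OF that(2)] that(3) by (auto simp: pa_def split: if_splits elim!: oddE)
    have "pos i \<noteq> pos j" using s_pos that by metis
    then have lt: "pos i < pos j" using j(2) pos_lt[OF that(1)] by simp
    then have "Suc (pos i) < h \<or> odd (pos i)" using j(1) pos_lt[OF that(2)] by presburger
    then have "pa (pos i) \<noteq> pos i" by (auto simp: pa_def elim!: oddE)
    then show ?thesis using fix_iff[OF that(1)] antiS[OF that(1,2)] lt by simp
  qed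
  have nest2: "max (n j) (n (st j)) \<le> min (n i) (n (st i)) \<or> max (n i) (n (st i)) \<le> min (n j) (n (st j))"
    if "i \<in> S" "j \<in> S" "st i \<noteq> i" "j \<noteq> i" "j \<noteq> st i" for i j
  proof -
    have "pos i div 2 \<noteq> pos j div 2" using eq_cases[OF that(1-3)] that(4,5) by blast
    then consider "pos i div 2 < pos j div 2" | "pos j div 2 < pos i div 2" by linarith
    then show ?thesis using nested[OF that(1,2)] nested[OF that(2,1)] by cases blast+
  qed
  show ?thesis
  proof (intro exI[of _ st] conjI ballI allI impI)
    fix p assume "\<forall>m\<in>S. n m \<noteq> p"
    then show "(\<forall>m\<in>S. p < n m \<longrightarrow> st m \<noteq> m \<and> p < n (st m)) \<or>
      (\<exists>u\<in>S. p < n u \<and> (st u = u \<or> n (st u) < p) \<and>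
        (\<forall>m\<in>S. p < n m \<longrightarrow> m \<noteq> u \<longrightarrow> st m \<noteq> m \<and> p < n (st m)))"
      by (rule gap)
  next
    fix i assume "i \<in> S"
    then show "st i \<in> S" "st (st i) = i" by (fact st)+
  next
    fix i j assume "i \<in> S" "j \<in> S" "st i \<noteq> i" "st j \<noteq> j" "j \<noteq> i" "j \<noteq> st i"
    then show "max (n j) (n (st j)) \<le> min (n i) (n (st i)) \<or> max (n i) (n (st i)) \<le> min (n j) (n (st j))"
      by (intro nest2)
  next
    fix i j assume ij: "i \<in> S" "j \<in> S" "st j = j" "i \<noteq> j"
    show "st i \<noteq> i" "n j \<le> n i" using unm[OF ij] by simp_all
  qed
qed

section \<open>Upper bounds for the index\<close>

lemma (in vector_space) dim_le_coordinates:
  fixes f :: "'i \<Rightarrow> 'b \<Rightarrow> 'a"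
  assumes U: "subspace U" and fin: "finite F"
    and add: "\<And>i x y. \<lbrakk>i \<in> F; x \<in> U; y \<in> U\<rbrakk> \<Longrightarrow> f i (x + y) = f i x + f i y"
    and scale: "\<And>i x a. \<lbrakk>i \<in> F; x \<in> U\<rbrakk> \<Longrightarrow> f i (a *s x) = a * f i x"
    and ker: "\<And>x. \<lbrakk>x \<in> U; \<And>i. i \<in> F \<Longrightarrow> f i x = 0\<rbrakk> \<Longrightarrow> x = 0"
  shows "dim U \<le> card F"
proof -
  obtain h where h: "bij_betw h {0..<card F} F" using ex_bij_betw_nat_finite[OF fin] by blast
  then have hF: "h i \<in> F" if "i < card F" for i using bij_betwE[OF h] that by simp
  show ?thesis
  proof (rule dim_le_functionals[OF U, where f = "\<lambda>i. f (h i)"])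
    fix x assume x: "x \<in> U" "\<And>i. i < card F \<Longrightarrow> f (h i) x = 0"
    show "x = 0"
    proof (rule ker[OF x(1)])
      fix i assume "i \<in> F"
      then obtain j where "j < card F" "h j = i"
        using h unfolding bij_betw_def by (metis atLeastLessThan_iff imageE)
      then show "f i x = 0" using x(2) by blast
    qed
  qed (use hF add scale in auto)
qed

lemma involution_sum:
  fixes g :: "nat \<Rightarrow> 'b::comm_monoid_add"
  assumes fin: "finite S" and st: "\<And>i. i \<in> S \<Longrightarrow> st i \<in> S \<and> st (st i) = i"
  shows "sum g S = sum g {i\<in>S. st i = i} + (\<Sum>i\<in>{i\<in>S. st i < i}. g i + g (st i))"
proof -
  let ?A = "{i\<in>S. st i = i}" and ?B = "{i\<in>S. st i < i}" and ?C = "{i\<in>S. i < st i}"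
  have "sum g S = sum g (?A \<union> (?B \<union> ?C))" by (rule arg_cong[of _ _ "sum g"]) auto
  also have "\<dots> = sum g ?A + (sum g ?B + sum g ?C)"
    using fin by (subst sum.union_disjoint; (subst sum.union_disjoint)?) auto
  also have "sum g ?C = (\<Sum>i\<in>?B. g (st i))"
    by (rule sum.reindex_bij_betw[symmetric], rule bij_betw_byWitness[where f' = st])
      (use st in auto)
  finally show ?thesis by (simp add: sum.distrib)
qed

definition stabiliser_in ::
  "(('v::ab_group_add \<Rightarrow> 'v) \<Rightarrow> bool) \<Rightarrow> (('v \<Rightarrow> 'v) \<Rightarrow> 'k::zero) \<Rightarrow> ('v \<Rightarrow> 'v) set" where
  "stabiliser_in P alpha = {f. P f \<and> (\<forall>g. P g \<longrightarrow> alpha (commutator f g) = 0)}"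

lemma card_triples_le:
  "finite F \<Longrightarrow> card {(a i, b i, c i t) | i t. i \<in> F \<and> t < (N i :: nat)} \<le> sum N F"
proof -
  assume F: "finite F"
  have "{(a i, b i, c i t) | i t. i \<in> F \<and> t < N i} = (\<lambda>(i, t). (a i, b i, c i t)) ` Sigma F (\<lambda>i. {..<N i})"
    by auto
  then have "card {(a i, b i, c i t) | i t. i \<in> F \<and> t < N i} \<le> card (Sigma F (\<lambda>i. {..<N i}))"
    using F card_image_le[of "Sigma F (\<lambda>i. {..<N i})" "\<lambda>(i, t). (a i, b i, c i t)"] by simp
  then show ?thesis using F by simp
qed

lemma finite_triples:
  "finite F \<Longrightarrow> finite {(a i, b i, c i t) | i t. i \<in> F \<and> t < (N i :: nat)}"
proof -
  assume F: "finite F"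
  have "{(a i, b i, c i t) | i t. i \<in> F \<and> t < N i} = (\<lambda>(i, t). (a i, b i, c i t)) ` Sigma F (\<lambda>i. {..<N i})"
    by auto
  then show ?thesis using F by simp
qed

lemma commutator_add_left:
  "Vector_Spaces.linear s s h \<Longrightarrow> commutator (f + g) h = commutator f h + commutator g h"
  by (rule ext) (simp add: commutator_def linear_map_add)

lemma commutator_scale_left:
  assumes "vector_space s" "Vector_Spaces.linear s s h"
  shows "commutator (endo_scale s c f) h = endo_scale s c (commutator f h)"
proof -
  interpret vector_space s by fact
  show ?thesis
    by (rule ext) (simp add: commutator_def endo_scale_def linear_map_scale[OF assms(2)] scale_right_diff_distrib)
qed

lemma subspace_stabiliser_in:
  fixes s :: "'k::field \<Rightarrow> 'v::ab_group_add \<Rightarrow> 'v"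
  assumes vs: "vector_space s"
    and lin: "\<And>f. P f \<Longrightarrow> Vector_Spaces.linear s s f"
    and P: "P 0" "\<And>f g. P f \<Longrightarrow> P g \<Longrightarrow> P (f + g)" "\<And>c f. P f \<Longrightarrow> P (endo_scale s c f)"
    and alpha: "\<And>f g. alpha (f + g) = alpha f + alpha g" "\<And>c f. alpha (endo_scale s c f) = c * (alpha f :: 'k)"
  shows "module.subspace (endo_scale s) (stabiliser_in P alpha)"
proof -
  interpret E: vector_space "endo_scale s" by (rule vector_space_endo[OF vs])
  have 0: "commutator 0 h = 0" if "P h" for h :: "'v \<Rightarrow> 'v"
    using linear_map_zero[OF lin[OF that]] by (auto simp: commutator_def)
  have "alpha 0 = alpha 0 + alpha 0" using alpha(1)[of 0 0] by (simp only: add_0_left)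
  then have a0: "alpha 0 = 0" by (simp only: add_cancel_right_right)
  show ?thesis
    by (rule E.subspaceI)
      (use P alpha in \<open>auto simp: stabiliser_in_def 0 a0 commutator_add_left[OF lin] commutator_scale_left[OF vs lin]\<close>)
qed

section \<open>Upper bound for the general linear algebra\<close>

context jordan_system
begin

lemma dim_UNIV: "dim UNIV = sum n {..<k}"
proof -
  let ?I = "Sigma {..<k} (\<lambda>i. {..<n i})" and ?b = "\<lambda>(i, s). (e ^^ s) (w i)"
  have "inj_on ?b ?I" "independent (?b ` ?I)" "span (?b ` ?I) = UNIV"
    using is_jordan_basis unfolding jordan_basis_def Let_def by auto
  then have "dim UNIV = card (?b ` ?I)" by (intro dim_eq_card) auto
  also have "\<dots> = card ?I" using \<open>inj_on ?b ?I\<close> by (rule card_image)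
  finally show ?thesis by simp
qed

lemma coord_add: "j < k \<Longrightarrow> coord (f + g) m j r = coord f m j r + coord g m j r"
  by (simp add: coord_def linear_map_add[OF pow_linear] linear_map_add[OF phi_linear])

lemma coord_scale: "j < k \<Longrightarrow> coord (endo_scale scale c f) m j r = c * coord f m j r"
  by (simp add: coord_def endo_scale_def linear_map_scale[OF pow_linear] linear_map_scale[OF phi_linear])

lemma centralising_closed:
  "centralising 0" "centralising f \<Longrightarrow> centralising g \<Longrightarrow> centralising (f + g)"
  "centralising f \<Longrightarrow> centralising (endo_scale scale c f)"
  unfolding centralising_def Vector_Spaces.linear_iff endo_scale_def
  using vector_space_axioms linear_map_zero[OF e_linear]
  by (auto simp: linear_map_add[OF e_linear] linear_map_scale[OF e_linear] scale_right_distrib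
      scale_left_commute ac_simps)

text \<open>A diagonal functional with pairwise distinct weights, where 0 is given to a block of the
  smallest size, needs only \<open>k\<close> field elements. Its stabiliser has only diagonal
  coordinates, and their number is the sum of the block sizes.\<close>

theorem general_linear_upper_bound:
  assumes K: "infinite (UNIV :: 'k set) \<or> k \<le> card (UNIV :: 'k set)"
  shows "\<exists>alpha. (\<forall>f g. alpha (f + g) = alpha f + alpha g) \<and>
    (\<forall>c f. alpha (endo_scale scale c f) = c * alpha f) \<and>
    vector_space.dim (endo_scale scale) (stabiliser_in centralising alpha) \<le> dim UNIV"
proof -
  interpret E: vector_space "endo_scale scale" by (rule vector_space_endo[OF vector_space_axioms])
  obtain a :: "nat \<Rightarrow> 'k" where a: "\<And>i j. \<lbrakk>i < k; j < k; i \<noteq> j\<rbrakk> \<Longrightarrow> a i \<noteq> a j"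
    "\<And>i j. \<lbrakk>i < k; j < k; n i < n j\<rbrakk> \<Longrightarrow> a j \<noteq> 0"
  proof (cases "k = 0")
    case True
    then show ?thesis using that[of "\<lambda>_. 0"] by simp
  next
    case False
    obtain m where m: "m < k" "\<And>i. i < k \<Longrightarrow> n m \<le> n i"
      using ex_has_least_nat[of "\<lambda>i. i < k" 0 n] False by auto
    have "card ({..<k} - {m}) = k - 1" using m(1) by simp
    moreover have "card (UNIV - {0 :: 'k}) = card (UNIV :: 'k set) - 1 \<or> infinite (UNIV :: 'k set)"
      by (cases "finite (UNIV :: 'k set)") (simp_all add: card_Diff_singleton)
    ultimately have "infinite (UNIV - {0 :: 'k}) \<or> card ({..<k} - {m}) \<le> card (UNIV - {0 :: 'k})"
      using K by auto
    then obtain f where f: "inj_on f ({..<k} - {m})" "f ` ({..<k} - {m}) \<subseteq> UNIV - {0 :: 'k}"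
      using exists_injection[of "{..<k} - {m}" "UNIV - {0 :: 'k}"] by auto
    have nz: "f i \<noteq> 0" if "i < k" "i \<noteq> m" for i using f(2) that by auto
    show ?thesis
    proof (rule that[of "f(m := 0)"])
      fix i j assume ij: "i < k" "j < k" "i \<noteq> j"
      then show "(f(m := 0)) i \<noteq> (f(m := 0)) j"
        using nz[of i] nz[of j] inj_onD[OF f(1), of i j] by auto
    next
      fix i j assume ij: "i < k" "j < k" "n i < n j"
      then have "j \<noteq> m" using m(2)[of i] by auto
      then show "(f(m := 0)) j \<noteq> 0" using nz[OF ij(2)] by simp
    qed
  qed
  define alpha where "alpha = level_functional (\<lambda>i j. if i = j then a i else 0) (\<lambda>_. 0)"
  let ?F = "{(i, i, t) | i t. i \<in> {..<k} \<and> t < n i}"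
  have "E.dim (stabiliser_in centralising alpha) \<le> card ?F"
  proof (rule E.dim_le_coordinates[where f = "\<lambda>(m, j, r) f. coord f m j r"])
    show "E.subspace (stabiliser_in centralising alpha)"
      by (rule subspace_stabiliser_in[OF vector_space_axioms])
        (use centralising_closed level_functional_add level_functional_scale in
          \<open>auto simp: centralising_def alpha_def\<close>)
    show "finite ?F" by (rule finite_triples) simp
    fix f assume f: "f \<in> stabiliser_in centralising alpha"
      and z: "\<And>p. p \<in> ?F \<Longrightarrow> (case p of (m, j, r) \<Rightarrow> \<lambda>f. coord f m j r) f = 0"
    have cf: "centralising f" using f by (simp add: stabiliser_in_def)
    interpret stabiliser_coordinates k n "\<lambda>i j. if i = j then a i else 0" "\<lambda>_. 0" "coord f"
      by (rule stabiliser_coordinates[OF cf])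
        (use f in \<open>auto simp: stabiliser_in_def alpha_def\<close>)
    show "f = 0"
    proof (rule coord_zero[OF cf])
      fix m j r assume mj: "m < k" "j < k"
      show "coord f m j r = 0"
      proof (cases "m = j")
        case True
        show ?thesis
        proof (cases "r < n j")
          case lt: True
          then show ?thesis using z[of "(j, j, r)"] mj True by auto
        next
          case False
          then show ?thesis using coord_range[OF cf mj] by simp
        qed
      next
        case False
        then show ?thesis using a mj by (intro off_diagonal_zero) auto
      qed
    qed
  qed (auto simp: coord_add coord_scale)
  also have "\<dots> \<le> sum n {..<k}" by (rule card_triples_le) simp
  also have "\<dots> = dim UNIV" by (rule dim_UNIV[symmetric])
  finally show ?thesis
    using level_functional_add level_functional_scale unfolding alpha_def by blast
qed

end

section \<open>Upper bounds for the symplectic and the orthogonal algebra\<close>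

context skew_nilpotent
begin

lemma eq_neg_zero: "(x :: 'k) = - x \<Longrightarrow> x = 0"
proof -
  assume "x = - x"
  then have "x + x = 0" by (simp add: eq_neg_iff_add_eq_0)
  then have "2 * x = 0" by (simp only: mult_2)
  then show "x = 0" using two by simp
qed

lemma in_algebra_closed:
  "in_algebra 0" "in_algebra f \<Longrightarrow> in_algebra g \<Longrightarrow> in_algebra (f + g)"
  "in_algebra f \<Longrightarrow> in_algebra (endo_scale scale c f)"
proof -
  show "in_algebra 0"
    unfolding in_algebra_def Vector_Spaces.linear_iff
    using vector_space_axioms linear_map_zero[OF e_linear] by (simp add: B_zero_left B_zero_right)
  show "in_algebra (f + g)" if f: "in_algebra f" and g: "in_algebra g"
    unfolding in_algebra_def Vector_Spaces.linear_iff
  proof (intro conjI allI vector_space_axioms)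
    have lin: "Vector_Spaces.linear scale scale f" "Vector_Spaces.linear scale scale g"
      using f g unfolding in_algebra_def by auto
    show "(f + g) (x + y) = (f + g) x + (f + g) y" for x y
      by (simp add: linear_map_add[OF lin(1)] linear_map_add[OF lin(2)])
    show "(f + g) (c *s x) = c *s (f + g) x" for c x
      by (simp add: linear_map_scale[OF lin(1)] linear_map_scale[OF lin(2)] scale_right_distrib)
    show "B ((f + g) x) y + B x ((f + g) y) = 0" for x y
    proof -
      have "B (f x) y + B x (f y) = 0" "B (g x) y + B x (g y) = 0"
        using f g unfolding in_algebra_def by auto
      then have "(B (f x) y + B x (f y)) + (B (g x) y + B x (g y)) = 0" by (simp only: add_0_left)
      then show ?thesis by (simp add: B_add_left B_add_right ac_simps)
    qed
    show "(f + g) (e v) = e ((f + g) v)" for v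
      using f g unfolding in_algebra_def by (simp add: linear_map_add[OF e_linear])
  qed
  show "in_algebra (endo_scale scale c f)" if f: "in_algebra f"
    unfolding in_algebra_def Vector_Spaces.linear_iff endo_scale_def
  proof (intro conjI allI vector_space_axioms)
    have lin: "Vector_Spaces.linear scale scale f"
      using f unfolding in_algebra_def by auto
    show "c *s f (x + y) = c *s f x + c *s f y" for x y
      by (simp add: linear_map_add[OF lin] scale_right_distrib)
    show "c *s f (d *s x) = d *s (c *s f x)" for d x
      by (simp add: linear_map_scale[OF lin] mult.commute)
    show "B (c *s f x) y + B x (c *s f y) = 0" for x y
    proof -
      have "c * (B (f x) y + B x (f y)) = 0" using f unfolding in_algebra_def by simp
      then show ?thesis by (simp only: B_scale_left B_scale_right distrib_left)
    qed
    show "c *s f (e v) = e (c *s f v)" for v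
      using f unfolding in_algebra_def by (simp add: linear_map_scale[OF e_linear])
  qed
qed

context
  fixes k n w pr kap
  assumes g: "gram_on UNIV k n w pr kap"
begin

interpretation js: jordan_system scale e k n w "\<lambda>i v. B v (w (pr i)) / kap i"
  by (rule gram_jordan_system[OF g])

lemma form_upper_bound_criterion:
  assumes X: "\<And>i j. \<lbrakk>i < k; j < k\<rbrakk> \<Longrightarrow> X i j * kap (pr i) = - (eps * X (pr j) (pr i) * kap j)"
    and Y: "\<And>i. i < k \<Longrightarrow> Y i * kap (pr i) = eps * Y (pr i) * kap i"
    and F: "finite F" "\<And>m j r. (m, j, r) \<in> F \<Longrightarrow> j < k" "card F \<le> N"
    and zero: "\<And>f m j r. \<lbrakk>in_algebra f; stabiliser_coordinates k n X Y (js.coord f);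
        \<And>m j r. (m, j, r) \<in> F \<Longrightarrow> js.coord f m j r = 0; m < k; j < k\<rbrakk> \<Longrightarrow> js.coord f m j r = 0"
  shows "\<exists>alpha. (\<forall>f g. alpha (f + g) = alpha f + alpha g) \<and>
    (\<forall>c f. alpha (endo_scale scale c f) = c * alpha f) \<and>
    vector_space.dim (endo_scale scale) (stabiliser_in in_algebra alpha) \<le> N"
proof -
  interpret E: vector_space "endo_scale scale" by (rule vector_space_endo[OF vector_space_axioms])
  define alpha where "alpha = js.level_functional X Y"
  have "E.dim (stabiliser_in in_algebra alpha) \<le> card F"
  proof (rule E.dim_le_coordinates[where f = "\<lambda>(m, j, r) f. js.coord f m j r"])
    show "E.subspace (stabiliser_in in_algebra alpha)"
      by (rule subspace_stabiliser_in[OF vector_space_axioms])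
        (use in_algebra_closed js.level_functional_add js.level_functional_scale in
          \<open>auto simp: in_algebra_def alpha_def\<close>)
    fix f assume f: "f \<in> stabiliser_in in_algebra alpha"
      and z: "\<And>p. p \<in> F \<Longrightarrow> (case p of (m, j, r) \<Rightarrow> \<lambda>f. js.coord f m j r) f = 0"
    have cf: "in_algebra f" using f by (simp add: stabiliser_in_def)
    have sc: "stabiliser_coordinates k n X Y (js.coord f)"
      by (rule form_stabiliser_coordinates[OF g X Y cf])
        (use f in \<open>auto simp: stabiliser_in_def alpha_def\<close>)
    show "f = 0"
    proof (rule js.coord_zero)
      show "js.centralising f" using cf unfolding in_algebra_def js.centralising_def by blast
      fix m j r assume mj: "m < k" "j < k"
      show "js.coord f m j r = 0"
        by (rule zero[OF cf sc _ mj]) (use z in force)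
    qed
  qed (use F in \<open>auto simp: js.coord_add js.coord_scale\<close>)
  then have "E.dim (stabiliser_in in_algebra alpha) \<le> N" using F(3) by linarith
  then show ?thesis
    using js.level_functional_add js.level_functional_scale unfolding alpha_def by blast
qed

text \<open>Self-dual blocks have even size and arbitrary distinct weights; dual pairs have odd size
  and opposite weights, kept apart by distinct squares. So any two blocks of equal size have
  different weights. On a self-dual block skewness kills the diagonal coordinates at odd levels,
  which are half of them; of a dual pair one member suffices.\<close>

lemma symplectic_upper_bound:
  assumes eps: "eps = - 1" and K: "infinite (UNIV :: 'k set) \<or> k \<le> card (UNIV :: 'k set)"
  shows "\<exists>alpha. (\<forall>f g. alpha (f + g) = alpha f + alpha g) \<and>
    (\<forall>c f. alpha (endo_scale scale c f) = c * alpha f) \<and>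
    vector_space.dim (endo_scale scale) (stabiliser_in in_algebra alpha) \<le> dim UNIV div 2"
proof -
  note G = gram_onD[OF g]
  define S where "S = {i. i < k \<and> pr i = i}"
  define Q where "Q = {i. i < k \<and> pr i < i}"
  have fin: "finite S" "finite Q" by (auto simp: S_def Q_def)
  have sums: "sum n {..<k} = sum n S + 2 * sum n Q"
  proof -
    have eq: "S = {i\<in>{..<k}. pr i = i}" "Q = {i\<in>{..<k}. pr i < i}" by (auto simp: S_def Q_def)
    have "sum n {..<k} = sum n S + (\<Sum>i\<in>Q. n i + n (pr i))"
      unfolding eq by (rule involution_sum) (use G(4,5) in auto)
    also have "(\<Sum>i\<in>Q. n i + n (pr i)) = (\<Sum>i\<in>Q. 2 * n i)"
      by (intro sum.cong) (auto simp: Q_def G(6))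
    finally show ?thesis by (simp add: sum_distrib_left)
  qed
  have cards: "k = card S + 2 * card Q"
  proof -
    have eq: "S = {i\<in>{..<k}. pr i = i}" "Q = {i\<in>{..<k}. pr i < i}" by (auto simp: S_def Q_def)
    have "(\<Sum>i<k. 1) = (\<Sum>i\<in>S. 1) + (\<Sum>i\<in>Q. 1 + (1::nat))"
      unfolding eq by (rule involution_sum) (use G(4,5) in auto)
    then show ?thesis by simp
  qed
  have even: "even (n i)" if "i \<in> S" for i
  proof -
    have "- ((- 1) ^ (n i - 1)) = (1 :: 'k)" using G(8)[of i] that eps by (auto simp: S_def)
    then have "odd (n i - 1)" using two by (cases "even (n i - 1)") (auto simp: minus_equation_iff eq_neg_iff_add_eq_0)
    then show ?thesis using G(1)[of i] that by (auto simp: S_def)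
  qed
  have kap_S: "kap (pr i) = kap i" if "i \<in> S" for i using that by (simp add: S_def)
  have kap_Q: "kap (pr i) = - kap i" if "i < k" "i \<notin> S" for i
  proof -
    have "eps * (- 1) ^ (n i - 1) \<noteq> 1" using G(8)[OF that(1)] that by (simp add: S_def)
    then have "eps * (- 1) ^ (n i - 1) = - 1" using eps_sign[of "n i - 1"] by blast
    then show ?thesis using kap_pr[OF g that(1)] by simp
  qed
  have "infinite (UNIV :: 'k set) \<or> 2 * card Q \<le> card (UNIV :: 'k set)" using K cards by linarith
  then have "\<exists>T :: nat \<Rightarrow> 'k. (\<forall>i\<in>Q. T i \<noteq> 0) \<and> inj_on (\<lambda>i. T i * T i) Q"
    using exists_square_values[OF fin(2), of "\<lambda>_. 1 :: 'k"] by simp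
  then obtain T :: "nat \<Rightarrow> 'k" where T: "\<And>i. i \<in> Q \<Longrightarrow> T i \<noteq> 0" "inj_on (\<lambda>i. T i * T i) Q"
    by blast
  have "card (S - {0}) \<le> k - 1"
    using card_mono[of "{..<k} - {0}" "S - {0}"] by (cases "k = 0") (auto simp: S_def)
  moreover have "card (UNIV - {0 :: 'k}) = card (UNIV :: 'k set) - 1 \<or> infinite (UNIV :: 'k set)"
    by (cases "finite (UNIV :: 'k set)") (simp_all add: card_Diff_singleton)
  ultimately have "infinite (UNIV - {0 :: 'k}) \<or> card (S - {0}) \<le> card (UNIV - {0 :: 'k})"
    using K by auto
  then obtain u where u: "inj_on u (S - {0})" "u ` (S - {0}) \<subseteq> UNIV - {0 :: 'k}"
    using exists_injection[of "S - {0}" "UNIV - {0 :: 'k}"] fin by auto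
  \<comment> \<open>Index 0 belongs to a block of the smallest size, the only place where the weight
    0 is used.\<close>
  define a where "a = (\<lambda>i. if i \<in> S then (if i = 0 then 0 else u i) else if i \<in> Q then T i else - T (pr i))"
  have prS: "pr i \<in> S \<longleftrightarrow> i \<in> S" "i \<notin> S \<Longrightarrow> pr i \<in> Q \<longleftrightarrow> i \<notin> Q" if "i < k" for i
    using that G(4,5)[OF that] by (auto simp: S_def Q_def)
  have a_pr: "a (pr i) = (if i \<in> S then a i else - a i)" if "i < k" for i
    using prS[OF that] G(5)[OF that] by (auto simp: a_def) (simp_all add: S_def)
  define X where "X = (\<lambda>i j. if i = j then a i else 0)"
  define Y where "Y = (\<lambda>_::nat. 0 :: 'k)"
  have a_nz: "a i \<noteq> 0" if "i < k" "i \<notin> S" for i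
    using T(1)[of i] T(1)[of "pr i"] prS(2)[OF that] that by (auto simp: a_def)
  have a_eq: "a i \<noteq> a j" if ij: "i < k" "j < k" "i \<noteq> j" "n i = n j" for i j
  proof (cases "i \<in> S")
    case True
    have "eps * (- 1) ^ (n j - 1) = 1" using G(8)[OF ij(1)] True ij(4) by (simp add: S_def)
    then have j: "j \<in> S" using G(8)[OF ij(2)] ij(2) by (simp add: S_def)
    show ?thesis using True j ij(3) inj_onD[OF u(1), of i j] u(2) by (auto simp: a_def)
  next
    case False
    have "eps * (- 1) ^ (n i - 1) \<noteq> 1" using G(8)[OF ij(1)] False ij(1) by (simp add: S_def)
    then have j: "j \<notin> S" using G(8)[OF ij(2)] ij(4) by (simp add: S_def)
    let ?r = "\<lambda>i. if i \<in> Q then i else pr i"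
    have r: "?r i \<in> Q" "?r j \<in> Q" using prS(2)[OF ij(1) False] prS(2)[OF ij(2) j] by auto
    have sq: "a i * a i = T (?r i) * T (?r i)" "a j * a j = T (?r j) * T (?r j)"
      using False j by (auto simp: a_def)
    show ?thesis
    proof
      assume eq: "a i = a j"
      then have "?r i = ?r j" using inj_onD[OF T(2), of "?r i" "?r j"] sq r by simp
      then have "i = j \<or> i = pr j \<or> pr i = j \<or> pr i = pr j" by metis
      then have "j = pr i \<or> j = i" using G(5)[OF ij(1)] G(5)[OF ij(2)] by metis
      then have "a i = - a i" using a_pr[OF ij(1)] False eq ij(3) by auto
      then have "a i = 0" by (rule eq_neg_zero)
      then show False using a_nz[OF ij(1) False] by simp
    qed
  qed
  have a_big: "a j \<noteq> 0" if ij: "i < k" "j < k" "n i < n j" for i j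
  proof (cases "j \<in> S")
    case True
    have "n 0 \<le> n i" using G(10)[of 0 i] ij(1) by simp
    then have "j \<noteq> 0" using ij(3) by (metis not_le)
    then show ?thesis using True u(2) by (auto simp: a_def)
  qed (use a_nz ij in blast)
  let ?F1 = "{(i, i, 2 * t) | i t. i \<in> S \<and> t < n i div 2}"
  let ?F2 = "{(i, i, t) | i t. i \<in> Q \<and> t < n i}"
  have "card (?F1 \<union> ?F2) \<le> card ?F1 + card ?F2" by (rule card_Un_le)
  also have "\<dots> \<le> (\<Sum>i\<in>S. n i div 2) + sum n Q"
    by (intro add_mono card_triples_le fin)
  also have "\<dots> = dim UNIV div 2"
  proof -
    have "2 * (\<Sum>i\<in>S. n i div 2) = sum n S" using even by (simp add: sum_distrib_left)
    then show ?thesis using sums js.dim_UNIV by simp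
  qed
  finally have cardF: "card (?F1 \<union> ?F2) \<le> dim UNIV div 2" .
  show ?thesis
  proof (rule form_upper_bound_criterion[of X Y])
    show "X i j * kap (pr i) = - (eps * X (pr j) (pr i) * kap j)" if "i < k" "j < k" for i j
    proof (cases "i = j")
      case True
      then show ?thesis using a_pr[OF that(1)] kap_S[of i] kap_Q[OF that(1)] eps by (auto simp: X_def)
    next
      case False
      then have "pr j \<noteq> pr i" using G(5) that by metis
      then show ?thesis using False by (simp add: X_def)
    qed
    show "finite (?F1 \<union> ?F2)" by (intro finite_UnI finite_triples fin)
    show "card (?F1 \<union> ?F2) \<le> dim UNIV div 2" by fact
    show "j < k" if "(m, j, r) \<in> ?F1 \<union> ?F2" for m j r using that by (auto simp: S_def Q_def)
    fix f m j r
    assume f: "in_algebra f" and sc: "stabiliser_coordinates k n X Y (js.coord f)"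
      and z: "\<And>m j r. (m, j, r) \<in> ?F1 \<union> ?F2 \<Longrightarrow> js.coord f m j r = 0" and mj: "m < k" "j < k"
    interpret stabiliser_coordinates k n X Y "js.coord f" by (rule sc)
    show "js.coord f m j r = 0"
    proof (cases "m = j")
      case False
      then show ?thesis using a_eq a_big mj by (intro off_diagonal_zero) (auto simp: X_def Y_def)
    next
      case True
      show ?thesis
      proof (cases "r < n j")
        case lt: True
        consider "j \<in> S" "even r" | "j \<in> S" "odd r" | "j \<in> Q" | "pr j \<in> Q" "j \<notin> S"
          using prS(2)[OF mj(2)] by blast
        then show ?thesis
        proof cases
          case 1
          then obtain t where t: "r = 2 * t" by blast
          then have "t < n j div 2" using lt even[OF 1(1)] by presburger
          then show ?thesis using z[of j j r] 1 t True by blast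
        next
          case 2
          have "kap j * js.coord f j j r = - (kap j * js.coord f j j r)"
            using coord_skew[OF g f mj(2) mj(2), of r] 2 eps by (simp add: S_def)
          then have "kap j * js.coord f j j r = 0" by (rule eq_neg_zero)
          then show ?thesis using G(7)[OF mj(2)] True by simp
        next
          case 3
          then show ?thesis using z[of j j r] lt True by blast
        next
          case 4
          have "js.coord f (pr j) (pr j) r = 0" using z[of "pr j" "pr j" r] 4 lt G(6)[OF mj(2)] by auto
          then show ?thesis
            using coord_skew[OF g f mj(2) mj(2), of r] G(7)[OF mj(2)] True by simp
        qed
      next
        case F: False
        then show ?thesis using range[OF mj] by simp
      qed
    qed
  qed (simp add: Y_def)
qed

end

end

context skew_nilpotent
begin

context
  fixes k n w pr kap
  assumes g: "gram_on UNIV k n w pr kap"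
begin

interpretation js: jordan_system scale e k n w "\<lambda>i v. B v (w (pr i)) / kap i"
  by (rule gram_jordan_system[OF g])

text \<open>For \<open>eps\<close> = 1 skewness leaves no diagonal weight on the self-dual blocks,
  which have odd size; they are weighted at the positions (i, st i) instead. The proof supplies the
  data of \<open>orthogonal_coordinates\<close> and counts the parameters.\<close>

lemma orthogonal_upper_bound:
  assumes eps: "eps = 1" and K: "infinite (UNIV :: 'k set) \<or> k \<le> card (UNIV :: 'k set)"
  shows "\<exists>alpha. (\<forall>f g. alpha (f + g) = alpha f + alpha g) \<and>
    (\<forall>c f. alpha (endo_scale scale c f) = c * alpha f) \<and>
    vector_space.dim (endo_scale scale) (stabiliser_in in_algebra alpha) \<le> dim UNIV div 2"
proof -
  note G = gram_onD[OF g]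
  define S where "S = {i. i < k \<and> pr i = i}"
  define Q where "Q = {i. i < k \<and> pr i < i}"
  have SD: "i < k" "pr i = i" if "i \<in> S" for i using that by (auto simp: S_def)
  have QD: "p < k" "pr p < k" "pr (pr p) = p" "pr p \<noteq> p" "n (pr p) = n p" "p \<notin> S" "pr p \<notin> S" "pr p \<notin> Q" if "p \<in> Q" for p
    using that G(4,5,6)[of p] by (auto simp: S_def Q_def)
  have fin: "finite S" "finite Q" by (auto simp: S_def Q_def)
  have eqs: "S = {i\<in>{..<k}. pr i = i}" "Q = {i\<in>{..<k}. pr i < i}" by (auto simp: S_def Q_def)
  have inv: "\<And>i. i \<in> {..<k} \<Longrightarrow> pr i \<in> {..<k} \<and> pr (pr i) = i" using G(4,5) by auto
  have sums: "sum n {..<k} = sum n S + 2 * sum n Q"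
  proof -
    have "sum n {..<k} = sum n S + (\<Sum>i\<in>Q. n i + n (pr i))"
      unfolding eqs by (rule involution_sum[OF _ inv]) simp
    also have "(\<Sum>i\<in>Q. n i + n (pr i)) = (\<Sum>i\<in>Q. 2 * n i)"
      by (intro sum.cong) (auto simp: QD(5))
    finally show ?thesis by (simp add: sum_distrib_left)
  qed
  have cards: "k = card S + 2 * card Q"
  proof -
    have "(\<Sum>i<k. 1) = (\<Sum>i\<in>S. 1) + (\<Sum>i\<in>Q. 1 + (1::nat))"
      unfolding eqs by (rule involution_sum[OF _ inv]) simp
    then show ?thesis by simp
  qed
  have parity: "odd (n i) \<longleftrightarrow> i \<in> S" if "i < k" for i
  proof -
    have "pr i = i \<longleftrightarrow> (- 1) ^ (n i - 1) = (1 :: 'k)" using G(8)[OF that] eps by simp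
    moreover have "(- 1 :: 'k) \<noteq> 1"
    proof
      assume "(- 1 :: 'k) = 1"
      then have "(1 :: 'k) = 0" by (rule eq_neg_zero[OF sym])
      then show False by simp
    qed
    ultimately have "pr i = i \<longleftrightarrow> even (n i - 1)" by (cases "even (n i - 1)") auto
    then show ?thesis using G(1)[OF that] that by (auto simp: S_def)
  qed
  have kap_Q: "kap (pr i) = - kap i" if "i < k" "i \<notin> S" for i
  proof -
    have "eps * (- 1) ^ (n i - 1) \<noteq> 1" using G(8)[OF that(1)] that by (simp add: S_def)
    then have "eps * (- 1) ^ (n i - 1) = - 1" using eps_sign[of "n i - 1"] by blast
    then show ?thesis using kap_pr[OF g that(1)] by simp
  qed
  have kap_nz: "kap i \<noteq> 0" if "i < k" for i using G(7)[OF that] .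
  obtain st where st: "\<And>i. i \<in> S \<Longrightarrow> st i \<in> S \<and> st (st i) = i"
    and nested: "\<And>i j. \<lbrakk>i \<in> S; j \<in> S; st i \<noteq> i; st j \<noteq> j; j \<noteq> i; j \<noteq> st i\<rbrakk> \<Longrightarrow>
      max (n j) (n (st j)) \<le> min (n i) (n (st i)) \<or> max (n i) (n (st i)) \<le> min (n j) (n (st j))"
    and unmatched: "\<And>i j. \<lbrakk>i \<in> S; j \<in> S; st j = j; i \<noteq> j\<rbrakk> \<Longrightarrow> st i \<noteq> i \<and> n j \<le> n i"
    and gap: "\<And>p. (\<forall>m\<in>S. n m \<noteq> p) \<Longrightarrow>
      (\<forall>m\<in>S. p < n m \<longrightarrow> st m \<noteq> m \<and> p < n (st m)) \<or>
      (\<exists>u\<in>S. p < n u \<and> (st u = u \<or> n (st u) < p) \<and>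
        (\<forall>m\<in>S. p < n m \<longrightarrow> m \<noteq> u \<longrightarrow> st m \<noteq> m \<and> p < n (st m)))"
  proof -
    have mono: "\<And>i j. \<lbrakk>i \<in> S; j \<in> S; i \<le> j\<rbrakk> \<Longrightarrow> n i \<le> n j" using G(10) SD(1) by blast
    show ?thesis
      by (rule exE[OF exists_matching[of S n, OF fin(1) mono]], assumption, assumption, assumption,
          (erule conjE)+, rule that, erule (1) bspec) blast+
  qed
  \<comment> \<open>A pair \<open>p\<close> is linked if some larger block in \<open>S\<close> has
    no partner that is larger than \<open>p\<close> too; by \<open>gap\<close> there is then exactly
    one such block, which becomes \<open>mu p\<close>.\<close>
  define lk where "lk = (\<lambda>p. \<not> (\<forall>m\<in>S. n p < n m \<longrightarrow> st m \<noteq> m \<and> n p < n (st m)))"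
  define good where "good = (\<lambda>p u. u \<in> S \<and> n p < n u \<and> (st u = u \<or> n (st u) < n p) \<and>
        (\<forall>m\<in>S. n p < n m \<longrightarrow> m \<noteq> u \<longrightarrow> st m \<noteq> m \<and> n p < n (st m)))"
  define mu where "mu = (\<lambda>p. SOME u. good p u)"
  have mu: "good p (mu p)" if "p \<in> Q" "lk p" for p
  proof -
    have "n m \<noteq> n p" if "m \<in> S" for m
      using parity[OF SD(1)[OF that]] parity[OF QD(1)[OF \<open>p \<in> Q\<close>]] that QD(6)[OF \<open>p \<in> Q\<close>] by metis
    then have "\<exists>u. good p u" using gap[of "n p"] that(2) unfolding lk_def good_def by blast
    then show ?thesis unfolding mu_def by (rule someI_ex)
  qed
  have muS: "mu p \<in> S" if "p \<in> Q" "lk p" for p using mu[OF that] unfolding good_def by blast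
  define I where "I = {i\<in>S. st i < i}"
  have finI: "finite I" using fin by (simp add: I_def)
  have S_sum: "sum f S = sum f {i\<in>S. st i = i} + (\<Sum>i\<in>I. f i + f (st i))" for f :: "nat \<Rightarrow> nat"
    unfolding I_def by (rule involution_sum[OF fin(1) st])
  have "2 * card I \<le> k" using S_sum[of "\<lambda>_. 1"] cards by simp
  then have "infinite (UNIV :: 'k set) \<or> 2 * card I \<le> card (UNIV :: 'k set)" using K by linarith
  moreover have "- (kap i * kap (st i)) \<noteq> 0" if "i \<in> I" for i
    using kap_nz SD(1) st that by (auto simp: I_def)
  ultimately have "\<exists>T :: nat \<Rightarrow> 'k. (\<forall>i\<in>I. T i \<noteq> 0) \<and> inj_on (\<lambda>i. - (kap i * kap (st i)) * (T i * T i)) I"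
    by (intro exists_square_values finI)
  then obtain T :: "nat \<Rightarrow> 'k" where T: "\<And>i. i \<in> I \<Longrightarrow> T i \<noteq> 0"
    "inj_on (\<lambda>i. - (kap i * kap (st i)) * (T i * T i)) I" by blast
  \<comment> \<open>\<open>T\<close> made antisymmetric under \<open>st\<close>, as the skewness of
    \<open>X\<close> at the positions (i, st i) and (st i, i) demands.\<close>
  define T' where "T' = (\<lambda>i. if st i < i then T i else - T (st i))"
  have T'_st: "T' (st i) = - T' i" if "i \<in> S" "st i \<noteq> i" for i
    using st[OF that(1)] that(2) by (auto simp: T'_def)
  have T'_nz: "T' i \<noteq> 0" if "i \<in> S" "st i \<noteq> i" for i
    using st[OF that(1)] that T(1)[of i] T(1)[of "st i"] by (auto simp: T'_def I_def)
  have T'_sq: "- (kap i * kap (st i)) * (T' i * T' i) =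
      - (kap (max i (st i)) * kap (st (max i (st i)))) * (T (max i (st i)) * T (max i (st i)))"
    if "i \<in> S" "st i \<noteq> i" for i
    using st[OF that(1)] that by (cases "st i < i") (auto simp: T'_def max_def mult_ac)
  have "card Q \<le> k - 1" using cards by (cases "card Q = 0") auto
  moreover have "card (UNIV - {0 :: 'k}) = card (UNIV :: 'k set) - 1 \<or> infinite (UNIV :: 'k set)"
    by (cases "finite (UNIV :: 'k set)") (simp_all add: card_Diff_singleton)
  ultimately have "infinite (UNIV - {0 :: 'k}) \<or> card Q \<le> card (UNIV - {0 :: 'k})"
    using K by auto
  then obtain a where a: "inj_on a Q" "a ` Q \<subseteq> UNIV - {0 :: 'k}"
    using exists_injection[of Q "UNIV - {0 :: 'k}"] fin by auto
  define q where "q = (\<lambda>i. if i \<in> Q then i else pr i)"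
  have q: "q i \<in> Q" "q (pr i) = q i" if "i < k" "i \<notin> S" for i
    using that G(4,5)[OF that(1)] by (auto simp: q_def Q_def S_def)
  \<comment> \<open>Inside \<open>S\<close> only matched positions carry weights; outside,
    \<open>p\<close> and \<open>pr p\<close> share one. Skewness makes links come in twos: position
    (p, mu p) together with (mu p, pr p).\<close>
  define X where "X = (\<lambda>i j. if i \<in> S then
      (if j \<in> S then (if j = st i \<and> j \<noteq> i then kap j * T' i else 0)
       else if pr j \<in> Q \<and> lk (pr j) \<and> i = mu (pr j) then kap j else 0)
    else if j = i then a (q i) else if i \<in> Q \<and> lk i \<and> j = mu i then - kap j else 0)"
  define Y where "Y = (\<lambda>i. if i \<in> S then 0 else kap i)"
  \<comment> \<open>For a linked pair the parameters move from the diagonal to the column entries at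
    \<open>mu p\<close>, in accordance with \<open>par_link\<close>.\<close>
  define src where "src = (\<lambda>p. if lk p then mu p else p)"
  define S' where "S' = {m\<in>S. st m \<le> m}"
  \<comment> \<open>A dual pair \<open>p\<close> contributes n p parameters. Two matched blocks
    contribute the odd levels on the diagonal of one and the even levels between them, together half
    the sum of their sizes; an unmatched block contributes half its size, rounded down.\<close>
  let ?F1 = "{(src p, p, t) | p t. p \<in> Q \<and> t < n p}"
  let ?F2 = "{(m, m, Suc (2 * t)) | m t. m \<in> S' \<and> t < n m div 2}"
  let ?F3 = "{(m, st m, 2 * t) | m t. m \<in> I \<and> t < Suc (n (st m)) div 2}"
  have finS': "finite S'" using fin by (simp add: S'_def)
  have "card (?F1 \<union> (?F2 \<union> ?F3)) \<le> card ?F1 + card (?F2 \<union> ?F3)" by (rule card_Un_le)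
  also have "\<dots> \<le> card ?F1 + (card ?F2 + card ?F3)" using card_Un_le[of ?F2 ?F3] by simp
  also have "\<dots> \<le> sum n Q + ((\<Sum>m\<in>S'. n m div 2) + (\<Sum>m\<in>I. Suc (n (st m)) div 2))"
    by (intro add_mono card_triples_le fin finS' finI)
  also have "\<dots> \<le> dim UNIV div 2"
  proof -
    have odd: "odd (n i)" if "i \<in> S" for i using parity that SD(1) by blast
    have S': "S' = {i\<in>S. st i = i} \<union> I" by (auto simp: S'_def I_def)
    have "(\<Sum>m\<in>S'. n m div 2) = (\<Sum>m\<in>{i\<in>S. st i = i}. n m div 2) + (\<Sum>m\<in>I. n m div 2)"
      unfolding S' using fin finI by (intro sum.union_disjoint) (auto simp: I_def)
    moreover have "2 * (\<Sum>m\<in>{i\<in>S. st i = i}. n m div 2) \<le> (\<Sum>m\<in>{i\<in>S. st i = i}. n m)"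
      unfolding sum_distrib_left by (intro sum_mono) simp
    moreover have "2 * (\<Sum>m\<in>I. n m div 2) + 2 * (\<Sum>m\<in>I. Suc (n (st m)) div 2) = (\<Sum>i\<in>I. n i + n (st i))"
      unfolding sum_distrib_left sum.distrib[symmetric]
    proof (intro sum.cong refl)
      fix m assume "m \<in> I"
      then have "odd (n m)" "odd (n (st m))" using odd st by (auto simp: I_def)
      then show "2 * (n m div 2) + 2 * (Suc (n (st m)) div 2) = n m + n (st m)" by presburger
    qed
    ultimately have "2 * (sum n Q + ((\<Sum>m\<in>S'. n m div 2) + (\<Sum>m\<in>I. Suc (n (st m)) div 2))) \<le> sum n {..<k}"
      unfolding sums S_sum[of n] by simp
    moreover have "x \<le> y div 2" if "2 * x \<le> y" for x y :: nat using that by presburger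
    ultimately show ?thesis unfolding js.dim_UNIV by blast
  qed
  finally have cardF: "card (?F1 \<union> (?F2 \<union> ?F3)) \<le> dim UNIV div 2" .
  have X_diag: "X i i = a (q i)" if "i \<notin> S" for i using that by (simp add: X_def)
  have Xskew: "X i j * kap (pr i) = - (eps * X (pr j) (pr i) * kap j)" if ij: "i < k" "j < k" for i j
  proof -
    have prS: "pr i \<in> S \<longleftrightarrow> i \<in> S" "pr i \<in> S \<Longrightarrow> pr i = i" if "i < k" for i
      using that G(4,5)[OF that] by (auto simp: S_def)
    consider (SS) "i \<in> S" "j \<in> S" | (SN) "i \<in> S" "j \<notin> S" | (NS) "i \<notin> S" "j \<in> S" | (NN) "i \<notin> S" "j \<notin> S" by blast
    then show ?thesis
    proof cases
      case SS
      have e: "pr i = i" "pr j = j" using SS SD by auto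
      show ?thesis
      proof (cases "j = st i \<and> j \<noteq> i")
        case True
        then have "i = st j" "i \<noteq> j" "T' j = - T' i" using st[OF SS(1)] T'_st[OF SS(1)] by auto
        then show ?thesis using True SS e eps by (simp add: X_def)
      next
        case False
        then have F: "\<not> (i = st j \<and> i \<noteq> j)" using st[OF SS(2)] by auto
        have "X i j = 0" by (simp only: X_def SS if_True False if_False)
        moreover have "X j i = 0" by (simp only: X_def SS if_True F if_False)
        ultimately show ?thesis unfolding e by simp
      qed
    next
      case SN
      have e: "pr i = i" "pr j \<notin> S" "pr j \<noteq> i" using SN SD prS[OF ij(2)] by auto
      then show ?thesis using SN eps by (simp add: X_def)
    next
      case NS
      have e: "pr j = j" "pr i \<notin> S" "pr (pr i) = i" "i \<noteq> j" using NS SD prS[OF ij(1)] G(5)[OF ij(1)] by auto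
      then show ?thesis using NS eps kap_Q[OF ij(1)] by (simp add: X_def)
    next
      case NN
      have e: "pr j \<notin> S" "pr i \<notin> S" using NN prS[OF ij(1)] prS[OF ij(2)] by auto
      have ne: "\<not> (x \<in> Q \<and> lk x \<and> y = mu x)" if "y \<notin> S" for x y using muS that by blast
      show ?thesis
      proof (cases "j = i")
        case True
        then show ?thesis using NN e eps kap_Q[OF ij(1)] q(2)[OF ij(1)] by (simp add: X_def)
      next
        case False
        then have F: "pr i \<noteq> pr j" using G(5) ij by metis
        have "X i j = 0" by (simp only: X_def NN False ne[OF NN(2)] if_False)
        moreover have "X (pr j) (pr i) = 0" by (simp only: X_def e F ne[OF e(2)] if_False)
        ultimately show ?thesis by simp
      qed
    qed
  qed
  show ?thesis
  proof (rule form_upper_bound_criterion[OF g Xskew, of Y])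
    show "Y i * kap (pr i) = eps * Y (pr i) * kap i" if "i < k" for i
      using that eps G(4,5)[OF that] by (auto simp: Y_def S_def)
    show "finite (?F1 \<union> (?F2 \<union> ?F3))" by (intro finite_UnI finite_triples fin finS' finI)
    show "card (?F1 \<union> (?F2 \<union> ?F3)) \<le> dim UNIV div 2" by fact
    show "j < k" if "(m, j, r) \<in> ?F1 \<union> (?F2 \<union> ?F3)" for m j r
      using that QD(1) SD(1) st by (auto simp: S'_def I_def)
    fix f m j r
    assume f: "in_algebra f" and sc: "stabiliser_coordinates k n X Y (js.coord f)"
      and z: "\<And>m j r. (m, j, r) \<in> ?F1 \<union> (?F2 \<union> ?F3) \<Longrightarrow> js.coord f m j r = 0" and mj: "m < k" "j < k"
    let ?c = "js.coord f"
    interpret sc: stabiliser_coordinates k n X Y ?c by (rule sc)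
    note skew = coord_skew[OF g f, unfolded eps mult_1]
    have par1: "?c (src p) p r = 0" if "p \<in> Q" for p r
    proof (cases "r < n p")
      case True
      then show ?thesis using that by (intro z) blast
    next
      case False
      have "src p < k" using QD(1)[OF that] muS[OF that] SD(1) by (auto simp: src_def)
      then show ?thesis using sc.range QD(1)[OF that] False by simp
    qed
    have "orthogonal_coordinates k n X Y ?c pr st mu S Q lk"
    proof (rule orthogonal_coordinates.intro[OF sc], rule orthogonal_coordinates_axioms.intro)
      show "S = {i. i < k \<and> pr i = i}" by (rule S_def)
      show "Q \<subseteq> {..<k}" by (auto simp: Q_def)
      show "pr i < k \<and> pr (pr i) = i \<and> n (pr i) = n i" if "i < k" for i using G(4,5,6)[OF that] by blast
      show "i \<in> Q \<longleftrightarrow> pr i \<notin> Q" if "i < k" "pr i \<noteq> i" for i using that G(4,5)[OF that(1)] by (auto simp: Q_def)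
      show "pr p \<noteq> p" if "p \<in> Q" for p using QD(4)[OF that] .
      show "odd (n i) \<longleftrightarrow> i \<in> S" if "i < k" for i using parity[OF that] .
      show "st i \<in> S \<and> st (st i) = i" if "i \<in> S" for i using st[OF that] .
      show "(i \<in> S \<and> j = st i \<and> j \<noteq> i) \<or> (i \<notin> S \<and> j = i) \<or> (i \<in> Q \<and> lk i \<and> j = mu i) \<or>
          (\<exists>p\<in>Q. lk p \<and> i = mu p \<and> j = pr p)" if "i < k" "j < k" "X i j \<noteq> 0" for i j
        using that(3) G(5)[OF that(2)] unfolding X_def by (auto split: if_splits)
      show "X i (st i) \<noteq> 0" if "i \<in> S" "st i \<noteq> i" for i
        using that st[OF that(1)] T'_nz[OF that] kap_nz SD(1) by (simp add: X_def)
      show "X p p \<noteq> 0 \<and> X (pr p) (pr p) = X p p" if "p \<in> Q" for p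
        using that QD[OF that] a(2) q(2)[of p] by (auto simp: X_diag q_def)
      show "X p p \<noteq> X p' p'" if "p \<in> Q" "p' \<in> Q" "p \<noteq> p'" for p p'
        using that QD(6) inj_onD[OF a(1), of p p'] by (auto simp: X_diag q_def)
      show "X p (mu p) \<noteq> 0 \<and> X (mu p) (pr p) \<noteq> 0" if "p \<in> Q" "lk p" for p
        using that QD[OF that(1)] muS[OF that] kap_nz SD(1) by (auto simp: X_def)
      show "Y i = 0" if "i \<in> S" for i using that by (simp add: Y_def)
      show "Y (pr p) = - Y p \<and> Y p \<noteq> 0" if "p \<in> Q" for p
        using QD[OF that] kap_Q kap_nz by (simp add: Y_def)
      show "(2 :: 'k) \<noteq> 0" by (rule two)
      show "mu p \<in> S \<and> n p < n (mu p) \<and> (st (mu p) = mu p \<or> n (st (mu p)) < n p)" if "p \<in> Q" "lk p" for p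
        using mu[OF that] unfolding good_def by blast
      show "st m \<noteq> m \<and> n p < n (st m)" if "p \<in> Q" "m \<in> S" "n p < n m" "\<not> (lk p \<and> m = mu p)" for p m
      proof (cases "lk p")
        case True
        then show ?thesis using mu[OF that(1) True] that(2-4) unfolding good_def by blast
      next
        case False
        then show ?thesis using that(2,3) unfolding lk_def by blast
      qed
      show "max (n j) (n (st j)) \<le> min (n i) (n (st i)) \<or> max (n i) (n (st i)) \<le> min (n j) (n (st j))"
        if "i \<in> S" "j \<in> S" "st i \<noteq> i" "st j \<noteq> j" "j \<noteq> i" "j \<noteq> st i" for i j
        using nested[OF that] .
      show "X j (st j) * X (st j) j \<noteq> X i (st i) * X (st i) i"
        if ij: "i \<in> S" "j \<in> S" "st i \<noteq> i" "st j \<noteq> j" "j \<noteq> i" "j \<noteq> st i" for i j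
      proof -
        have val: "X i (st i) * X (st i) i = - (kap (max i (st i)) * kap (st (max i (st i)))) * (T (max i (st i)) * T (max i (st i)))"
          if "i \<in> S" "st i \<noteq> i" for i
          using st[OF that(1)] that T'_st[OF that] by (subst T'_sq[OF that, symmetric]) (simp add: X_def)
        have mI: "max i (st i) \<in> I" if "i \<in> S" "st i \<noteq> i" for i
          using st[OF that(1)] that by (auto simp: I_def max_def)
        have "max j (st j) \<noteq> max i (st i)"
        proof
          assume "max j (st j) = max i (st i)"
          then have "j = i \<or> j = st i \<or> st j = i \<or> st j = st i" unfolding max_def by metis
          then show False using st[OF ij(1)] st[OF ij(2)] ij(5,6) by metis
        qed
        then show ?thesis
          unfolding val[OF ij(1,3)] val[OF ij(2,4)]
          using inj_onD[OF T(2) _ mI[OF ij(2,4)] mI[OF ij(1,3)]] by blast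
      qed
      show "st i \<noteq> i \<and> n j \<le> n i" if "j \<in> S" "st j = j" "i \<in> S" "i \<noteq> j" for i j
        using unmatched[OF that(3,1,2,4)] .
      show "?c m j r = 0 \<longleftrightarrow> ?c (pr j) (pr m) r = 0" if "m < k" "j < k" for m j r
      proof -
        have "kap j * ?c m j r = 0 \<longleftrightarrow> kap (pr m) * ?c (pr j) (pr m) r = 0"
          unfolding skew[OF that, of r] by simp
        then show ?thesis using kap_nz[OF that(2)] kap_nz[OF G(4)[OF that(1)]] by simp
      qed
      show "?c m (pr m) r = 0" if "m < k" "even r" for m r
      proof -
        have "kap (pr m) * ?c m (pr m) r = - (kap (pr m) * ?c m (pr m) r)"
          using skew[OF that(1) G(4)[OF that(1)], of r] G(5)[OF that(1)] that(2) by simp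
        then have "kap (pr m) * ?c m (pr m) r = 0" by (rule eq_neg_zero)
        then show ?thesis using kap_nz[OF G(4)[OF that(1)]] by simp
      qed
      show "X m (st m) * ?c m (st m) r = - (X (st m) m * ?c (st m) m r)" if m: "m \<in> S" "st m \<noteq> m" "odd r" for m r
      proof -
        have s: "st m \<in> S" "st (st m) = m" using st[OF m(1)] by auto
        have "kap (st m) * ?c m (st m) r = kap m * ?c (st m) m r"
          using skew[OF SD(1)[OF m(1)] SD(1)[OF s(1)], of r] SD(2)[OF m(1)] SD(2)[OF s(1)] m(3) by simp
        moreover have "X m (st m) = kap (st m) * T' m" "X (st m) m = - (kap m * T' m)"
          using m s T'_st[OF m(1,2)] by (auto simp: X_def)
        ultimately show ?thesis by (simp add: mult_ac)
      qed
      show "?c (mu p) p r = 0" if "p \<in> Q" "lk p" for p r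
        using par1[OF that(1), of r] that(2) by (simp add: src_def)
      show "?c p p r = 0" if "p \<in> Q" "\<not> lk p" for p r
        using par1[OF that(1), of r] that(2) by (simp add: src_def)
      show "?c m m r = 0" if m: "m \<in> S" "st m \<le> m" "odd r" for m r
      proof (cases "r < n m")
        case True
        obtain t where t: "r = Suc (2 * t)" using m(3) by (metis oddE Suc_eq_plus1)
        have "odd (n m)" using parity SD(1) m(1) by blast
        then have "t < n m div 2" using t True by presburger
        then have "(m, m, r) \<in> ?F2" using m t by (auto simp: S'_def)
        then show ?thesis by (intro z) blast
      next
        case False
        then show ?thesis using sc.range SD(1)[OF m(1)] by simp
      qed
      show "n (st m) \<le> n m" if "m \<in> S" "st m \<le> m" for m using G(10) that SD(1) by blast
      show "?c m (st m) r = 0" if m: "m \<in> S" "st m < m" "even r" for m r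
      proof (cases "r < n (st m)")
        case True
        obtain t where t: "r = 2 * t" using m(3) by blast
        have "t < Suc (n (st m)) div 2" using t True by presburger
        then have "(m, st m, r) \<in> ?F3" using m t by (auto simp: I_def)
        then show ?thesis by (intro z) blast
      next
        case False
        then show ?thesis using sc.range SD(1)[OF m(1)] SD(1) st[OF m(1)] by simp
      qed
    qed
    then show "?c m j r = 0" using mj by (rule orthogonal_coordinates.all_zero)
  qed
qed

end

end

section \<open>Lower bounds for the index\<close>

definition mtrace :: "nat \<Rightarrow> (nat \<Rightarrow> nat \<Rightarrow> 'a::comm_ring_1) \<Rightarrow> 'a" where
  "mtrace n A = (\<Sum>i<n. A i i)"

lemma mtrace_commute: "mtrace n (mmul n A B) = mtrace n (mmul n B A)"
  unfolding mtrace_def mmul_def by (subst sum.swap) (simp add: mult.commute)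

lemma mtrace_cong:
  "(\<And>i j. \<lbrakk>i < n; j < n\<rbrakk> \<Longrightarrow> A i j = B i j) \<Longrightarrow> mtrace n (mmul n A C) = mtrace n (mmul n B C)"
  unfolding mtrace_def mmul_def by (intro sum.cong) auto

text \<open>tr (X [y, Z]) = tr ([X, y] Z) = tr ([y', E] Z) = tr (y' [E, Z]) = 0. Thus the
  first-order condition of \<open>limit_of_centralisers\<close> makes \<open>y\<close> stabilise the
  functional Z \<mapsto> tr (X Z) on the centraliser of \<open>E\<close>.\<close>

lemma mtrace_commutator_zero:
  assumes E: "\<And>i j. \<lbrakk>i < n; j < n\<rbrakk> \<Longrightarrow> mmul n E Z i j = mmul n Z E i j"
    and X: "\<And>i j. \<lbrakk>i < n; j < n\<rbrakk> \<Longrightarrow>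
      mmul n X y i j + mmul n E y' i j = mmul n y X i j + mmul n y' E i j"
  shows "mtrace n (mmul n X (\<lambda>i j. mmul n y Z i j - mmul n Z y i j)) = 0"
proof -
  have diff_right: "mtrace n (mmul n A (\<lambda>i j. P i j - Q i j)) = mtrace n (mmul n A P) - mtrace n (mmul n A Q)" for A P Q
    by (simp add: mtrace_def mmul_def right_diff_distrib sum_subtractf)
  have diff_left: "mtrace n (mmul n (\<lambda>i j. P i j - Q i j) A) = mtrace n (mmul n P A) - mtrace n (mmul n Q A)" for A P Q
    by (simp add: mtrace_def mmul_def left_diff_distrib sum_subtractf)
  have "mtrace n (mmul n X (mmul n Z y)) = mtrace n (mmul n (mmul n y X) Z)"
    by (metis mmul_assoc mtrace_commute)
  then have "mtrace n (mmul n X (\<lambda>i j. mmul n y Z i j - mmul n Z y i j)) =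
      mtrace n (mmul n (\<lambda>i j. mmul n X y i j - mmul n y X i j) Z)"
    unfolding diff_right diff_left mmul_assoc by simp
  also have "\<dots> = mtrace n (mmul n (\<lambda>i j. mmul n y' E i j - mmul n E y' i j) Z)"
    using X by (intro mtrace_cong) (simp add: algebra_simps)
  also have "\<dots> = mtrace n (mmul n (mmul n E Z) y') - mtrace n (mmul n (mmul n Z E) y')"
    unfolding diff_left by (metis mmul_assoc mtrace_commute)
  also have "mtrace n (mmul n (mmul n E Z) y') = mtrace n (mmul n (mmul n Z E) y')"
    by (rule mtrace_cong[OF E])
  finally show ?thesis by simp
qed

text \<open>A numbered basis with its dual functionals, so that endomorphisms turn into matrices for
  \<open>mmul\<close>.\<close>

locale frame = vector_space scale
  for scale :: "'k::field \<Rightarrow> 'v::ab_group_add \<Rightarrow> 'v" (infixr "*s" 75) +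
  fixes N :: nat and w :: "nat \<Rightarrow> 'v" and phi :: "nat \<Rightarrow> 'v \<Rightarrow> 'k"
  assumes phi_linear: "i < N \<Longrightarrow> Vector_Spaces.linear scale (*) (phi i)"
    and dual: "\<lbrakk>i < N; j < N\<rbrakk> \<Longrightarrow> phi i (w j) = (if i = j then 1 else 0)"
    and expand: "v = (\<Sum>i<N. phi i v *s w i)"
begin

sublocale E: vector_space "endo_scale scale"
  by (rule vector_space_endo[OF vector_space_axioms])

definition mat :: "('v \<Rightarrow> 'v) \<Rightarrow> nat \<Rightarrow> nat \<Rightarrow> 'k" where
  "mat f i j = phi i (f (w j))"

definition endo :: "(nat \<Rightarrow> nat \<Rightarrow> 'k) \<Rightarrow> 'v \<Rightarrow> 'v" where
  "endo A v = (\<Sum>i<N. \<Sum>j<N. (A i j * phi j v) *s w i)"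

lemma phi_comb: "i < N \<Longrightarrow> phi i (\<Sum>j<N. c j *s w j) = c i"
proof -
  assume i: "i < N"
  have "phi i (\<Sum>j<N. c j *s w j) = (\<Sum>j<N. c j * phi i (w j))"
    by (simp only: linear_map_sum[OF phi_linear[OF i]] linear_map_scale[OF phi_linear[OF i]])
  also have "\<dots> = (\<Sum>j<N. if j = i then c j else 0)"
    using i by (intro sum.cong) (auto simp: dual)
  finally show ?thesis using i by simp
qed

lemma eq_iff_phi: "(\<And>i. i < N \<Longrightarrow> phi i u = phi i v) \<Longrightarrow> u = v"
  using expand[of u] expand[of v] by simp

lemma endo_linear: "Vector_Spaces.linear scale scale (endo A)"
  unfolding Vector_Spaces.linear_iff
proof (intro conjI allI vector_space_axioms)
  show "endo A (x + y) = endo A x + endo A y" for x y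
  proof -
    have "(A i j * phi j (x + y)) *s w i = (A i j * phi j x) *s w i + (A i j * phi j y) *s w i" if "j < N" for i j
      by (simp add: linear_map_add[OF phi_linear[OF that]] distrib_left scale_left_distrib)
    then show ?thesis unfolding endo_def by (simp add: sum.distrib)
  qed
  show "endo A (c *s x) = c *s endo A x" for c x
    unfolding endo_def scale_sum_right
    by (intro sum.cong refl) (simp add: linear_map_scale[OF phi_linear] mult_ac)
qed

lemma mat_endo:
  assumes "i < N" "j < N"
  shows "mat (endo A) i j = A i j"
proof -
  have "endo A (w j) = (\<Sum>i<N. A i j *s w i)"
    unfolding endo_def
  proof (intro sum.cong refl)
    fix i
    have "(\<Sum>l<N. (A i l * phi l (w j)) *s w i) = (\<Sum>l<N. if l = j then A i l *s w i else 0)"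
      using assms(2) by (intro sum.cong) (auto simp: dual)
    then show "(\<Sum>l<N. (A i l * phi l (w j)) *s w i) = A i j *s w i" using assms(2) by simp
  qed
  then show ?thesis unfolding mat_def using phi_comb[OF assms(1)] by simp
qed

lemma mat_apply:
  assumes f: "Vector_Spaces.linear scale scale f" and i: "i < N"
  shows "phi i (f v) = (\<Sum>l<N. mat f i l * phi l v)"
proof -
  have "phi i (f v) = phi i (f (\<Sum>l<N. phi l v *s w l))" using expand[of v] by simp
  also have "\<dots> = (\<Sum>l<N. phi l v * phi i (f (w l)))"
    by (simp only: linear_map_sum[OF f] linear_map_scale[OF f] linear_map_sum[OF phi_linear[OF i]]
        linear_map_scale[OF phi_linear[OF i]])
  finally show ?thesis by (simp add: mat_def mult.commute)
qed

lemma mat_compose: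
  assumes "Vector_Spaces.linear scale scale f" "i < N"
  shows "phi i (f (g (w j))) = mmul N (mat f) (mat g) i j"
  using mat_apply[OF assms, of "g (w j)"] by (simp add: mmul_def mat_def)

lemma mat_commutator:
  assumes "Vector_Spaces.linear scale scale f" "Vector_Spaces.linear scale scale g" "i < N"
  shows "mat (commutator f g) i j = mmul N (mat f) (mat g) i j - mmul N (mat g) (mat f) i j"
proof -
  have "mat (commutator f g) i j = phi i (f (g (w j))) - phi i (g (f (w j)))"
    by (simp add: mat_def commutator_def linear_map_diff[OF phi_linear[OF assms(3)]])
  then show ?thesis by (simp only: mat_compose[OF assms(1,3)] mat_compose[OF assms(2,3)])
qed

lemma linear_eq_mat:
  assumes f: "Vector_Spaces.linear scale scale f" and g: "Vector_Spaces.linear scale scale g"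
    and eq: "\<And>i j. \<lbrakk>i < N; j < N\<rbrakk> \<Longrightarrow> mat f i j = mat g i j"
  shows "f = g"
proof
  fix v show "f v = g v"
    by (rule eq_iff_phi) (simp add: mat_apply[OF f] mat_apply[OF g] eq cong: sum.cong_simp)
qed

lemma commute_iff_mat:
  assumes f: "Vector_Spaces.linear scale scale f" and e: "Vector_Spaces.linear scale scale e"
  shows "(\<forall>v. f (e v) = e (f v)) \<longleftrightarrow>
    (\<forall>i<N. \<forall>j<N. mmul N (mat f) (mat e) i j = mmul N (mat e) (mat f) i j)"
proof
  assume "\<forall>v. f (e v) = e (f v)"
  then show "\<forall>i<N. \<forall>j<N. mmul N (mat f) (mat e) i j = mmul N (mat e) (mat f) i j"
    using mat_compose[OF f, of _ e] mat_compose[OF e, of _ f] by metis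
next
  assume h: "\<forall>i<N. \<forall>j<N. mmul N (mat f) (mat e) i j = mmul N (mat e) (mat f) i j"
  have "(\<lambda>v. f (e v)) = (\<lambda>v. e (f v))"
  proof (rule linear_eq_mat)
    show "Vector_Spaces.linear scale scale (\<lambda>v. f (e v))"
      using Vector_Spaces.linear_compose[OF e f] by (simp add: comp_def)
    show "Vector_Spaces.linear scale scale (\<lambda>v. e (f v))"
      using Vector_Spaces.linear_compose[OF f e] by (simp add: comp_def)
    show "mat (\<lambda>v. f (e v)) i j = mat (\<lambda>v. e (f v)) i j" if "i < N" "j < N" for i j
      using h that by (simp add: mat_def mat_compose[OF f] mat_compose[OF e, of _ f])
  qed
  then show "\<forall>v. f (e v) = e (f v)" by metis
qed

definition unit_endo :: "nat \<Rightarrow> nat \<Rightarrow> 'v \<Rightarrow> 'v" where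
  "unit_endo i j = (\<lambda>v. phi j v *s w i)"

lemma linear_unit_sum:
  assumes f: "Vector_Spaces.linear scale scale f"
  shows "f = (\<Sum>i<N. \<Sum>j<N. endo_scale scale (mat f i j) (unit_endo i j))"
proof
  fix v
  have ap: "(\<Sum>a\<in>A. F a) v = (\<Sum>a\<in>A. F a v)" for A and F :: "nat \<Rightarrow> 'v \<Rightarrow> 'v"
    by (induction A rule: infinite_finite_induct) auto
  have "f v = (\<Sum>i<N. phi i (f v) *s w i)" by (rule expand)
  also have "\<dots> = (\<Sum>i<N. \<Sum>j<N. (mat f i j * phi j v) *s w i)"
    by (intro sum.cong refl) (simp add: mat_apply[OF f] scale_sum_left)
  finally show "f v = (\<Sum>i<N. \<Sum>j<N. endo_scale scale (mat f i j) (unit_endo i j)) v"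
    by (simp add: ap endo_scale_def unit_endo_def)
qed

definition units :: "('v \<Rightarrow> 'v) set" where
  "units = (\<lambda>(i, j). unit_endo i j) ` ({..<N} \<times> {..<N})"

lemma finite_units: "finite units"
  by (simp add: units_def)

lemma linear_in_span: "Vector_Spaces.linear scale scale f \<Longrightarrow> f \<in> E.span units"
  by (subst linear_unit_sum, assumption, rule E.span_sum, rule E.span_sum, rule E.span_scale,
      rule E.span_base) (auto simp: units_def)

lemma functional_trace:
  assumes add: "\<And>f g. alpha (f + g) = alpha f + (alpha g :: 'k)"
    and scl: "\<And>c f. alpha (endo_scale scale c f) = c * alpha f"
    and f: "Vector_Spaces.linear scale scale f"
  shows "alpha f = mtrace N (mmul N (\<lambda>i j. alpha (unit_endo j i)) (mat f))"
proof -
  have "alpha 0 = alpha 0 + alpha 0" using add[of 0 0] by (simp only: add_0_left)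
  then have a0: "alpha 0 = 0" by (simp only: add_cancel_right_right)
  have sum: "alpha (\<Sum>a\<in>A. F a) = (\<Sum>a\<in>A. alpha (F a))" for A and F :: "nat \<Rightarrow> 'v \<Rightarrow> 'v"
    by (induction A rule: infinite_finite_induct) (simp_all only: sum.infinite sum.empty sum.insert a0 add not_False_eq_True)
  have "alpha f = (\<Sum>i<N. \<Sum>j<N. mat f i j * alpha (unit_endo i j))"
    by (subst linear_unit_sum[OF f]) (simp only: sum scl)
  also have "\<dots> = mtrace N (mmul N (\<lambda>i j. alpha (unit_endo j i)) (mat f))"
    unfolding mtrace_def mmul_def by (subst sum.swap) (simp add: mult.commute)
  finally show ?thesis .
qed

text \<open>The matrices y of \<open>limit_of_centralisers\<close> give independent maps in the
  algebra that stabilise \<open>alpha\<close>. \<open>G\<close> is 0 for the general linear algebra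
  and the Gram matrix for a form. As \<open>X\<close> has to be skew for \<open>G\<close>, a
  functional must first be represented by a skew matrix.\<close>

theorem stabiliser_lower_bound:
  fixes G X :: "nat \<Rightarrow> nat \<Rightarrow> 'k" and D :: "nat \<Rightarrow> nat \<Rightarrow> 'k poly" and e :: "'v \<Rightarrow> 'v"
    and alpha :: "('v \<Rightarrow> 'v) \<Rightarrow> 'k"
  defines "P \<equiv> \<lambda>f. Vector_Spaces.linear scale scale f \<and> skew_for N G (mat f)"
  defines "L \<equiv> \<lambda>f. P f \<and> (\<forall>v. f (e v) = e (f v))"
  assumes e: "P e" and X: "skew_for N G X" and D: "skew_for N (\<lambda>i l. [:G i l:]) D"
    and ind: "independent_family {..<r} ({..<N} \<times> {..<N}) (\<lambda>j (i, l). odd_power N D j i l)"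
    and alpha: "\<And>z. L z \<Longrightarrow> alpha z = mtrace N (mmul N X (mat z))"
    and comm: "\<And>f g. \<lbrakk>L f; L g\<rbrakk> \<Longrightarrow> L (commutator f g)"
  shows "r \<le> E.dim (stabiliser_in L alpha)"
proof -
  have e': "Vector_Spaces.linear scale scale e" "skew_for N G (mat e)" using e by (auto simp: P_def)
  from limit_of_centralisers[OF e'(2) X D ind]
  obtain y y' where y: "independent_family {..<r} ({..<N} \<times> {..<N}) (\<lambda>j (i, l). y j i l)"
    and sk: "\<And>j. j < r \<Longrightarrow> skew_for N G (y j)"
    and ye: "\<And>j i l. \<lbrakk>j < r; i < N; l < N\<rbrakk> \<Longrightarrow> mmul N (mat e) (y j) i l = mmul N (y j) (mat e) i l"
    and yx: "\<And>j i l. \<lbrakk>j < r; i < N; l < N\<rbrakk> \<Longrightarrow>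
      mmul N X (y j) i l + mmul N (mat e) (y' j) i l = mmul N (y j) X i l + mmul N (y' j) (mat e) i l"
    by blast
  define f where "f = (\<lambda>j. endo (y j))"
  have mm: "mmul N (mat (f j)) A i l = mmul N (y j) A i l" "mmul N A (mat (f j)) i l = mmul N A (y j) i l"
    if "i < N" "l < N" for A i l j
    using that unfolding mmul_def by (auto simp: f_def mat_endo intro!: sum.cong)
  have Lf: "L (f j)" if "j < r" for j
  proof -
    have "skew_for N G (mat (f j))"
      using sk[OF that] unfolding skew_for_def by (simp add: f_def mat_endo cong: sum.cong_simp)
    moreover have "\<forall>v. f j (e v) = e (f j v)"
    proof -
      have "Vector_Spaces.linear scale scale (f j)" by (simp add: f_def endo_linear)
      from commute_iff_mat[OF this e'(1)] show ?thesis using mm ye[OF that] by simp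
    qed
    ultimately show ?thesis by (simp add: L_def P_def f_def endo_linear)
  qed
  have stab: "f j \<in> stabiliser_in L alpha" if j: "j < r" for j
    unfolding stabiliser_in_def
  proof (intro CollectI conjI allI impI Lf[OF j])
    fix z assume z: "L z"
    have lin: "Vector_Spaces.linear scale scale z" "Vector_Spaces.linear scale scale (f j)"
      using z Lf[OF j] by (auto simp: L_def P_def)
    have "alpha (commutator (f j) z) = mtrace N (mmul N X (mat (commutator (f j) z)))"
      by (rule alpha[OF comm[OF Lf[OF j] z]])
    also have "\<dots> = mtrace N (mmul N (mat (commutator (f j) z)) X)" by (rule mtrace_commute)
    also have "\<dots> = mtrace N (mmul N (\<lambda>i l. mmul N (y j) (mat z) i l - mmul N (mat z) (y j) i l) X)"
      by (rule mtrace_cong) (simp add: mat_commutator[OF lin(2,1)] mm)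
    also have "\<dots> = mtrace N (mmul N X (\<lambda>i l. mmul N (y j) (mat z) i l - mmul N (mat z) (y j) i l))"
      by (rule mtrace_commute)
    also have "\<dots> = 0"
    proof (rule mtrace_commutator_zero[where E = "mat e" and y' = "y' j"])
      show "mmul N (mat e) (mat z) i l = mmul N (mat z) (mat e) i l" if "i < N" "l < N" for i l
        using z commute_iff_mat[OF lin(1) e'(1)] that by (simp add: L_def)
    qed (rule yx[OF j])
    finally show "alpha (commutator (f j) z) = 0" .
  qed
  have "inj_on f {..<r} \<and> E.independent (f ` {..<r})"
  proof (rule E.independent_image)
    fix c j assume c: "(\<Sum>j<r. endo_scale scale (c j) (f j)) = 0" and j: "j \<in> {..<r}"
    have "(\<Sum>j<r. c j * y j i l) = 0" if "i < N" "l < N" for i l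
    proof -
      have m: "mat (\<Sum>a\<in>A. endo_scale scale (c a) (f a)) i l = (\<Sum>a\<in>A. c a * mat (f a) i l)" for A
      proof (induction A rule: infinite_finite_induct)
        case (insert a A)
        then show ?case
          using that by (simp add: mat_def endo_scale_def linear_map_add[OF phi_linear] linear_map_scale[OF phi_linear])
      qed (use that in \<open>simp_all add: mat_def linear_map_zero[OF phi_linear]\<close>)
      have "mat 0 i l = 0" using that by (simp add: mat_def linear_map_zero[OF phi_linear])
      then show ?thesis using m[of "{..<r}"] that unfolding c by (simp add: f_def mat_endo)
    qed
    then show "c j = 0" using independent_familyD[OF y, of c j] j by auto
  qed simp
  moreover have "stabiliser_in L alpha \<subseteq> E.span units"
    using linear_in_span by (auto simp: stabiliser_in_def L_def P_def)
  moreover have "f ` {..<r} \<subseteq> stabiliser_in L alpha" using stab by auto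
  ultimately have "card (f ` {..<r}) \<le> E.dim (stabiliser_in L alpha)"
    using E.card_le_dim[OF _ _ _ finite_units] by blast
  then show ?thesis using \<open>inj_on f {..<r} \<and> _\<close> by (simp add: card_image)
qed

text \<open>For \<open>G\<close> = 0 every matrix is skew. \<open>D\<close> is diagonal with entries
  s^a; their squares have the distinct degrees 2a, so the first \<open>N\<close> odd powers of
  \<open>D\<close> are independent over every field.\<close>

theorem general_linear_lower_bound:
  assumes add: "\<And>f g. alpha (f + g) = alpha f + (alpha g :: 'k)"
    and scl: "\<And>c f. alpha (endo_scale scale c f) = c * alpha f"
    and e: "Vector_Spaces.linear scale scale e"
  shows "N \<le> E.dim (stabiliser_in (\<lambda>f. Vector_Spaces.linear scale scale f \<and> (\<forall>v. f (e v) = e (f v))) alpha)"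
proof -
  have sk: "skew_for N (\<lambda>i j. 0) A" for A :: "nat \<Rightarrow> nat \<Rightarrow> 'k" by (simp add: skew_for_def)
  let ?h = "\<lambda>a::nat. monom (1::'k) a"
  let ?D = "\<lambda>a b. if b = id a then ?h a else 0"
  have inj: "inj_on (\<lambda>a. ?h a * ?h (id a)) {..<N}"
  proof (rule inj_onI)
    fix a b assume "?h a * ?h (id a) = ?h b * ?h (id b)"
    then have "monom (1::'k) (a + a) = monom 1 (b + b)" by (simp add: mult_monom)
    then have "degree (monom (1::'k) (a + a)) = degree (monom (1::'k) (b + b))" by simp
    then show "a = b" by (simp add: degree_monom_eq)
  qed
  have "N \<le> E.dim (stabiliser_in (\<lambda>f. (Vector_Spaces.linear scale scale f \<and> skew_for N (\<lambda>i j. 0) (mat f)) \<and> (\<forall>v. f (e v) = e (f v))) alpha)"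
  proof (rule stabiliser_lower_bound[where D = ?D])
    show "independent_family {..<N} ({..<N} \<times> {..<N}) (\<lambda>j (i, l). odd_power N ?D j i l)"
      by (rule odd_power_monomial_independent[where A = "{..<N}"]) (use inj in \<open>auto simp: monom_eq_0_iff\<close>)
    show "skew_for N (\<lambda>i l. [:0:]) ?D" by (simp add: skew_for_def)
    fix f g assume "(Vector_Spaces.linear scale scale f \<and> skew_for N (\<lambda>i j. 0) (mat f)) \<and> (\<forall>v. f (e v) = e (f v))"
      "(Vector_Spaces.linear scale scale g \<and> skew_for N (\<lambda>i j. 0) (mat g)) \<and> (\<forall>v. g (e v) = e (g v))"
    then have lin: "Vector_Spaces.linear scale scale f" "Vector_Spaces.linear scale scale g"
      and ce: "\<And>v. f (e v) = e (f v)" "\<And>v. g (e v) = e (g v)" by auto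
    show "(Vector_Spaces.linear scale scale (commutator f g) \<and> skew_for N (\<lambda>i j. 0) (mat (commutator f g))) \<and>
      (\<forall>v. commutator f g (e v) = e (commutator f g v))"
      unfolding Vector_Spaces.linear_iff commutator_def
      by (intro conjI allI vector_space_axioms sk)
        (simp_all add: linear_map_add[OF lin(1)] linear_map_add[OF lin(2)] linear_map_scale[OF lin(1)]
          linear_map_scale[OF lin(2)] scale_right_diff_distrib ce linear_map_diff[OF e])
  qed (use e sk functional_trace[OF add scl] in auto)
  then show ?thesis by (simp add: sk)
qed

end

section \<open>The index of the centraliser\<close>

lemma (in vector_space) functional_extend:
  assumes L: "subspace L"
    and add: "\<And>x y. \<lbrakk>x \<in> L; y \<in> L\<rbrakk> \<Longrightarrow> alpha (x + y) = alpha x + (alpha y :: 'a)"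
    and scl: "\<And>c x. x \<in> L \<Longrightarrow> alpha (c *s x) = c * alpha x"
  shows "\<exists>beta. Vector_Spaces.linear scale (*) beta \<and> (\<forall>x\<in>L. beta x = alpha x)"
proof -
  obtain C where C: "C \<subseteq> L" "independent C" "L \<subseteq> span C" using basis_exists[of L] by metis
  obtain beta where beta: "Vector_Spaces.linear scale (*) beta" "\<And>b. b \<in> C \<Longrightarrow> beta b = alpha b"
    using linear_functional_extend[OF C(2), of alpha] by metis
  have a0: "alpha 0 = 0" using scl[OF subspace_0[OF L], of 0] by simp
  have "subspace {x\<in>L. beta x = alpha x}"
  proof (rule subspaceI)
    show "0 \<in> {x\<in>L. beta x = alpha x}" using subspace_0[OF L] a0 linear_map_zero[OF beta(1)] by simp
    show "x + y \<in> {x\<in>L. beta x = alpha x}" if "x \<in> {x\<in>L. beta x = alpha x}" "y \<in> {x\<in>L. beta x = alpha x}" for x y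
      using that add[of x y] subspace_add[OF L, of x y] linear_map_add[OF beta(1), of x y] by simp
    show "c *s x \<in> {x\<in>L. beta x = alpha x}" if "x \<in> {x\<in>L. beta x = alpha x}" for c x
      using that scl[of x c] subspace_scale[OF L, of x c] linear_map_scale[OF beta(1), of c x] by simp
  qed
  then have "span C \<subseteq> {x\<in>L. beta x = alpha x}"
    using C(1) beta(2) by (intro span_minimal) auto
  then have "\<forall>x\<in>L. beta x = alpha x" using C(3) by auto
  then show ?thesis using beta(1) by auto
qed

lemma (in vector_space) dim_mono_finite:
  assumes "U \<subseteq> W" "W \<subseteq> span T" "finite T"
  shows "dim U \<le> dim W"
proof -
  obtain C where C: "C \<subseteq> U" "independent C" "U \<subseteq> span C" "card C = dim U" using basis_exists by blast
  then show ?thesis using card_le_dim[OF C(2) _ assms(2,3)] assms(1) by auto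
qed

text \<open>An element of \<open>lie_dual\<close> is linear on the algebra only. It is replaced by a
  linear extension to all maps, which has the same stabiliser because commutators stay in the
  algebra; this is why \<open>lower\<close> and \<open>upper\<close> can speak of functionals on all
  maps.\<close>

lemma lie_index_eqI:
  fixes s :: "'k::field \<Rightarrow> 'v::ab_group_add \<Rightarrow> 'v"
  assumes vs: "vector_space s"
    and L: "module.subspace (endo_scale s) {f. P f}"
    and comm: "\<And>f g. P f \<Longrightarrow> P g \<Longrightarrow> P (commutator f g)"
    and lower: "\<And>alpha :: ('v \<Rightarrow> 'v) \<Rightarrow> 'k. \<lbrakk>\<And>f g. alpha (f + g) = alpha f + alpha g;
        \<And>c f. alpha (endo_scale s c f) = c * alpha f\<rbrakk> \<Longrightarrow>
      r \<le> vector_space.dim (endo_scale s) (stabiliser_in P alpha)"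
    and upper: "\<exists>alpha :: ('v \<Rightarrow> 'v) \<Rightarrow> 'k. (\<forall>f g. alpha (f + g) = alpha f + alpha g) \<and>
        (\<forall>c f. alpha (endo_scale s c f) = c * alpha f) \<and>
      vector_space.dim (endo_scale s) (stabiliser_in P alpha) \<le> r"
  shows "lie_index (endo_scale s) commutator {f. P f} = r"
proof -
  interpret E: vector_space "endo_scale s" by (rule vector_space_endo[OF vs])
  have stab: "lie_stabiliser commutator {f. P f} alpha = stabiliser_in P alpha" for alpha :: "('v \<Rightarrow> 'v) \<Rightarrow> 'k"
    by (auto simp: lie_stabiliser_def stabiliser_in_def)
  obtain alpha where alpha: "\<And>f g. alpha (f + g) = alpha f + alpha g"
    "\<And>c f. alpha (endo_scale s c f) = c * alpha f" "E.dim (stabiliser_in P alpha) \<le> r"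
    using upper by blast
  show ?thesis
    unfolding lie_index_def stab
  proof (rule Least_equality)
    have "alpha \<in> lie_dual (endo_scale s) {f. P f}" using alpha(1,2) by (simp add: lie_dual_def)
    moreover have "r = E.dim (stabiliser_in P alpha)" using alpha(3) lower[OF alpha(1,2)] by simp
    ultimately show "\<exists>alpha\<in>lie_dual (endo_scale s) {f. P f}. r = E.dim (stabiliser_in P alpha)" by blast
  next
    fix d assume "\<exists>alpha\<in>lie_dual (endo_scale s) {f. P f}. d = E.dim (stabiliser_in P alpha)"
    then obtain gamma where g: "gamma \<in> lie_dual (endo_scale s) {f. P f}" "d = E.dim (stabiliser_in P gamma)" by blast
    obtain beta where beta: "Vector_Spaces.linear (endo_scale s) (*) beta" "\<forall>x\<in>{f. P f}. beta x = gamma x"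
      using E.functional_extend[OF L, of gamma] g(1) unfolding lie_dual_def by blast
    have "stabiliser_in P beta = stabiliser_in P gamma"
      using beta(2) comm by (auto simp: stabiliser_in_def)
    then show "r \<le> d"
      using lower[of beta] linear_map_add[OF beta(1)] linear_map_scale[OF beta(1)] g(2) by simp
  qed
qed

context skew_nilpotent
begin

lemma commutator_in_algebra:
  assumes f: "in_algebra f" and g: "in_algebra g"
  shows "in_algebra (commutator f g)"
proof -
  have lin: "Vector_Spaces.linear scale scale f" "Vector_Spaces.linear scale scale g"
    and ce: "\<And>v. f (e v) = e (f v)" "\<And>v. g (e v) = e (g v)"
    and sk: "\<And>x y. B (f x) y = - B x (f y)" "\<And>x y. B (g x) y = - B x (g y)"
    using f g unfolding in_algebra_def by (auto simp: eq_neg_iff_add_eq_0)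
  show ?thesis
    unfolding in_algebra_def Vector_Spaces.linear_iff commutator_def
    by (intro conjI allI vector_space_axioms)
      (simp_all add: linear_map_add[OF lin(1)] linear_map_add[OF lin(2)] linear_map_scale[OF lin(1)]
        linear_map_scale[OF lin(2)] scale_right_diff_distrib ce linear_map_diff[OF e_linear]
        B_diff_left linear_map_diff[OF B_linear_right] sk)
qed

text \<open>The adapted Jordan basis of the zero map: all blocks have size 1, and the result is an
  orthogonal basis for \<open>eps\<close> = 1 and a basis of hyperbolic pairs for \<open>eps\<close>
  = -1.\<close>

lemma exists_frame:
  "\<exists>N w pr kap. frame scale N w (\<lambda>i v. B v (w (pr i)) / kap i) \<and> dim UNIV = N \<and>
    (\<forall>i<N. pr i < N \<and> pr (pr i) = i \<and> kap i \<noteq> 0 \<and> (pr i = i \<longleftrightarrow> eps = 1) \<and> kap (pr i) = eps * kap i \<and>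
      (\<forall>j<N. B (w i) (w j) = (if j = pr i then kap i else 0)))"
proof -
  let ?z = "\<lambda>_::'v. 0 :: 'v"
  interpret s: skew_nilpotent scale Basis B eps ?z
  proof (rule skew_nilpotent.intro[OF finite_dimensional_vector_space_axioms], rule skew_nilpotent_axioms.intro)
    show "Vector_Spaces.linear scale scale ?z"
      by (simp add: Vector_Spaces.linear_iff vector_space_axioms)
    show "nilpotent_endo ?z" unfolding nilpotent_endo_def by (intro exI[of _ 1]) simp
    show "B v x = eps * B x v" for v x by (rule B_sym)
    show "v = 0" if "\<And>x. B v x = 0" for v using B_nondegenerate that by blast
  qed (use B_linear_right B_linear_left eps two in \<open>simp_all add: B_zero_left B_zero_right\<close>)
  obtain N n w pr kap where g: "s.gram_on UNIV N n w pr kap" using s.exists_gram by blast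
  note G = s.gram_onD[OF g]
  have n1: "n i = 1" if i: "i < N" for i
  proof -
    have "B ((?z ^^ (n i - 1)) (w i)) (w (pr i)) \<noteq> 0"
      using G(9)[OF i G(4)[OF i], of "n i - 1"] G(1,7)[OF i] by simp
    then have "n i - 1 = 0" by (cases "n i - 1") (auto simp: B_zero_left)
    then show ?thesis using G(1)[OF i] by simp
  qed
  interpret js: jordan_system scale ?z N n w "\<lambda>i v. B v (w (pr i)) / kap i"
    by (rule s.gram_jordan_system[OF g])
  have "frame scale N w (\<lambda>i v. B v (w (pr i)) / kap i)"
  proof (rule frame.intro[OF vector_space_axioms], rule frame_axioms.intro)
    show "Vector_Spaces.linear scale (*) (\<lambda>v. B v (w (pr i)) / kap i)" if "i < N" for i
      by (rule js.phi_linear[OF that])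
    show "B (w j) (w (pr i)) / kap i = (if i = j then 1 else 0)" if "i < N" "j < N" for i j
      using js.dual[OF that, of 0] n1[OF that(1)] by simp
    show "v = (\<Sum>i<N. (B v (w (pr i)) / kap i) *s w i)" for v
    proof -
      have "v = (\<Sum>i<N. \<Sum>s<n i. (B ((?z ^^ (n i - Suc s)) v) (w (pr i)) / kap i) *s (?z ^^ s) (w i))"
        by (rule js.expand)
      also have "\<dots> = (\<Sum>i<N. (B v (w (pr i)) / kap i) *s w i)"
        using n1 by (intro sum.cong) auto
      finally show ?thesis .
    qed
  qed
  moreover have "dim UNIV = N" using js.dim_UNIV n1 by simp
  moreover have "kap (pr i) = eps * kap i" "pr i = i \<longleftrightarrow> eps = 1" if "i < N" for i
    using s.kap_pr[OF g that] G(8)[OF that] n1[OF that] by simp_all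
  moreover have "B (w i) (w j) = (if j = pr i then kap i else 0)" if "i < N" "j < N" for i j
    using G(9)[OF that, of 0] n1[OF that(1)] by simp
  ultimately show ?thesis
    by (intro exI[of _ N] exI[of _ w] exI[of _ pr] exI[of _ kap] conjI allI impI) (use G(4,5,7) in simp_all)
qed

text \<open>Two things are needed for \<open>stabiliser_lower_bound\<close>: a skew matrix that
  represents \<open>alpha\<close> on the algebra, and a skew polynomial matrix \<open>D\<close> with
  N div 2 independent odd powers.\<close>

theorem form_lower_bound:
  assumes add: "\<And>f g. alpha (f + g) = alpha f + (alpha g :: 'k)"
    and scl: "\<And>c f. alpha (endo_scale scale c f) = c * alpha f"
  shows "dim UNIV div 2 \<le> vector_space.dim (endo_scale scale) (stabiliser_in in_algebra alpha)"
proof -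
  obtain N w pr kap where fr: "frame scale N w (\<lambda>i v. B v (w (pr i)) / kap i)" and N: "dim UNIV = N"
    and pr: "\<And>i. i < N \<Longrightarrow> pr i < N" "\<And>i. i < N \<Longrightarrow> pr (pr i) = i"
    and kap: "\<And>i. i < N \<Longrightarrow> kap i \<noteq> 0" "\<And>i. i < N \<Longrightarrow> kap (pr i) = eps * kap i"
    and fix_iff: "\<And>i. i < N \<Longrightarrow> pr i = i \<longleftrightarrow> eps = 1"
    and gram: "\<And>i j. \<lbrakk>i < N; j < N\<rbrakk> \<Longrightarrow> B (w i) (w j) = (if j = pr i then kap i else 0)"
    using exists_frame by blast
  define phi where "phi = (\<lambda>i v. B v (w (pr i)) / kap i)"
  interpret frame scale N w phi using fr unfolding phi_def .
  define G where "G = (\<lambda>i j. B (w i) (w j))"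
  have G_sums: "(\<Sum>l<N. A l * G l j) = A (pr j) * kap (pr j)" "(\<Sum>l<N. G j l * A l) = kap j * A (pr j)"
    if "j < N" for A j
  proof -
    have "(\<Sum>l<N. A l * G l j) = (\<Sum>l<N. if l = pr j then A l * kap l else 0)"
      using pr that by (intro sum.cong) (auto simp: G_def gram)
    then show "(\<Sum>l<N. A l * G l j) = A (pr j) * kap (pr j)" using pr(1)[OF that] by simp
    have "(\<Sum>l<N. G j l * A l) = (\<Sum>l<N. if l = pr j then kap j * A l else 0)"
      using that by (intro sum.cong) (auto simp: G_def gram)
    then show "(\<Sum>l<N. G j l * A l) = kap j * A (pr j)" using pr(1)[OF that] by simp
  qed
  have skew_iff: "skew_for N G A \<longleftrightarrow> (\<forall>i<N. \<forall>j<N. A (pr j) i * kap (pr j) + kap i * A (pr i) j = 0)" for A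
    unfolding skew_for_def by (simp add: G_sums cong: conj_cong)
  have form_iff: "(\<forall>x y. B (f x) y + B x (f y) = 0) \<longleftrightarrow> skew_for N G (mat f)"
    if f: "Vector_Spaces.linear scale scale f" for f
  proof -
    have fw: "f (w i) = (\<Sum>l<N. mat f l i *s w l)" for i
      using expand[of "f (w i)"] by (simp add: mat_def)
    have entry: "B (f (w i)) (w j) + B (w i) (f (w j)) =
        (\<Sum>l<N. mat f l i * G l j) + (\<Sum>l<N. G i l * mat f l j)" for i j
      unfolding fw by (simp add: B_sum_left B_scale_left B_sum_right B_scale_right G_def mult.commute)
    show ?thesis
    proof
      assume "\<forall>x y. B (f x) y + B x (f y) = 0"
      then show "skew_for N G (mat f)" unfolding skew_for_def entry[symmetric] by blast
    next
      assume sk: "skew_for N G (mat f)"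
      show "\<forall>x y. B (f x) y + B x (f y) = 0"
      proof (intro allI)
        fix x y
        have "B (f x) y + B x (f y) = B (f (\<Sum>i<N. phi i x *s w i)) (\<Sum>j<N. phi j y *s w j) +
            B (\<Sum>i<N. phi i x *s w i) (f (\<Sum>j<N. phi j y *s w j))"
          by (simp flip: expand)
        also have "\<dots> = (\<Sum>j<N. \<Sum>i<N. phi i x * phi j y * (B (f (w i)) (w j) + B (w i) (f (w j))))"
          by (simp add: linear_map_sum[OF f] linear_map_scale[OF f] B_sum_left B_sum_right B_scale_left
              B_scale_right sum_distrib_left distrib_left sum.distrib mult_ac)
        also have "\<dots> = 0"
          using sk unfolding skew_for_def entry[symmetric] by (intro sum.neutral) auto
        finally show "B (f x) y + B x (f y) = 0" .
      qed
    qed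
  qed
  have alg: "in_algebra = (\<lambda>f. (Vector_Spaces.linear scale scale f \<and> skew_for N G (mat f)) \<and> (\<forall>v. f (e v) = e (f v)))"
    using form_iff unfolding in_algebra_def by (intro ext) blast
  have bij: "bij_betw pr {..<N} {..<N}"
    by (rule bij_betw_byWitness[where f' = pr]) (use pr in auto)
  have ee: "eps * eps = 1" using eps by auto
  text \<open>\<open>Xa\<close> is the matrix of the adjoint with respect to the form, so \<open>X\<close> is the skew part.\<close>
  define X0 where "X0 = (\<lambda>i j. alpha (unit_endo j i))"
  define Xa where "Xa = (\<lambda>i l. X0 (pr l) (pr i) * kap (pr l) / kap (pr i))"
  define X where "X = (\<lambda>i l. (X0 i l - Xa i l) / 2)"
  have skX: "skew_for N G X"
    unfolding skew_iff
  proof (intro allI impI)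
    fix i j assume ij: "i < N" "j < N"
    have "Xa (pr j) i * kap (pr j) = X0 (pr i) j * kap i"
      using kap ij pr ee eps by (auto simp: Xa_def)
    moreover have "kap i * Xa (pr i) j = X0 (pr j) i * kap (pr j)"
      using kap ij pr by (simp add: Xa_def)
    ultimately have "(X0 (pr j) i - Xa (pr j) i) * kap (pr j) + kap i * (X0 (pr i) j - Xa (pr i) j) = 0"
      by (simp add: algebra_simps)
    then have "((X0 (pr j) i - Xa (pr j) i) * kap (pr j) + kap i * (X0 (pr i) j - Xa (pr i) j)) / 2 = 0" by simp
    then show "X (pr j) i * kap (pr j) + kap i * X (pr i) j = 0"
      by (simp add: X_def add_divide_distrib)
  qed
  \<comment> \<open>Paired with a skew \<open>Z\<close>, the adjoint matrix \<open>Xa\<close> has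
    the opposite trace to \<open>X0\<close>, so halving the difference preserves the
    functional.\<close>
  have trX: "mtrace N (mmul N X Z) = mtrace N (mmul N X0 Z)" if sk: "skew_for N G Z" for Z
  proof -
    have "mtrace N (mmul N Xa Z) = (\<Sum>i<N. \<Sum>l<N. - (X0 (pr l) (pr i) * Z (pr i) (pr l)))"
      unfolding mtrace_def mmul_def
    proof (intro sum.cong refl)
      fix i l assume "i \<in> {..<N}" "l \<in> {..<N}"
      then have il: "i < N" "l < N" by auto
      have "Z l i * kap l + kap i * Z (pr i) (pr l) = 0"
        using sk[unfolded skew_iff, rule_format, OF il(1) pr(1)[OF il(2)]] pr(2)[OF il(2)] by simp
      then have Zl: "Z l i * kap l = - (kap i * Z (pr i) (pr l))" by (simp add: eq_neg_iff_add_eq_0)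
      have "Xa i l * Z l i = X0 (pr l) (pr i) * (eps * (Z l i * kap l)) / (eps * kap i)"
        using kap(2)[OF il(1)] kap(2)[OF il(2)] by (simp add: Xa_def)
      also have "\<dots> = - (X0 (pr l) (pr i) * Z (pr i) (pr l))"
        unfolding Zl using kap(1)[OF il(1)] eps by auto
      finally show "Xa i l * Z l i = - (X0 (pr l) (pr i) * Z (pr i) (pr l))" .
    qed
    also have "\<dots> = (\<Sum>i<N. \<Sum>l<N. - (X0 l (pr i) * Z (pr i) l))"
      by (intro sum.cong refl sum.reindex_bij_betw[OF bij])
    also have "\<dots> = (\<Sum>i<N. \<Sum>l<N. - (X0 l i * Z i l))"
      by (rule sum.reindex_bij_betw[OF bij])
    also have "\<dots> = - mtrace N (mmul N X0 Z)"
      unfolding mtrace_def mmul_def by (subst sum.swap) (simp add: sum_negf)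
    finally have adj: "mtrace N (mmul N Xa Z) = - mtrace N (mmul N X0 Z)" .
    have "mtrace N (mmul N X Z) = (mtrace N (mmul N X0 Z) - mtrace N (mmul N Xa Z)) / 2"
      by (simp add: mtrace_def mmul_def X_def left_diff_distrib diff_divide_distrib sum_subtractf sum_divide_distrib)
    then show ?thesis using adj two by simp
  qed
  \<comment> \<open>The nonzero entries of \<open>D\<close> are at positions (a, t a). For a
    symmetric form \<open>pr\<close> is the identity and \<open>t\<close> swaps 2b and 2b + 1, with
    \<open>c\<close> = 0 at an index left over; for a skew form \<open>t\<close> is
    \<open>pr\<close>. \<open>A\<close> holds the smaller member of each pair.\<close>
  obtain t A and c :: "nat \<Rightarrow> 'k" where t: "\<And>a. a < N \<Longrightarrow> t a < N \<and> t (t a) = a"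
    and A: "A \<subseteq> {..<N}" "card A = N div 2" "\<And>a. a \<in> A \<Longrightarrow> a < t a" "\<And>a. a \<in> A \<Longrightarrow> c a \<noteq> 0 \<and> c (t a) \<noteq> 0"
    and c: "\<And>i j. \<lbrakk>i < N; j < N\<rbrakk> \<Longrightarrow>
      (if i = t (pr j) then c (pr j) else 0) * kap (pr j) + kap i * (if j = t (pr i) then c (pr i) else 0) = 0"
    and tmin: "\<And>i j. \<lbrakk>i < N; j < N; j = t (pr i); i = t (pr j)\<rbrakk> \<Longrightarrow> min (pr j) i = min (pr i) j"
  proof (cases "eps = 1")
    case True
    then have pr_id: "pr i = i" if "i < N" for i using fix_iff[OF that] by simp
    define t where "t = (\<lambda>a::nat. if even a then (if Suc a < N then Suc a else a) else a - 1)"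
    define A where "A = {a. even a \<and> Suc a < N}"
    define c where "c = (\<lambda>a. if t a = a then 0 else if even a then - kap (t a) else kap (t a))"
    have t: "t a < N \<and> t (t a) = a" if "a < N" for a
    proof (cases "even a")
      case True
      then show ?thesis using that by (simp add: t_def)
    next
      case False
      then have "even (a - 1)" "Suc (a - 1) = a" by presburger+
      then show ?thesis using that False by (simp add: t_def)
    qed
    have "A = (\<lambda>b. 2 * b) ` {..<N div 2}"
    proof
      show "A \<subseteq> (\<lambda>b. 2 * b) ` {..<N div 2}"
      proof
        fix a assume a: "a \<in> A"
        then have "a = 2 * (a div 2)" "a div 2 < N div 2" unfolding A_def by auto
        then show "a \<in> (\<lambda>b. 2 * b) ` {..<N div 2}" by blast
      qed
    qed (auto simp: A_def)
    then have cardA: "card A = N div 2" by (simp add: card_image inj_on_def)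
    show ?thesis
    proof (rule that[of t A c])
      show "t a < N \<and> t (t a) = a" if "a < N" for a using t[OF that] .
      show "A \<subseteq> {..<N}" by (auto simp: A_def)
      show "card A = N div 2" by (rule cardA)
      show "a < t a" if "a \<in> A" for a using that by (simp add: A_def t_def)
      show "min (pr j) i = min (pr i) j" if "i < N" "j < N" for i j
        using pr_id that by (simp add: min.commute)
      show "c a \<noteq> 0 \<and> c (t a) \<noteq> 0" if "a \<in> A" for a
        using that kap(1) by (auto simp: A_def t_def c_def)
      fix i j assume ij: "i < N" "j < N"
      show "(if i = t (pr j) then c (pr j) else 0) * kap (pr j) + kap i * (if j = t (pr i) then c (pr i) else 0) = 0"
      proof (cases "i = t j")
        case True
        then have tt: "t i = j" using t[OF ij(2)] by simp
        show ?thesis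
        proof (cases "i = j")
          case True
          then show ?thesis using tt pr_id ij by (simp add: c_def)
        next
          case False
          have "even i \<longleftrightarrow> odd j" using tt False unfolding t_def by (auto split: if_splits)
          then show ?thesis using True tt False pr_id ij by (auto simp: c_def)
        qed
      next
        case False
        then have "j \<noteq> t i" using t[OF ij(1)] by auto
        then show ?thesis using False pr_id ij by simp
      qed
    qed
  next
    case False
    then have eps1: "eps = - 1" using eps by simp
    have pr_ne: "pr i \<noteq> i" if "i < N" for i using fix_iff[OF that] False by simp
    define A where "A = {a\<in>{..<N}. pr a < a}"
    have "(\<Sum>i<N. 1) = (\<Sum>i\<in>{i\<in>{..<N}. pr i = i}. 1) + (\<Sum>i\<in>A. 1 + (1::nat))"
      unfolding A_def by (rule involution_sum) (use pr in auto)
    moreover have "{i\<in>{..<N}. pr i = i} = {}" using pr_ne by auto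
    ultimately have "(\<Sum>i<N. 1) = (\<Sum>i\<in>A. 1 + (1::nat))" by (simp only: sum.empty add_0)
    then have "N = 2 * card A" by simp
    moreover have "bij_betw pr A {a\<in>{..<N}. a < pr a}"
      by (rule bij_betw_byWitness[where f' = pr]) (use pr in \<open>auto simp: A_def\<close>)
    ultimately have cardA: "card {a\<in>{..<N}. a < pr a} = N div 2"
      using bij_betw_same_card by fastforce
    show ?thesis
    proof (rule that[of pr "{a\<in>{..<N}. a < pr a}" "\<lambda>_. 1"])
      show "(if i = pr (pr j) then 1 else 0) * kap (pr j) + kap i * (if j = pr (pr i) then 1 else 0) = 0"
        if "i < N" "j < N" for i j
        unfolding pr(2)[OF that(1)] pr(2)[OF that(2)] kap(2)[OF that(2)] eps1 by simp
      show "min (pr j) i = min (pr i) j" if "i < N" "j < N" "j = pr (pr i)" "i = pr (pr j)" for i j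
        using pr(2)[OF that(1)] that(3) by simp
    qed (use pr cardA in simp_all, auto)
  qed
  \<comment> \<open>Both members of a pair get the same degree, so that the skewness condition on
    \<open>c\<close> carries over to \<open>D\<close>; the products \<open>h a * h (t a)\<close>
    have the distinct degrees 2a for \<open>a\<close> in \<open>A\<close>.\<close>
  define h where "h = (\<lambda>a. monom (c a) (min a (t a)))"
  let ?D = "\<lambda>a b. if b = t a then h a else 0"
  have "N div 2 \<le> E.dim (stabiliser_in in_algebra alpha)"
    unfolding alg
  proof (rule stabiliser_lower_bound[where D = ?D and X = X])
    show "Vector_Spaces.linear scale scale e \<and> skew_for N G (mat e)"
      using e_linear form_iff[OF e_linear] e_skew by simp
    show "skew_for N G X" by (rule skX)
    show "skew_for N (\<lambda>i l. [:G i l:]) ?D"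
      unfolding skew_for_def
    proof (intro allI impI)
      fix i j assume ij: "i < N" "j < N"
      have "(\<Sum>l<N. ?D l i * [:G l j:]) = (\<Sum>l<N. if l = pr j then ?D l i * [:kap l:] else 0)"
        using ij pr by (intro sum.cong) (auto simp: G_def gram)
      also have "\<dots> = ?D (pr j) i * [:kap (pr j):]" using pr(1)[OF ij(2)] by simp
      also have "\<dots> = monom ((if i = t (pr j) then c (pr j) else 0) * kap (pr j)) (min (pr j) (t (pr j)))"
        by (simp add: h_def smult_monom mult.commute)
      finally have 1: "(\<Sum>l<N. ?D l i * [:G l j:]) =
        monom ((if i = t (pr j) then c (pr j) else 0) * kap (pr j)) (min (pr j) (t (pr j)))" .
      have "(\<Sum>l<N. [:G i l:] * ?D l j) = (\<Sum>l<N. if l = pr i then [:kap i:] * ?D l j else 0)"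
        using ij by (intro sum.cong) (auto simp: G_def gram)
      also have "\<dots> = [:kap i:] * ?D (pr i) j" using pr(1)[OF ij(1)] by simp
      also have "\<dots> = monom (kap i * (if j = t (pr i) then c (pr i) else 0)) (min (pr i) (t (pr i)))"
        by (simp add: h_def smult_monom)
      finally have 2: "(\<Sum>l<N. [:G i l:] * ?D l j) =
        monom (kap i * (if j = t (pr i) then c (pr i) else 0)) (min (pr i) (t (pr i)))" .
      have z1: "(if i = t (pr j) then c (pr j) else 0) * kap (pr j) = 0 \<longleftrightarrow>
          kap i * (if j = t (pr i) then c (pr i) else 0) = 0"
        using c[OF ij] by (metis add.left_neutral add.right_neutral)
      show "(\<Sum>l<N. ?D l i * [:G l j:]) + (\<Sum>l<N. [:G i l:] * ?D l j) = 0"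
      proof (cases "kap i * (if j = t (pr i) then c (pr i) else 0) = 0")
        case True
        moreover from True have "(if i = t (pr j) then c (pr j) else 0) * kap (pr j) = 0" unfolding z1 .
        ultimately show ?thesis unfolding 1 2 by (simp only: monom_eq_0 add_0)
      next
        case False
        then have e: "j = t (pr i)" "i = t (pr j)" using z1 by (auto split: if_splits)
        have "min (pr j) (t (pr j)) = min (pr i) (t (pr i))"
          using tmin[OF ij e] e by metis
        then show ?thesis unfolding 1 2 using c[OF ij] by (simp add: add_monom)
      qed
    qed
    show "independent_family {..<N div 2} ({..<N} \<times> {..<N}) (\<lambda>j (i, l). odd_power N ?D j i l)"
    proof (rule odd_power_monomial_independent[OF t A(1,2)])
      show "h a \<noteq> 0" if "a \<in> A" for a using A(4)[OF that] by (simp add: h_def monom_eq_0_iff)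
      show "inj_on (\<lambda>a. h a * h (t a)) A"
      proof (rule inj_onI)
        fix a b assume ab: "a \<in> A" "b \<in> A" "h a * h (t a) = h b * h (t b)"
        have deg: "degree (h a * h (t a)) = a + a" if "a \<in> A" for a
          using A(3,4)[OF that] t[of a] A(1) that by (auto simp: h_def mult_monom degree_monom_eq min_def)
        have "a + a = b + b" using deg[OF ab(1)] deg[OF ab(2)] ab(3) by metis
        then show "a = b" by simp
      qed
    qed simp
    show "alpha z = mtrace N (mmul N X (mat z))"
      if "(Vector_Spaces.linear scale scale z \<and> skew_for N G (mat z)) \<and> (\<forall>v. z (e v) = e (z v))" for z
      using functional_trace[OF add scl, of z] trX[of "mat z"] that unfolding X0_def by simp
    show "(Vector_Spaces.linear scale scale (commutator f g) \<and> skew_for N G (mat (commutator f g))) \<and>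
        (\<forall>v. commutator f g (e v) = e (commutator f g v))"
      if "(Vector_Spaces.linear scale scale f \<and> skew_for N G (mat f)) \<and> (\<forall>v. f (e v) = e (f v))"
        "(Vector_Spaces.linear scale scale g \<and> skew_for N G (mat g)) \<and> (\<forall>v. g (e v) = e (g v))" for f g
      using commutator_in_algebra[of f g] that unfolding alg by blast
  qed
  then show ?thesis unfolding N .
qed

end

section \<open>The trace and the special linear algebra\<close>

context finite_dimensional_vector_space
begin

lemma endo_trace_add: "endo_trace scale Basis (f + g) = endo_trace scale Basis f + endo_trace scale Basis g"
  unfolding endo_trace_def
  by (simp add: representation_add independent_Basis span_Basis sum.distrib)

lemma endo_trace_scale: "endo_trace scale Basis (endo_scale scale c f) = c * endo_trace scale Basis f"
  unfolding endo_trace_def endo_scale_def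
  by (simp add: representation_scale independent_Basis span_Basis sum_distrib_left)

lemma basis_frame:
  assumes b: "bij_betw b {..<N} Basis"
  shows "frame scale N b (\<lambda>i v. representation Basis v (b i))"
proof (rule frame.intro[OF vector_space_axioms], rule frame_axioms.intro)
  show "Vector_Spaces.linear scale (*) (\<lambda>v. representation Basis v (b i))" for i
    unfolding Vector_Spaces.linear_iff
    by (simp add: vector_space_axioms vector_space_mult representation_add representation_scale
        independent_Basis span_Basis)
  show "representation Basis (b j) (b i) = (if i = j then 1 else 0)" if "i < N" "j < N" for i j
  proof -
    have "b j \<in> Basis" "b i = b j \<longleftrightarrow> i = j"
      using b that by (auto simp: bij_betw_def inj_on_def)
    then show ?thesis by (simp add: representation_basis[OF independent_Basis])
  qed
  show "v = (\<Sum>i<N. representation Basis v (b i) *s b i)" for v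
    using sum_representation_eq[OF independent_Basis, of v Basis] sum.reindex_bij_betw[OF b, of "\<lambda>x. representation Basis v x *s x"]
    by (simp add: span_Basis finite_Basis)
qed

lemma exists_basis_frame:
  "\<exists>b. frame scale (dim UNIV) b (\<lambda>i v. representation Basis v (b i)) \<and> bij_betw b {..<dim UNIV} Basis"
proof -
  obtain b where "bij_betw b {..<dim UNIV} Basis"
    using ex_bij_betw_nat_finite[OF finite_Basis] by (auto simp: dim_UNIV atLeast0LessThan)
  then show ?thesis using basis_frame by blast
qed

lemma endo_trace_commutator:
  assumes f: "Vector_Spaces.linear scale scale f" and g: "Vector_Spaces.linear scale scale g"
  shows "endo_trace scale Basis (commutator f g) = 0"
proof -
  obtain b where fr: "frame scale (dim UNIV) b (\<lambda>i v. representation Basis v (b i))"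
    and b: "bij_betw b {..<dim UNIV} Basis"
    using exists_basis_frame by blast
  interpret frame scale "dim UNIV" b "\<lambda>i v. representation Basis v (b i)" by (rule fr)
  have "endo_trace scale Basis (commutator f g) = (\<Sum>i<dim UNIV. mat (commutator f g) i i)"
    unfolding endo_trace_def mat_def by (rule sum.reindex_bij_betw[OF b, symmetric])
  also have "\<dots> = mtrace (dim UNIV) (mmul (dim UNIV) (mat f) (mat g)) - mtrace (dim UNIV) (mmul (dim UNIV) (mat g) (mat f))"
    by (simp add: mat_commutator[OF f g] mtrace_def sum_subtractf)
  also have "\<dots> = 0" by (simp add: mtrace_commute)
  finally show ?thesis .
qed

lemma linear_id_scale: "Vector_Spaces.linear scale scale (\<lambda>v. c *s v)"
  unfolding Vector_Spaces.linear_iff by (simp add: vector_space_axioms scale_right_distrib mult.commute)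

text \<open>If the identity had trace 0, the scalars would form a central ideal. By simplicity this
  ideal is 0, and then the space is 0, or it is everything; in both cases all commutators
  vanish.\<close>

lemma simple_special_linear_trace_id:
  assumes "simple_lie_algebra (endo_scale scale) commutator (special_linear scale Basis)"
  shows "endo_trace scale Basis (\<lambda>v. v) \<noteq> 0"
proof
  assume tr: "endo_trace scale Basis (\<lambda>v. v) = 0"
  interpret L: simple_lie_algebra "endo_scale scale" commutator "special_linear scale Basis" by (rule assms)
  let ?I = "range (\<lambda>c v. c *s v)"
  have lin: "Vector_Spaces.linear scale scale x" if "x \<in> special_linear scale Basis" for x
    using that by (simp add: special_linear_def)
  have central: "commutator x y = 0" if x: "x \<in> special_linear scale Basis" and y: "y \<in> ?I" for x y
    using y linear_map_scale[OF lin[OF x]] by (auto simp: commutator_def fun_eq_iff)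
  have zero: "(0::'b \<Rightarrow> 'b) \<in> ?I" by (rule range_eqI[of _ _ 0]) (simp add: fun_eq_iff)
  have "?I = {0} \<or> ?I = special_linear scale Basis"
  proof (rule L.ideals_trivial)
    show "L.subspace ?I"
    proof (rule L.subspaceI)
      show "0 \<in> ?I" by (rule zero)
      show "x + y \<in> ?I" if xy: "x \<in> ?I" "y \<in> ?I" for x y
      proof -
        obtain c d where "x = (\<lambda>v. c *s v)" "y = (\<lambda>v. d *s v)" using xy by blast
        then have "x + y = (\<lambda>v. (c + d) *s v)" by (simp add: fun_eq_iff scale_left_distrib)
        then show ?thesis by blast
      qed
      show "endo_scale scale c x \<in> ?I" if x: "x \<in> ?I" for c x
      proof -
        obtain d where "x = (\<lambda>v. d *s v)" using x by blast
        then have "endo_scale scale c x = (\<lambda>v. (c * d) *s v)" by (simp add: fun_eq_iff endo_scale_def)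
        then show ?thesis by blast
      qed
    qed
    show "?I \<subseteq> special_linear scale Basis"
      using linear_id_scale endo_trace_scale[of _ "\<lambda>v. v"] tr by (auto simp: special_linear_def endo_scale_def)
    show "commutator x y \<in> ?I" if "x \<in> special_linear scale Basis" "y \<in> ?I" for x y
      using central[OF that] zero by simp
  qed
  then have "\<forall>x\<in>special_linear scale Basis. \<forall>y\<in>special_linear scale Basis. commutator x y = 0"
  proof
    assume "?I = {0}"
    moreover have "(\<lambda>v. 1 *s v) \<in> ?I" by blast
    ultimately have "(\<lambda>v. 1 *s v) = (0 :: 'b \<Rightarrow> 'b)" by blast
    then have "v = (0::'b)" for v by (simp add: fun_eq_iff)
    then have "commutator x y v = 0" for x y :: "'b \<Rightarrow> 'b" and v by (rule allE[OF allI])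
    then show ?thesis by (simp add: fun_eq_iff)
  next
    assume "?I = special_linear scale Basis"
    then show ?thesis using central by blast
  qed
  then show False using L.not_abelian by blast
qed

text \<open>Restricting a stabiliser in the centraliser \<open>Q\<close> in gl to trace zero costs
  at most one dimension, which gives the lower bound. Conversely \<open>Q\<close> is spanned by its
  trace-zero part \<open>P\<close> and the identity, and scalars commute with everything. So the
  stabiliser in \<open>P\<close> and the identity both lie in the stabiliser in \<open>Q\<close>,
  and the former is smaller by at least one dimension.\<close>

lemma special_linear_centraliser_index:
  assumes e: "Vector_Spaces.linear scale scale e" "nilpotent_endo e"
    and K: "infinite (UNIV :: 'a set) \<or> num_jordan_blocks scale e \<le> card (UNIV :: 'a set)"
    and tr: "endo_trace scale Basis (\<lambda>v. v) \<noteq> 0"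
  shows "lie_index (endo_scale scale) commutator
    {f. (Vector_Spaces.linear scale scale f \<and> endo_trace scale Basis f = 0) \<and> (\<forall>v. f (e v) = e (f v))} = dim UNIV - 1"
proof -
  define Q where "Q = (\<lambda>f. Vector_Spaces.linear scale scale f \<and> (\<forall>v. f (e v) = e (f v)))"
  define P where "P = (\<lambda>f. (Vector_Spaces.linear scale scale f \<and> endo_trace scale Basis f = 0) \<and> (\<forall>v. f (e v) = e (f v)))"
  have PQ: "P f \<longleftrightarrow> Q f \<and> endo_trace scale Basis f = 0" for f by (auto simp: P_def Q_def)
  interpret E: vector_space "endo_scale scale" by (rule vector_space_endo[OF vector_space_axioms])
  obtain b where fr: "frame scale (dim UNIV) b (\<lambda>i v. representation Basis v (b i))"
    using exists_basis_frame by blast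
  interpret fr: frame scale "dim UNIV" b "\<lambda>i v. representation Basis v (b i)" by (rule fr)
  have Q0: "Q 0" and Qadd: "\<And>f g. Q f \<Longrightarrow> Q g \<Longrightarrow> Q (f + g)" and Qscale: "\<And>c f. Q f \<Longrightarrow> Q (endo_scale scale c f)"
    unfolding Q_def Vector_Spaces.linear_iff
    by (simp_all add: vector_space_axioms linear_map_zero[OF e(1)] linear_map_add[OF e(1)] linear_map_scale[OF e(1)]
        endo_scale_def scale_right_distrib mult.commute add_ac)
  have tr0: "endo_trace scale Basis 0 = 0" using endo_trace_scale[of 0 "\<lambda>v. v"] by (simp add: endo_scale_def zero_fun_def)
  have subP: "E.subspace {f. P f}"
    unfolding PQ using Q0 Qadd Qscale by (intro E.subspaceI) (auto simp: endo_trace_add endo_trace_scale tr0)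
  have commP: "P (commutator f g)" if "Q f" "Q g" for f g
  proof -
    have lin: "Vector_Spaces.linear scale scale f" "Vector_Spaces.linear scale scale g"
      and ce: "\<And>v. f (e v) = e (f v)" "\<And>v. g (e v) = e (g v)" using that by (auto simp: Q_def)
    have "Q (commutator f g)"
      unfolding Q_def Vector_Spaces.linear_iff commutator_def
      by (intro conjI allI vector_space_axioms)
        (simp_all add: linear_map_add[OF lin(1)] linear_map_add[OF lin(2)] linear_map_scale[OF lin(1)]
          linear_map_scale[OF lin(2)] scale_right_diff_distrib ce linear_map_diff[OF e(1)])
    then show ?thesis using endo_trace_commutator[OF lin] by (simp add: PQ)
  qed
  have Qspan: "{f. Q f} \<subseteq> E.span fr.units" using fr.linear_in_span by (auto simp: Q_def)
  have "lie_index (endo_scale scale) commutator {f. P f} = dim UNIV - 1"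
  proof (rule lie_index_eqI[OF vector_space_axioms subP])
    show "P (commutator f g)" if "P f" "P g" for f g using commP that by (simp add: PQ)
  next
    fix alpha :: "('b \<Rightarrow> 'b) \<Rightarrow> 'a"
    assume add: "\<And>f g. alpha (f + g) = alpha f + alpha g" and scl: "\<And>c f. alpha (endo_scale scale c f) = c * alpha f"
    let ?S = "stabiliser_in Q alpha"
    have sub: "E.subspace ?S"
      by (rule subspace_stabiliser_in[OF vector_space_axioms _ Q0 Qadd Qscale add scl]) (simp add: Q_def)
    have "dim UNIV \<le> E.dim ?S"
      unfolding Q_def by (rule fr.general_linear_lower_bound[OF add scl e(1)])
    also have "\<dots> \<le> E.dim (?S \<inter> {f. endo_trace scale Basis f = 0}) + 1"
      using Qspan by (intro E.dim_le_Suc_dim_kernel[OF sub _ fr.finite_units endo_trace_add endo_trace_scale])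
        (auto simp: stabiliser_in_def)
    also have "E.dim (?S \<inter> {f. endo_trace scale Basis f = 0}) \<le> E.dim (stabiliser_in P alpha)"
      using Qspan by (intro E.dim_mono_finite[OF _ _ fr.finite_units]) (auto simp: stabiliser_in_def PQ)
    finally show "dim UNIV - 1 \<le> E.dim (stabiliser_in P alpha)" by simp
  next
    obtain k n w phi where js: "jordan_system scale e k n w phi" using exists_jordan_system[OF e] by blast
    interpret js: jordan_system scale e k n w phi by (rule js)
    have cQ: "js.centralising = Q" unfolding js.centralising_def Q_def by (intro ext) simp
    obtain alpha where alpha: "\<And>f g. alpha (f + g) = alpha f + (alpha g :: 'a)"
      "\<And>c f. alpha (endo_scale scale c f) = c * alpha f" "E.dim (stabiliser_in Q alpha) \<le> dim UNIV"
      using js.general_linear_upper_bound K unfolding cQ js.num_blocks by blast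
    let ?id = "\<lambda>v. v :: 'b"
    have Qid: "Q ?id" by (simp add: Q_def Vector_Spaces.linear_iff vector_space_axioms)
    have split: "\<exists>c g'. P g' \<and> g = g' + endo_scale scale c ?id" if "Q g" for g
    proof -
      let ?c = "endo_trace scale Basis g / endo_trace scale Basis ?id"
      let ?g = "g + endo_scale scale (- ?c) ?id"
      have "endo_trace scale Basis ?g = 0" using tr by (simp only: endo_trace_add endo_trace_scale) simp
      then have "P ?g" using Qadd[OF that Qscale[OF Qid]] by (simp only: PQ)
      moreover have "g = ?g + endo_scale scale ?c ?id" by (simp add: fun_eq_iff endo_scale_def)
      ultimately show ?thesis by blast
    qed
    have a0: "alpha 0 = 0" using alpha(2)[of 0 0] by simp
    have cid: "commutator f (g' + endo_scale scale c ?id) = commutator f g'" if "Q f" for f g' c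
      using that linear_map_add[of scale scale f] linear_map_scale[of scale scale f]
      by (simp add: Q_def commutator_def endo_scale_def fun_eq_iff)
    have PS: "stabiliser_in P alpha \<subseteq> stabiliser_in Q alpha"
    proof
      fix f assume f: "f \<in> stabiliser_in P alpha"
      then have Qf: "Q f" by (simp add: stabiliser_in_def PQ)
      have "alpha (commutator f g) = 0" if g: "Q g" for g
      proof -
        obtain c g' where "P g'" "g = g' + endo_scale scale c ?id" using split[OF g] by blast
        then show ?thesis using f cid[OF Qf] by (simp add: stabiliser_in_def)
      qed
      then show "f \<in> stabiliser_in Q alpha" using Qf by (simp add: stabiliser_in_def)
    qed
    have idS: "?id \<in> stabiliser_in Q alpha"
      using Qid a0 by (simp add: stabiliser_in_def commutator_def zero_fun_def)
    obtain C where C: "C \<subseteq> stabiliser_in P alpha" "E.independent C" "card C = E.dim (stabiliser_in P alpha)"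
      using E.basis_exists by metis
    have "E.span C \<subseteq> {f. P f}"
      using C(1) subP by (intro E.span_minimal) (auto simp: stabiliser_in_def)
    then have nid: "?id \<notin> E.span C" using tr by (auto simp: PQ)
    have ind: "E.independent (insert ?id C)" using C(2) nid by (rule E.independent_insertI[rotated])
    have "finite (insert ?id C) \<and> card (insert ?id C) \<le> E.dim (stabiliser_in Q alpha)"
      using Qspan C(1) PS idS
      by (intro E.card_le_dim[OF ind _ _ fr.finite_units]) (auto simp: stabiliser_in_def)
    moreover have "?id \<notin> C" using nid E.span_base by blast
    ultimately have "E.dim (stabiliser_in P alpha) + 1 \<le> dim UNIV" using C(3) alpha(3) by auto
    then have "E.dim (stabiliser_in P alpha) \<le> dim UNIV - 1" by simp
    then show "\<exists>alpha :: ('b \<Rightarrow> 'b) \<Rightarrow> 'a. (\<forall>f g. alpha (f + g) = alpha f + alpha g) \<and>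
        (\<forall>c f. alpha (endo_scale scale c f) = c * alpha f) \<and>
      E.dim (stabiliser_in P alpha) \<le> dim UNIV - 1"
      using alpha(1,2) by blast
  qed
  then show ?thesis unfolding P_def .
qed

end

theorem (in skew_nilpotent) form_centraliser_index:
  assumes K: "infinite (UNIV :: 'k set) \<or> num_jordan_blocks scale e \<le> card (UNIV :: 'k set)"
  shows "lie_index (endo_scale scale) commutator {f. in_algebra f} = dim UNIV div 2"
proof (rule lie_index_eqI[OF vector_space_axioms])
  interpret E: vector_space "endo_scale scale" by (rule vector_space_endo[OF vector_space_axioms])
  show "E.subspace {f. in_algebra f}"
    using in_algebra_closed by (intro E.subspaceI) auto
  show "in_algebra (commutator f g)" if "in_algebra f" "in_algebra g" for f g
    by (rule commutator_in_algebra[OF that])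
  show "dim UNIV div 2 \<le> E.dim (stabiliser_in in_algebra alpha)"
    if "\<And>f g. alpha (f + g) = alpha f + (alpha g :: 'k)" "\<And>c f. alpha (endo_scale scale c f) = c * alpha f" for alpha
    by (rule form_lower_bound[OF that])
  obtain k n w pr kap where g: "gram_on UNIV k n w pr kap" using exists_gram by blast
  interpret js: jordan_system scale e k n w "\<lambda>i v. B v (w (pr i)) / kap i" by (rule gram_jordan_system[OF g])
  have K': "infinite (UNIV :: 'k set) \<or> k \<le> card (UNIV :: 'k set)" using K unfolding js.num_blocks .
  show "\<exists>alpha. (\<forall>f g. alpha (f + g) = alpha f + (alpha g :: 'k)) \<and>
      (\<forall>c f. alpha (endo_scale scale c f) = c * alpha f) \<and>
      E.dim (stabiliser_in in_algebra alpha) \<le> dim UNIV div 2"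
    using eps symplectic_upper_bound[OF g _ K'] orthogonal_upper_bound[OF g _ K'] by blast
qed

lemma form_algebra_centraliser_index:
  fixes scale :: "'k::field \<Rightarrow> 'v::ab_group_add \<Rightarrow> 'v"
  assumes fd: "finite_dimensional_vector_space scale Basis"
    and B: "bilinear_form scale B" "nondegenerate B" "\<And>v x. B v x = eps * B x v" and eps: "eps = 1 \<or> eps = - 1"
    and e: "e \<in> form_algebra scale B" "nilpotent_endo e"
    and K: "infinite (UNIV :: 'k set) \<or> num_jordan_blocks scale e \<le> card (UNIV :: 'k set)"
    and two: "CHAR('k) \<noteq> 2"
  shows "lie_index (endo_scale scale) commutator (lie_centraliser commutator (form_algebra scale B) e) =
    vector_space.dim scale UNIV div 2"
proof -
  have two': "(2::'k) \<noteq> 0"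
  proof
    assume "(2::'k) = 0"
    then have "of_nat 2 = (0::'k)" by simp
    then have "CHAR('k) dvd 2" by (simp only: of_nat_eq_0_iff_char_dvd)
    then have "CHAR('k) \<noteq> 0" "CHAR('k) \<le> 2" using dvd_imp_le[of "CHAR('k)" 2] by (auto intro: gr0I)
    then have "CHAR('k) = 1" using two by linarith
    then have "of_nat 1 = (0::'k)" by (simp only: of_nat_eq_0_iff_char_dvd) simp
    then show False by simp
  qed
  interpret skew_nilpotent scale Basis B eps e
  proof (rule skew_nilpotent.intro[OF fd], rule skew_nilpotent_axioms.intro)
    show "v = 0" if "\<And>x. B v x = 0" for v using B(2) that unfolding nondegenerate_def by blast
    show "B (e v) x = - B v (e x)" for v x using e(1) by (simp add: form_algebra_def eq_neg_iff_add_eq_0)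
    show "B v x = eps * B x v" for v x by (rule B(3))
  qed (use B(1) eps two' e in \<open>simp_all add: bilinear_form_def form_algebra_def\<close>)
  have "lie_centraliser commutator (form_algebra scale B) e = {f. in_algebra f}"
    unfolding lie_centraliser_def form_algebra_def in_algebra_def
    by (simp add: commutator_def fun_eq_iff)
  then show ?thesis using form_centraliser_index[OF K] by simp
qed

theorem mainTheorem1:
  fixes scale :: "'k::field \<Rightarrow> 'v::ab_group_add \<Rightarrow> 'v"
    and Basis :: "'v set"
    and G :: "('k, 'v) classical_type"
    and g :: "('v \<Rightarrow> 'v) set"
    and e :: "'v \<Rightarrow> 'v"
    and k :: nat
  assumes "finite_dimensional_vector_space scale Basis"
    and "admissible_type scale G"
    and "g = classical_algebra scale Basis G"
    and "simple_lie_algebra (endo_scale scale) commutator g"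
    and "e \<in> g"
    and "nilpotent_endo e"
    and "k = num_jordan_blocks scale e"
    and "infinite (UNIV :: 'k set) \<or> card (UNIV :: 'k set) \<ge> k"
    and "G \<noteq> SL \<Longrightarrow> CHAR('k) \<noteq> 2"
  shows "lie_index (endo_scale scale) commutator (lie_centraliser commutator g e) =
    classical_rank scale G"
proof -
  interpret finite_dimensional_vector_space scale Basis by (rule assms(1))
  have K: "infinite (UNIV :: 'k set) \<or> num_jordan_blocks scale e \<le> card (UNIV :: 'k set)"
    using assms(7,8) by simp
  show ?thesis
  proof (cases G)
    case SL
    have tr: "endo_trace scale Basis (\<lambda>v. v) \<noteq> 0"
      using simple_special_linear_trace_id assms(3,4) SL by simp
    have lin: "Vector_Spaces.linear scale scale e"
      using assms(3,5) SL by (simp add: special_linear_def)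
    have "lie_centraliser commutator g e =
        {f. (Vector_Spaces.linear scale scale f \<and> endo_trace scale Basis f = 0) \<and> (\<forall>v. f (e v) = e (f v))}"
      using assms(3) SL by (auto simp: lie_centraliser_def special_linear_def commutator_def fun_eq_iff)
    then show ?thesis using special_linear_centraliser_index[OF lin assms(6) K tr] SL by simp
  next
    case (SO B)
    have form: "bilinear_form scale B" "nondegenerate B" "\<forall>v x. B v x = B x v"
      using assms(2) unfolding SO admissible_type.simps by blast+
    have sym: "B v x = 1 * B x v" for v x unfolding mult_1 mult_minus1 using form(3) by blast
    have e: "e \<in> form_algebra scale B" and char: "CHAR('k) \<noteq> 2" using assms(3,5,9) SO by simp_all
    show ?thesis
      unfolding assms(3) SO classical_algebra.simps classical_rank.simps
      by (rule form_algebra_centraliser_index[OF assms(1) form(1,2) sym _ e assms(6) K char]) simp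
  next
    case (SP B)
    have form: "bilinear_form scale B" "nondegenerate B" "\<forall>v x. B v x = - B x v"
      using assms(2) unfolding SP admissible_type.simps by blast+
    have sym: "B v x = - 1 * B x v" for v x unfolding mult_1 mult_minus1 using form(3) by blast
    have e: "e \<in> form_algebra scale B" and char: "CHAR('k) \<noteq> 2" using assms(3,5,9) SP by simp_all
    show ?thesis
      unfolding assms(3) SP classical_algebra.simps classical_rank.simps
      by (rule form_algebra_centraliser_index[OF assms(1) form(1,2) sym _ e assms(6) K char]) simp
  qed
qed

end
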